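(* Let $\mathcal{P}_3$ be the probability that a random symmetric $4\times 4$ matrix $\Delta_3$ with zeros on the main diagonal, whose six entries above the diagonal are independent and uniformly distributed in $[0,1]$, is the distance matrix of a tetrahedron in the Euclidean space $\mathbb{E}^3$. Then $$0.090\le\mathcal{P}_3\le 0.111.$$
   Context: A symmetric $4\times4$ matrix $(\delta_{i,j})_{0\le i,j\le 3}$ is the distance matrix of a tetrahedron (3-dimensional simplex) in $\mathbb{E}^3$ if there are four affinely independent points $p_0,\dots,p_3\in\mathbb{R}^3$ with Euclidean distances $\|p_i-p_j\|=\delta_{i,j}$ for all $i,j$. *)

theory Defs
  imports "HOL-Probability.Probability"
begin

text \<open>
  Matrix rows and columns are indexed by the numeral type \<open>4\<close>, whose elements are
  \<open>0, 1, 2, 3\<close> in this order. Affine dependence is a property of sets, hence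
  injectivity is required separately for the family \<open>p\<close> to be affinely independent.
\<close>

definition tetrahedron_distance_matrix :: "real ^ 4 ^ 4 \<Rightarrow> bool" where
  "tetrahedron_distance_matrix \<Delta> \<longleftrightarrow>
     (\<exists>p :: 4 \<Rightarrow> real ^ 3. inj p \<and> \<not> affine_dependent (range p) \<and>
        (\<forall>i j. dist (p i) (p j) = \<Delta> $ i $ j))"

end

theory Submission
  imports Defs
begin

text \<open>
  Being the distance matrix of a tetrahedron is invariant under scaling, so the six edge lengths
  range over a cone. Cut it into six pieces according to which edge is the longest. Each piece,
  intersected with the unit cube, is a cone over the facet on which the longest edge has length
  \<open>1\<close>, and by relabelling the vertices all six facets have the same five-dimensional volume
  \<open>K\<close>. A cone over a facet of volume \<open>K\<close> in dimension six has volume \<open>K / 6\<close>, hence the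
  probability equals \<open>K\<close> (\<open>emeasure_tetrahedron\<close>, with \<open>K\<close> written \<open>flap_volume {0..1}\<close>).

  On the facet, the longest edge carries two triangles with remaining sides at most \<open>1\<close>. Put the
  edge on the \<open>x\<close>-axis with its midpoint at the origin; a triangle \<open>q\<close> is then described by the
  abscissa \<open>u\<close> and the altitude \<open>h\<close> of its apex. When the two triangles are
  rotated against each other about the common edge, the distance of the apexes sweeps the interval
  between the two flat positions, \<open>near_dist\<close> and \<open>far_dist\<close>, and the endpoints belong to
  degenerate tetrahedra (\<open>tetrahedron_iff_flap\<close>). As this distance is at most \<open>1\<close>, \<open>K\<close> is the
  double integral over all pairs of triangles of
  \<open>gap q q' = min 1 (far_dist q q') - near_dist q q'\<close> (\<open>flap_volume_eq_double_integral\<close>). With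
  \<open>r = u\<^sup>2 + h\<^sup>2\<close> one has \<open>far\<^sup>2 = r + r' - 2 u u' + 2 h h'\<close> and
  \<open>near\<^sup>2 = r + r' - 2 u u' - 2 h h'\<close>: both are sums of products of a function of \<open>q\<close> and a
  function of \<open>q'\<close>. So every bound for the gap that is polynomial in these squares, or linear
  in \<open>u\<close> and \<open>h\<close>, turns the double integral into products of moments over single triangles.

  For the lower bound the gap is minorised by a quadratic polynomial in the two squares
  (\<open>gap_ge_polynomial\<close>) that vanishes with \<open>far\<^sup>2 - near\<^sup>2 = 4 h h'\<close>. After integration only the
  integrals of \<open>h\<close>, \<open>r h\<close> and \<open>h\<^sup>2\<close> over all triangles matter (\<open>gap_pair_lower\<close>), and these are
  bounded by integrals of explicit elementary functions (\<open>flap_volume_ge\<close>).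

  For the upper bound the triangles are divided by the square grid of mesh \<open>1/8\<close> in the two
  sides. On a pair of cells, Jensen's inequality bounds the mean of \<open>near_dist\<close> from below by the
  distance of the mean apexes and the mean of \<open>min 1 far_dist\<close> from above by the square root of
  the mean of \<open>far\<^sup>2\<close> (\<open>cell_pair_bound\<close>). This uses the means of \<open>r\<close> and \<open>u\<close> over each cell, which
  are rational, and bounds for the mean of \<open>h\<close>, obtained from the mean of \<open>h\<^sup>2 = r - u\<^sup>2\<close>. The sum
  over all pairs is then a finite computation with integers (\<open>flap_volume_le\<close>).
\<close>

section \<open>Two triangles on a common unit edge\<close>

text \<open>
  The apex of the triangle over the unit segment from \<open>(-1/2, 0)\<close> to \<open>(1/2, 0)\<close> whose distances
  from these endpoints are the components of \<open>q\<close>; the altitude is Heron's formula.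
\<close>

definition abscissa :: "real \<times> real \<Rightarrow> real" where
  "abscissa q = ((fst q)\<^sup>2 - (snd q)\<^sup>2) / 2"

definition altitude :: "real \<times> real \<Rightarrow> real" where
  "altitude q = sqrt (((fst q + snd q)\<^sup>2 - 1) * (1 - (fst q - snd q)\<^sup>2)) / 2"

text \<open>
  The distance of the apexes when both triangles lie in one plane, on the same side of the common
  edge (near) or on opposite sides (far).
\<close>

definition near_dist :: "real \<times> real \<Rightarrow> real \<times> real \<Rightarrow> real" where
  "near_dist q q' = sqrt ((abscissa q - abscissa q')\<^sup>2 + (altitude q - altitude q')\<^sup>2)"

definition far_dist :: "real \<times> real \<Rightarrow> real \<times> real \<Rightarrow> real" where
  "far_dist q q' = sqrt ((abscissa q - abscissa q')\<^sup>2 + (altitude q + altitude q')\<^sup>2)"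

text \<open>
  Both components are automatically positive: neither exceeds \<open>1\<close> and their sum does.
\<close>

definition triangles :: "(real \<times> real) set" where
  "triangles = {q. fst q \<le> 1 \<and> snd q \<le> 1 \<and> 1 < fst q + snd q}"

lemma UNIV_four: "(UNIV :: 4 set) = {0, 1, 2, 3}"
proof -
  have "(4::4) = 0" by simp
  then have "x \<in> {0, 1, 2, 3}" for x :: 4 using exhaust_4[of x] by auto
  then show ?thesis by blast
qed

lemma all_four: "(\<forall>i::4. P i) \<longleftrightarrow> P 0 \<and> P 1 \<and> P 2 \<and> P 3"
  using UNIV_four by (metis UNIV_I empty_iff insert_iff)

text \<open>
  The order on a numeral type is inherited from the representing integers; the simplifier does not
  know it for concrete elements.
\<close>

lemma order_four: "(0::4) < 1" "(0::4) < 2" "(0::4) < 3" "(1::4) < 2" "(1::4) < 3" "(2::4) < 3"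
  by (simp_all only: less_bit0_def bit0.Rep_0 bit0.Rep_1 bit0.Rep_numeral) simp_all

lemma edges_four: "{(i, j). i < (j::4)} = {(0,1), (0,2), (1,2), (0,3), (1,3), (2,3)}"
proof -
  have "\<forall>i j::4. i < j \<longleftrightarrow> (i, j) \<in> {(0,1), (0,2), (1,2), (0,3), (1,3), (2,3)}"
    unfolding all_four by (simp add: order_four order_four[THEN less_not_sym])
  then show ?thesis by blast
qed

lemma altitude_square:
  assumes "q \<in> triangles" shows "(altitude q)\<^sup>2 = ((fst q + snd q)\<^sup>2 - 1) * (1 - (fst q - snd q)\<^sup>2) / 4"
    and "0 < altitude q"
proof -
  obtain x y where q: "q = (x, y)" by force
  have a: "x \<le> 1" "y \<le> 1" "1 < x + y" using assms by (auto simp: triangles_def q)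
  have "1 < (x+y)\<^sup>2" using a by (simp add: one_less_power)
  moreover have "(x - y)\<^sup>2 < 1" using a by (simp add: abs_square_less_1 abs_less_iff)
  ultimately have p: "((x+y)\<^sup>2 - 1) * (1 - (x - y)\<^sup>2) > 0" by simp
  show "(altitude q)\<^sup>2 = ((fst q + snd q)\<^sup>2 - 1) * (1 - (fst q - snd q)\<^sup>2) / 4" "0 < altitude q"
    using p by (simp_all add: altitude_def q power_divide)
qed

lemma half_square: "(c / 2 + 1 / 2)\<^sup>2 = (c + 1)\<^sup>2 / 4" "(c / 2 - 1 / 2)\<^sup>2 = (c - 1)\<^sup>2 / 4" for c :: real
  by (simp_all add: power2_eq_square field_simps)

lemma sides_from_apex:
  assumes "q \<in> triangles"
  shows "(abscissa q + 1/2)\<^sup>2 + (altitude q)\<^sup>2 = (fst q)\<^sup>2" "(abscissa q - 1/2)\<^sup>2 + (altitude q)\<^sup>2 = (snd q)\<^sup>2"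
proof -
  obtain a b where q: "q = (a, b)" by force
  have "(abscissa q + 1/2)\<^sup>2 = (a\<^sup>2 - b\<^sup>2 + 1)\<^sup>2 / 4" "(abscissa q - 1/2)\<^sup>2 = (a\<^sup>2 - b\<^sup>2 - 1)\<^sup>2 / 4"
    by (simp_all only: q abscissa_def fst_conv snd_conv half_square)
  moreover have "(a\<^sup>2 - b\<^sup>2 + 1)\<^sup>2 + ((a + b)\<^sup>2 - 1) * (1 - (a - b)\<^sup>2) = 4 * a\<^sup>2"
    "(a\<^sup>2 - b\<^sup>2 - 1)\<^sup>2 + ((a + b)\<^sup>2 - 1) * (1 - (a - b)\<^sup>2) = 4 * b\<^sup>2" by algebra+
  ultimately show "(abscissa q + 1/2)\<^sup>2 + (altitude q)\<^sup>2 = (fst q)\<^sup>2" "(abscissa q - 1/2)\<^sup>2 + (altitude q)\<^sup>2 = (snd q)\<^sup>2"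
    using altitude_square(1)[OF assms] unfolding q fst_conv snd_conv by linarith+
qed

lemma power2_eq_far_near: "(a - b)\<^sup>2 + (c + d)\<^sup>2 = (a - b)\<^sup>2 + (c - d)\<^sup>2 + 4 * c * d" for a b c d :: real
  by algebra

lemma far_minus_near: "(far_dist q q')\<^sup>2 = (near_dist q q')\<^sup>2 + 4 * altitude q * altitude q'"
  unfolding far_dist_def near_dist_def real_sqrt_pow2[OF sum_power2_ge_zero]
  by (rule power2_eq_far_near)

text \<open>
  Project \<open>b\<close> and \<open>c\<close> orthogonally to the unit vector \<open>a\<close>. The projections have the altitudes as
  norms, and the squared distance of \<open>b\<close> and \<open>c\<close> is a constant minus twice the inner product of the
  projections. The Cauchy--Schwarz inequality confines that product to an interval, strictly because
  the projections are not collinear. This holds in every inner product space and gives the necessity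
  of the flap inequalities.
\<close>

lemma flap_bounds:
  fixes a b c :: "'b::real_inner"
  assumes a: "norm a = 1" and "norm b \<le> 1" "norm (b - a) \<le> 1" "norm c \<le> 1" "norm (c - a) \<le> 1"
    and nb: "\<And>s. b \<noteq> s *\<^sub>R a" and nc: "\<And>s. c \<noteq> s *\<^sub>R a"
    and nbc: "\<And>s t. b \<noteq> s *\<^sub>R a + t *\<^sub>R c"
  defines "q \<equiv> (norm b, norm (b - a))" and "q' \<equiv> (norm c, norm (c - a))"
  shows "q \<in> triangles \<and> q' \<in> triangles \<and> near_dist q q' < norm (b - c) \<and> norm (b - c) < far_dist q q'"
proof -
  have aa: "a \<bullet> a = 1" using a by (simp add: norm_eq_1)
  have U: "d \<bullet> a = abscissa (norm d, norm (d - a)) + 1/2" for d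
  proof -
    have "(norm (d - a))\<^sup>2 = (norm d)\<^sup>2 - 2 * (d \<bullet> a) + 1"
      using aa by (simp add: power2_norm_eq_inner inner_diff inner_commute)
    then show ?thesis by (simp add: abscissa_def field_simps)
  qed
  have P: "(norm (d - (d \<bullet> a) *\<^sub>R a))\<^sup>2 =
     ((norm d + norm (d - a))\<^sup>2 - 1) * (1 - (norm d - norm (d - a))\<^sup>2) / 4" for d
  proof -
    define x y where "x = norm d" and "y = norm (d - a)"
    have x: "d \<bullet> d = x\<^sup>2" by (simp add: x_def power2_norm_eq_inner)
    have da: "d \<bullet> a = (x\<^sup>2 - y\<^sup>2) / 2 + 1/2" using U[of d] by (simp add: abscissa_def x_def y_def)
    have "(norm (d - (d \<bullet> a) *\<^sub>R a))\<^sup>2 = d \<bullet> d - (d \<bullet> a)\<^sup>2"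
      unfolding power2_norm_eq_inner by (simp add: inner_diff aa inner_commute power2_eq_square)
    also have "\<dots> = ((x + y)\<^sup>2 - 1) * (1 - (x - y)\<^sup>2) / 4"
    proof -
      have "((x\<^sup>2 - y\<^sup>2) / 2 + 1/2)\<^sup>2 = (x\<^sup>2 - y\<^sup>2 + 1)\<^sup>2 / 4"
        by (rule half_square)
      moreover have "(x\<^sup>2 - y\<^sup>2 + 1)\<^sup>2 + ((x + y)\<^sup>2 - 1) * (1 - (x - y)\<^sup>2) = 4 * x\<^sup>2" by algebra
      ultimately show ?thesis unfolding x da by linarith
    qed
    finally show ?thesis unfolding x_def y_def .
  qed
  have T: "(norm d, norm (d - a)) \<in> triangles" if "norm d \<le> 1" "norm (d - a) \<le> 1" "\<And>s. d \<noteq> s *\<^sub>R a" for d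
  proof -
    have "norm (d - (d \<bullet> a) *\<^sub>R a) > 0" using that(3)[of "d \<bullet> a"] by simp
    then have pos: "((norm d + norm (d - a))\<^sup>2 - 1) * (1 - (norm d - norm (d - a))\<^sup>2) > 0"
      using P[of d] by (smt (verit) divide_nonpos_pos zero_less_power)
    have "(norm d - norm (d - a))\<^sup>2 \<le> 1" using that(1,2) norm_ge_zero[of d] norm_ge_zero[of "d - a"]
      by (subst abs_square_le_1) linarith
    then have "(norm d + norm (d - a))\<^sup>2 > 1" using pos by (auto simp: zero_less_mult_iff)
    then have "norm d + norm (d - a) > 1"
      using power_le_one[of "norm d + norm (d - a)" 2] by fastforce
    then show ?thesis using that by (simp add: triangles_def)
  qed
  have N: "norm (d - (d \<bullet> a) *\<^sub>R a) = altitude (norm d, norm (d - a))" if "norm d \<le> 1" "norm (d - a) \<le> 1" "\<And>s. d \<noteq> s *\<^sub>R a" for d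
  proof (rule power2_eq_imp_eq)
    show "(norm (d - (d \<bullet> a) *\<^sub>R a))\<^sup>2 = (altitude (norm d, norm (d - a)))\<^sup>2"
      using P[of d] altitude_square(1)[OF T[OF that]] by simp
  qed (use altitude_square(2)[OF T[OF that]] in auto)
  define b' c' where "b' = b - (b \<bullet> a) *\<^sub>R a" and "c' = c - (c \<bullet> a) *\<^sub>R a"
  have q: "q \<in> triangles" "q' \<in> triangles" using T assms by (auto simp: q_def q'_def)
  have nb': "norm b' = altitude q" "norm c' = altitude q'" using N assms unfolding b'_def c'_def q_def q'_def by blast+
  have c0: "c' \<noteq> 0" using nc by (auto simp: c'_def)
  have np: "\<bar>b' \<bullet> c'\<bar> < norm b' * norm c'"
  proof -
    have "\<bar>b' \<bullet> c'\<bar> \<noteq> norm b' * norm c'"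
    proof
      assume "\<bar>b' \<bullet> c'\<bar> = norm b' * norm c'"
      then have "collinear {0, b', c'}" by (simp add: norm_cauchy_schwarz_equal)
      then have "collinear {0, c', b'}" by (simp add: insert_commute)
      then obtain k where "b' = k *\<^sub>R c'" using c0 unfolding collinear_lemma by (metis scaleR_zero_left)
      then have "b = ((b \<bullet> a) - k * (c \<bullet> a)) *\<^sub>R a + k *\<^sub>R c" by (simp add: b'_def c'_def algebra_simps)
      then show False using nbc by blast
    qed
    then show ?thesis using Cauchy_Schwarz_ineq2[of b' c'] by linarith
  qed
  have f: "(norm (b - c))\<^sup>2 = (abscissa q - abscissa q')\<^sup>2 + (altitude q)\<^sup>2 + (altitude q')\<^sup>2 - 2 * (b' \<bullet> c')"
  proof -
    have "(abscissa q - abscissa q')\<^sup>2 = (b \<bullet> a - c \<bullet> a)\<^sup>2" using U[of b] U[of c] by (simp add: q_def q'_def)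
    then show ?thesis unfolding nb'[symmetric]
      unfolding power2_norm_eq_inner b'_def c'_def by (simp add: inner_diff aa inner_commute power2_eq_square algebra_simps)
  qed
  have "near_dist q q' < norm (b - c)" unfolding near_dist_def
    by (rule real_less_lsqrt) (use f np nb' in \<open>auto simp: power2_eq_square algebra_simps\<close>)
  moreover have "norm (b - c) < far_dist q q'" unfolding far_dist_def
    by (rule real_less_rsqrt) (use f np nb' in \<open>auto simp: power2_eq_square algebra_simps\<close>)
  ultimately show ?thesis using q by simp
qed

section \<open>Existence of a tetrahedron with a longest edge of length one\<close>

lemma sum_four: "sum f (UNIV :: 4 set) = f 0 + f 1 + f 2 + f 3"
  unfolding UNIV_four by (simp add: ac_simps)

text \<open>
  Affine independence of a family, in one condition that contains injectivity: it is the absence of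
  a nontrivial affine relation.
\<close>

lemma simplex_iff:
  fixes p :: "4 \<Rightarrow> 'b::real_vector"
  shows "inj p \<and> \<not> affine_dependent (range p) \<longleftrightarrow>
    (\<forall>w. sum w UNIV = 0 \<and> (\<Sum>i\<in>UNIV. w i *\<^sub>R p i) = 0 \<longrightarrow> (\<forall>i. w i = 0))"
proof (intro iffI allI impI; (elim conjE)?)
  fix w i assume p: "inj p" and n: "\<not> affine_dependent (range p)"
    and w: "sum w UNIV = 0" "(\<Sum>i\<in>UNIV. w i *\<^sub>R p i) = 0"
  have "sum (w \<circ> inv p) (range p) = 0" "(\<Sum>v\<in>range p. (w \<circ> inv p) v *\<^sub>R v) = 0"
    using w by (simp_all add: sum.reindex[OF p] p o_def)
  then have "\<forall>v\<in>range p. (w \<circ> inv p) v = 0"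
    using n unfolding affine_dependent_explicit_finite[OF finite_imageI[OF finite]] by blast
  then show "w i = 0" using p by simp
next
  assume ind: "\<forall>w. sum w UNIV = 0 \<and> (\<Sum>i\<in>UNIV. w i *\<^sub>R p i) = 0 \<longrightarrow> (\<forall>i. w i = (0::real))"
  have inj: "inj p"
  proof (rule injI, rule ccontr)
    fix i j assume e: "p i = p j" and ij: "i \<noteq> j"
    define w where "w k = (if k = i then 1 else 0) - (if k = j then 1 else (0::real))" for k
    have "sum w UNIV = 0" by (simp add: w_def sum_subtractf)
    moreover have "(\<Sum>k\<in>UNIV. w k *\<^sub>R p k) = 0"
      using e by (simp add: w_def scaleR_diff_left sum_subtractf if_distrib[of "\<lambda>r. r *\<^sub>R _"] cong: if_cong)
    ultimately have "w i = 0" using ind by blast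
    then show False using ij by (simp add: w_def)
  qed
  have "\<not> affine_dependent (range p)"
  proof
    assume "affine_dependent (range p)"
    then obtain U j where U: "sum U (range p) = 0" "U (p j) \<noteq> 0" "(\<Sum>v\<in>range p. U v *\<^sub>R v) = 0"
      using affine_dependent_explicit_finite[of "range p"] by auto
    have "sum (U \<circ> p) UNIV = 0 \<and> (\<Sum>i\<in>UNIV. (U \<circ> p) i *\<^sub>R p i) = 0"
      using U(1,3) by (simp add: sum.reindex[OF inj] o_def)
    then show False using ind U(2) by (metis comp_apply)
  qed
  with inj show "inj p \<and> \<not> affine_dependent (range p)" ..
qed

lemma dist_vec3: "dist (vector [a, b, c] :: real^3) (vector [a', b', c']) = sqrt ((a - a')\<^sup>2 + (b - b')\<^sup>2 + (c - c')\<^sup>2)"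
  by (simp add: dist_vec_def L2_set_def sum_3 dist_real_def)

text \<open>
  Lay the first triangle flat and rotate the second one about the common edge by the angle with
  cosine \<open>c\<close>, which the law of cosines prescribes from \<open>f\<close>. The inequalities for \<open>f\<close> say that
  \<open>\<bar>c\<bar> < 1\<close>, and then the second apex leaves the plane of the first triangle.
\<close>

lemma flap_realizable:
  assumes q: "q \<in> triangles" "q' \<in> triangles" and f: "near_dist q q' < f" "f < far_dist q q'"
  shows "\<exists>p :: 4 \<Rightarrow> real ^ 3. inj p \<and> \<not> affine_dependent (range p) \<and>
    dist (p 0) (p 1) = 1 \<and> dist (p 0) (p 2) = fst q \<and> dist (p 1) (p 2) = snd q \<and>
    dist (p 0) (p 3) = fst q' \<and> dist (p 1) (p 3) = snd q' \<and> dist (p 2) (p 3) = f"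
proof -
  define U V h k where "U = abscissa q + 1/2" and "V = abscissa q' + 1/2" and "h = altitude q" and "k = altitude q'"
  have hk: "0 < h" "0 < k" using altitude_square(2) q by (auto simp: h_def k_def)
  have f0: "0 \<le> f" using f(1) near_dist_def by (smt (verit) real_sqrt_ge_zero sum_power2_ge_zero)
  have n: "(U - V)\<^sup>2 + (h - k)\<^sup>2 < f\<^sup>2"
    using power_strict_mono[OF f(1), of 2] by (simp add: near_dist_def h_def k_def U_def V_def)
  have n': "f\<^sup>2 < (U - V)\<^sup>2 + (h + k)\<^sup>2"
    using power_strict_mono[OF f(2), of 2] f0 by (simp add: far_dist_def h_def k_def U_def V_def)
  \<comment> \<open>cosine of the dihedral angle at the common edge\<close>
  define c where "c = ((U - V)\<^sup>2 + h\<^sup>2 + k\<^sup>2 - f\<^sup>2) / (2 * h * k)"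
  have c2: "2 * h * k * c = (U - V)\<^sup>2 + h\<^sup>2 + k\<^sup>2 - f\<^sup>2" using hk by (simp add: c_def)
  have "c < 1" "- 1 < c" unfolding c_def using n n' hk by (simp_all add: field_simps power2_eq_square)
  then have c1: "c\<^sup>2 < 1" by (simp add: abs_square_less_1 abs_less_iff)
  define s where "s = sqrt (1 - c\<^sup>2)"
  have s: "0 < s" "s\<^sup>2 = 1 - c\<^sup>2" using c1 by (auto simp: s_def)
  define p :: "4 \<Rightarrow> real^3" where "p i = (if i = 0 then vector [0, 0, 0] else if i = 1 then vector [1, 0, 0]
     else if i = 2 then vector [U, h, 0] else vector [V, k * c, k * s])" for i
  have p: "p 0 = vector [0, 0, 0]" "p 1 = vector [1, 0, 0]" "p 2 = vector [U, h, 0]" "p 3 = vector [V, k * c, k * s]"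
    by (simp_all add: p_def)
  have "inj p \<and> \<not> affine_dependent (range p)" unfolding simplex_iff
  proof (intro allI impI, elim conjE)
    fix w :: "4 \<Rightarrow> real" and i assume w: "sum w UNIV = 0" "(\<Sum>i\<in>UNIV. w i *\<^sub>R p i) = 0"
    have comp: "w 0 * p 0 $ j + w 1 * p 1 $ j + w 2 * p 2 $ j + w 3 * p 3 $ j = 0" for j
      using arg_cong[OF w(2), of "\<lambda>v. v $ j"] by (simp add: sum_four)
    have "w 3 * (k * s) = 0" using comp[of 3] by (simp add: p)
    then have w3: "w 3 = 0" using hk s by simp
    have w2: "w 2 = 0" using comp[of 2] w3 hk by (simp add: p)
    have w1: "w 1 = 0" using comp[of 1] w3 w2 by (simp add: p)
    have "w 0 = 0" using w(1) w1 w2 w3 by (simp add: sum_four)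
    then have "\<forall>i. w i = 0" using w1 w2 w3 by (simp add: all_four)
    then show "w i = 0" ..
  qed
  moreover have sq: "U\<^sup>2 + h\<^sup>2 = (fst q)\<^sup>2" "(1 - U)\<^sup>2 + h\<^sup>2 = (snd q)\<^sup>2" "V\<^sup>2 + k\<^sup>2 = (fst q')\<^sup>2" "(1 - V)\<^sup>2 + k\<^sup>2 = (snd q')\<^sup>2"
    using sides_from_apex[OF q(1)] sides_from_apex[OF q(2)]
    by (simp_all add: U_def V_def h_def k_def power2_commute[of "1/2"])
  have ks: "(k * c)\<^sup>2 + (k * s)\<^sup>2 = k\<^sup>2" using s by (simp add: power_mult_distrib flip: distrib_left)
  have F: "(U - V)\<^sup>2 + (h - k * c)\<^sup>2 + (k * s)\<^sup>2 = f\<^sup>2"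
  proof -
    have "(h - k * c)\<^sup>2 = h\<^sup>2 - 2 * h * k * c + (k * c)\<^sup>2" by (simp add: power2_diff)
    then show ?thesis using c2 ks by linarith
  qed
  have nn: "0 \<le> fst q" "0 \<le> snd q" "0 \<le> fst q'" "0 \<le> snd q'" using q by (auto simp: triangles_def)
  have "dist (p 0) (p 1) = 1" by (simp add: p dist_vec3)
  moreover have "dist (p 0) (p 2) = fst q" using sq(1) nn by (simp add: p dist_vec3)
  moreover have "dist (p 1) (p 2) = snd q" using sq(2) nn by (simp add: p dist_vec3)
  moreover have "dist (p 0) (p 3) = fst q'" using sq(3) ks nn by (simp add: p dist_vec3 add.assoc)
  moreover have "dist (p 1) (p 3) = snd q'" using sq(4) ks nn by (simp add: p dist_vec3 add.assoc)
  moreover have "dist (p 2) (p 3) = f" using F f0 by (simp add: p dist_vec3)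
  ultimately show ?thesis by blast
qed

lemma tetrahedron_iff_flap:
  fixes \<Delta> :: "real ^ 4 ^ 4"
  assumes sym: "transpose \<Delta> = \<Delta>" and diag: "\<And>i. \<Delta> $ i $ i = 0" and unit: "\<Delta> $ 0 $ 1 = 1"
    and le: "\<Delta> $ 0 $ 2 \<le> 1" "\<Delta> $ 1 $ 2 \<le> 1" "\<Delta> $ 0 $ 3 \<le> 1" "\<Delta> $ 1 $ 3 \<le> 1"
  defines "q \<equiv> (\<Delta> $ 0 $ 2, \<Delta> $ 1 $ 2)" and "q' \<equiv> (\<Delta> $ 0 $ 3, \<Delta> $ 1 $ 3)"
  shows "tetrahedron_distance_matrix \<Delta> \<longleftrightarrow>
    q \<in> triangles \<and> q' \<in> triangles \<and> near_dist q q' < \<Delta> $ 2 $ 3 \<and> \<Delta> $ 2 $ 3 < far_dist q q'" (is "?L \<longleftrightarrow> ?R")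
proof
  have s: "\<Delta> $ i $ j = \<Delta> $ j $ i" for i j using arg_cong[OF sym, of "\<lambda>A. A $ j $ i"] by (simp add: transpose_def)
  have dists: "(\<forall>i j. dist (p i) (p j) = \<Delta> $ i $ j) \<longleftrightarrow> dist (p 0) (p 1) = 1 \<and> dist (p 0) (p 2) = fst q \<and> dist (p 1) (p 2) = snd q \<and>
    dist (p 0) (p 3) = fst q' \<and> dist (p 1) (p 3) = snd q' \<and> dist (p 2) (p 3) = \<Delta> $ 2 $ 3" for p :: "4 \<Rightarrow> real^3"
    unfolding all_four using s[of 1 0] s[of 2 0] s[of 2 1] s[of 3 0] s[of 3 1] s[of 3 2]
    by (auto simp: diag dist_commute unit q_def q'_def)
  show ?L if ?R using flap_realizable[of q q' "\<Delta> $ 2 $ 3"] that unfolding tetrahedron_distance_matrix_def dists by blast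
  show ?R if L: ?L
  proof -
    obtain p :: "4 \<Rightarrow> real^3" where p: "inj p \<and> \<not> affine_dependent (range p)" and d: "\<forall>i j. dist (p i) (p j) = \<Delta> $ i $ j"
      using L unfolding tetrahedron_distance_matrix_def by blast
    define a b c where "a = p 1 - p 0" and "b = p 2 - p 0" and "c = p 3 - p 0"
    have a: "norm a = 1" using d unit unfolding a_def by (metis dist_norm dist_commute)
    have n: "norm b = \<Delta> $ 0 $ 2" "norm (b - a) = \<Delta> $ 1 $ 2" "norm c = \<Delta> $ 0 $ 3" "norm (c - a) = \<Delta> $ 1 $ 3"
      "norm (b - c) = \<Delta> $ 2 $ 3"
      unfolding a_def b_def c_def d[rule_format, symmetric]
      by (simp_all add: dist_norm norm_minus_commute)
    have dep: False if "x *\<^sub>R a + y *\<^sub>R b + z *\<^sub>R c = 0" "x \<noteq> 0 \<or> y \<noteq> 0 \<or> z \<noteq> 0" for x y z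
    proof -
      define w :: "4 \<Rightarrow> real" where "w i = (if i = 0 then - x - y - z else if i = 1 then x else if i = 2 then y else z)" for i
      have "sum w UNIV = 0" by (simp add: sum_four w_def)
      moreover have "(\<Sum>i\<in>UNIV. w i *\<^sub>R p i) = 0" using that(1) by (simp add: sum_four w_def a_def b_def c_def algebra_simps)
      ultimately have "\<forall>i. w i = 0" using p unfolding simplex_iff by blast
      then have "w 1 = 0" "w 2 = 0" "w 3 = 0" by blast+
      then show False using that(2) by (simp add: w_def)
    qed
    have nb: "b \<noteq> s *\<^sub>R a" for s using dep[of "- s" 1 0] by force
    have nc: "c \<noteq> s *\<^sub>R a" for s using dep[of "- s" 0 1] by force
    have nbc: "b \<noteq> s *\<^sub>R a + t *\<^sub>R c" for s t using dep[of "- s" 1 "- t"] by force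
    show ?R using flap_bounds[OF a _ _ _ _ nb nc nbc] le unfolding n q_def q'_def by blast
  qed
qed

text \<open>
  A scaled simplex is a simplex; the inverse factor gives the converse.
\<close>

lemma tetrahedron_scale:
  assumes "0 < c"
  shows "tetrahedron_distance_matrix (c *\<^sub>R \<Delta>) \<longleftrightarrow> tetrahedron_distance_matrix \<Delta>"
proof -
  have *: "tetrahedron_distance_matrix (c *\<^sub>R \<Delta>)" if t: "tetrahedron_distance_matrix \<Delta>" and "0 < c" for c \<Delta>
  proof -
    obtain p :: "4 \<Rightarrow> real^3" where p: "inj p \<and> \<not> affine_dependent (range p)" and d: "\<forall>i j. dist (p i) (p j) = \<Delta> $ i $ j"
      using t unfolding tetrahedron_distance_matrix_def by blast
    have "inj (\<lambda>i. c *\<^sub>R p i) \<and> \<not> affine_dependent (range (\<lambda>i. c *\<^sub>R p i))"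
      unfolding simplex_iff
    proof (intro allI impI, elim conjE)
      fix w :: "4 \<Rightarrow> real" and i assume w: "sum w UNIV = 0" "(\<Sum>i\<in>UNIV. w i *\<^sub>R c *\<^sub>R p i) = 0"
      have "c *\<^sub>R (\<Sum>i\<in>UNIV. w i *\<^sub>R p i) = 0" using w(2) by (simp add: scaleR_sum_right mult.commute)
      then have "(\<Sum>i\<in>UNIV. w i *\<^sub>R p i) = 0" using that by simp
      then show "w i = 0" using p w(1) unfolding simplex_iff by blast
    qed
    moreover have "\<forall>i j. dist (c *\<^sub>R p i) (c *\<^sub>R p j) = (c *\<^sub>R \<Delta>) $ i $ j"
      using d that(2) by (simp add: dist_norm flip: scaleR_diff_right)
    ultimately show ?thesis unfolding tetrahedron_distance_matrix_def by blast
  qed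
  show ?thesis using *[of \<Delta> c] *[of "c *\<^sub>R \<Delta>" "inverse c"] assms by auto
qed

lemma tetrahedron_relabel:
  assumes "bij \<sigma>"
  shows "tetrahedron_distance_matrix (\<chi> i j. \<Delta> $ \<sigma> i $ \<sigma> j) \<longleftrightarrow> tetrahedron_distance_matrix \<Delta>"
proof -
  have *: "tetrahedron_distance_matrix (\<chi> i j. \<Delta> $ \<sigma> i $ \<sigma> j)" if t: "tetrahedron_distance_matrix \<Delta>" and s: "bij \<sigma>" for \<Delta> \<sigma>
  proof -
    obtain p :: "4 \<Rightarrow> real^3" where p: "inj p" "\<not> affine_dependent (range p)" and d: "\<forall>i j. dist (p i) (p j) = \<Delta> $ i $ j"
      using t unfolding tetrahedron_distance_matrix_def by blast
    have "range (p \<circ> \<sigma>) = range p" using s by (metis bij_def image_comp)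
    then show ?thesis unfolding tetrahedron_distance_matrix_def
      using p d s by (intro exI[of _ "p \<circ> \<sigma>"]) (auto simp: inj_compose bij_is_inj)
  qed
  have i: "bij (inv \<sigma>)" "\<sigma> (inv \<sigma> k) = k" for k using assms by (auto simp: bij_imp_bij_inv bij_is_surj surj_f_inv_f)
  show ?thesis using *[OF _ assms] *[OF _ i(1), of "\<chi> i j. \<Delta> $ \<sigma> i $ \<sigma> j"] by (auto simp: i)
qed

section \<open>The volume of the normalised edge lengths\<close>

definition flaps :: "real \<Rightarrow> real \<Rightarrow> real \<Rightarrow> real \<Rightarrow> real \<Rightarrow> bool" where
  "flaps x y z w f \<longleftrightarrow> (x, y) \<in> triangles \<and> (z, w) \<in> triangles \<and>
     near_dist (x, y) (z, w) < f \<and> f < far_dist (x, y) (z, w)"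

text \<open>
  The indicator function, as an extended nonnegative real, of the flaps all of whose lengths lie in
  \<open>J\<close>. For \<open>J = {0..1}\<close> the common edge is a longest edge, for \<open>J = {0..<1}\<close> it is the only one.
\<close>

definition flaps_in :: "real set \<Rightarrow> real \<Rightarrow> real \<Rightarrow> real \<Rightarrow> real \<Rightarrow> real \<Rightarrow> ennreal" where
  "flaps_in J x y z w f = (if x \<in> J \<and> y \<in> J \<and> z \<in> J \<and> w \<in> J \<and> f \<in> J \<and> flaps x y z w f then 1 else 0)"

definition flap_volume :: "real set \<Rightarrow> ennreal" where
  "flap_volume J = (\<integral>\<^sup>+x. \<integral>\<^sup>+y. \<integral>\<^sup>+z. \<integral>\<^sup>+w. \<integral>\<^sup>+f. flaps_in J x y z w f \<partial>lborel \<partial>lborel \<partial>lborel \<partial>lborel \<partial>lborel)"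

lemma measurable_flaps_in [measurable]:
  assumes [measurable]: "J \<in> sets borel"
    "a \<in> borel_measurable M" "b \<in> borel_measurable M" "c \<in> borel_measurable M" "d \<in> borel_measurable M" "e \<in> borel_measurable M"
  shows "(\<lambda>t. flaps_in J (a t) (b t) (c t) (d t) (e t)) \<in> borel_measurable M"
  unfolding flaps_in_def flaps_def triangles_def near_dist_def far_dist_def abscissa_def altitude_def mem_Collect_eq fst_conv snd_conv
  by measurable

lemma scale_integral:
  assumes [measurable]: "g \<in> borel_measurable borel" and e: "0 < e" "e \<le> (1::real)" and g: "\<And>x. x \<notin> {0..1} \<Longrightarrow> g x = 0"
  shows "(\<integral>\<^sup>+x. g (x / e) * indicator {0..1} x \<partial>lborel) = ennreal e * (\<integral>\<^sup>+x. g x \<partial>lborel)"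
proof -
  have "(\<integral>\<^sup>+x. g (x / e) * indicator {0..1} x \<partial>lborel) = ennreal \<bar>e\<bar> * (\<integral>\<^sup>+x. g ((0 + e * x) / e) * indicator {0..1} (0 + e * x) \<partial>lborel)"
    by (rule nn_integral_real_affine) (use e in auto)
  also have "(\<integral>\<^sup>+x. g ((0 + e * x) / e) * indicator {0..1} (0 + e * x) \<partial>lborel) = (\<integral>\<^sup>+x. g x \<partial>lborel)"
  proof (rule nn_integral_cong)
    fix x show "g ((0 + e * x) / e) * indicator {0..1} (0 + e * x) = g x"
      using e g[of x] mult_le_one[of e x] by (cases "x \<in> {0..1}") (auto simp: indicator_def)
  qed
  finally show ?thesis using e by simp
qed

text \<open>
  If the longest edge has length \<open>e\<close> instead of \<open>1\<close>, each of the five other lengths contributes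
  one factor \<open>e\<close> by substitution. As the flaps have lengths in \<open>{0..1}\<close> and \<open>e \<le> 1\<close>, the
  restriction of the scaled lengths to \<open>{0..1}\<close> cuts nothing off.
\<close>

lemma scaled_flap_volume:
  assumes [measurable]: "J \<in> sets borel" and J: "J \<subseteq> {0..1}" and e: "0 < e" "e \<le> (1::real)"
  shows "(\<integral>\<^sup>+x\<in>{0..1}. \<integral>\<^sup>+y\<in>{0..1}. \<integral>\<^sup>+z\<in>{0..1}. \<integral>\<^sup>+w\<in>{0..1}. \<integral>\<^sup>+f\<in>{0..1}.
      flaps_in J (x / e) (y / e) (z / e) (w / e) (f / e) \<partial>lborel \<partial>lborel \<partial>lborel \<partial>lborel \<partial>lborel) = ennreal e ^ 5 * flap_volume J"
proof -
  have z: "x \<notin> {0..1} \<Longrightarrow> flaps_in J x y z w = (\<lambda>_. 0)" "y \<notin> {0..1} \<Longrightarrow> flaps_in J x y z w = (\<lambda>_. 0)"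
    "z \<notin> {0..1} \<Longrightarrow> flaps_in J x y z w = (\<lambda>_. 0)" "w \<notin> {0..1} \<Longrightarrow> flaps_in J x y z w = (\<lambda>_. 0)"
    "f \<notin> {0..1} \<Longrightarrow> flaps_in J x y z w f = 0" for x y z w f
    using J by (auto simp: flaps_in_def fun_eq_iff)
  note S = scale_integral[OF _ e]
  have 5: "(\<integral>\<^sup>+f\<in>{0..1}. flaps_in J x y z w (f / e) \<partial>lborel) = ennreal e * (\<integral>\<^sup>+f. flaps_in J x y z w f \<partial>lborel)" for x y z w
    by (rule S) (auto simp: z)
  have 4: "(\<integral>\<^sup>+w\<in>{0..1}. (ennreal e * (\<integral>\<^sup>+f. flaps_in J x y z (w / e) f \<partial>lborel)) \<partial>lborel)
    = ennreal e * (ennreal e * (\<integral>\<^sup>+w. \<integral>\<^sup>+f. flaps_in J x y z w f \<partial>lborel \<partial>lborel))" for x y z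
    by (subst S) (auto simp: z nn_integral_cmult simp del: atLeastAtMost_iff)
  have 3: "(\<integral>\<^sup>+z\<in>{0..1}. (ennreal e * (ennreal e * (\<integral>\<^sup>+w. \<integral>\<^sup>+f. flaps_in J x y (z / e) w f \<partial>lborel \<partial>lborel))) \<partial>lborel)
    = ennreal e * (ennreal e * (ennreal e * (\<integral>\<^sup>+z. \<integral>\<^sup>+w. \<integral>\<^sup>+f. flaps_in J x y z w f \<partial>lborel \<partial>lborel \<partial>lborel)))" for x y
    by (subst S) (auto simp: z nn_integral_cmult simp del: atLeastAtMost_iff)
  have 2: "(\<integral>\<^sup>+y\<in>{0..1}. (ennreal e * (ennreal e * (ennreal e * (\<integral>\<^sup>+z. \<integral>\<^sup>+w. \<integral>\<^sup>+f. flaps_in J x (y / e) z w f \<partial>lborel \<partial>lborel \<partial>lborel)))) \<partial>lborel)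
    = ennreal e * (ennreal e * (ennreal e * (ennreal e * (\<integral>\<^sup>+y. \<integral>\<^sup>+z. \<integral>\<^sup>+w. \<integral>\<^sup>+f. flaps_in J x y z w f \<partial>lborel \<partial>lborel \<partial>lborel \<partial>lborel))))" for x
    by (subst S) (auto simp: z nn_integral_cmult simp del: atLeastAtMost_iff)
  have 1: "(\<integral>\<^sup>+x\<in>{0..1}. (ennreal e * (ennreal e * (ennreal e * (ennreal e * (\<integral>\<^sup>+y. \<integral>\<^sup>+z. \<integral>\<^sup>+w. \<integral>\<^sup>+f. flaps_in J (x / e) y z w f \<partial>lborel \<partial>lborel \<partial>lborel \<partial>lborel))))) \<partial>lborel)
    = ennreal e * (ennreal e * (ennreal e * (ennreal e * (ennreal e * flap_volume J))))"
    unfolding flap_volume_def by (subst S) (auto simp: z nn_integral_cmult simp del: atLeastAtMost_iff)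
  show ?thesis unfolding 5 4 3 2 1 by (simp add: eval_nat_numeral mult.assoc)
qed

text \<open>
  The integral over the height of a six-dimensional cone, which produces the factor \<open>1/6\<close>.
\<close>

lemma integral_fifth_power: "(\<integral>\<^sup>+e\<in>{0..1}. (if 0 < e then ennreal e ^ 5 * c else 0) \<partial>lborel) = c / 6"
proof -
  have "(\<integral>\<^sup>+e\<in>{0..1}. (if 0 < e then ennreal e ^ 5 * c else 0) \<partial>lborel) = (\<integral>\<^sup>+e. c * (ennreal (e ^ 5) * indicator {0..1} e) \<partial>lborel)"
    by (rule nn_integral_cong) (auto simp: indicator_def ennreal_power mult.commute)
  also have "\<dots> = c * (\<integral>\<^sup>+e. ennreal (e ^ 5) * indicator {0..1} e \<partial>lborel)" by (rule nn_integral_cmult) simp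
  also have "(\<integral>\<^sup>+e. ennreal (e ^ 5) * indicator {0..1} e \<partial>lborel) = ennreal (1 ^ 6 / 6 - 0 ^ 6 / 6)"
    by (rule nn_integral_FTC_Icc) (auto intro!: derivative_eq_intros)
  also have "c * \<dots> = c / 6" by (simp add: divide_ennreal_def inverse_ennreal flip: ennreal_numeral)
  finally show ?thesis .
qed

lemma nn_integral_cong_except_one:
  fixes f g :: "real \<Rightarrow> ennreal"
  assumes "\<And>x. x \<noteq> 1 \<Longrightarrow> f x = g x"
  shows "(\<integral>\<^sup>+x. f x \<partial>lborel) = (\<integral>\<^sup>+x. g x \<partial>lborel)"
  using AE_lborel_singleton[of 1] assms by (intro nn_integral_cong_AE) (auto elim!: AE_mp)

text \<open>
  Ties for the longest edge form a null set.
\<close>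

lemma flap_volume_half_open: "flap_volume {0..<1} = flap_volume {0..1}"
proof -
  have *: "flaps_in {0..<1} x y z w f = flaps_in {0..1} x y z w f" if "x \<noteq> 1" "y \<noteq> 1" "z \<noteq> 1" "w \<noteq> 1" "f \<noteq> 1" for x y z w f
    using that by (auto simp: flaps_in_def)
  show ?thesis unfolding flap_volume_def
    by (intro nn_integral_cong_except_one *)
qed

section \<open>Six independent uniform coordinates as an iterated integral\<close>

abbreviation unif :: "real measure" where "unif \<equiv> uniform_measure lborel {0..1}"

lemma unif_eq_density: "unif = density lborel (indicator {0..1})"
  by (simp add: uniform_measure_def divide_ennreal_def)

lemma nn_integral_unif:
  "f \<in> borel_measurable borel \<Longrightarrow> (\<integral>\<^sup>+x. f x \<partial>unif) = (\<integral>\<^sup>+x\<in>{0..1}. f x \<partial>lborel)"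
  unfolding unif_eq_density by (subst nn_integral_density) (auto simp: mult.commute)

lemma prob_space_unif: "prob_space unif"
  by (rule prob_space_uniform_measure) auto

interpretation unif: prob_space unif by (rule prob_space_unif)

interpretation unif_product: product_sigma_finite "\<lambda>_. unif"
  by (simp add: product_sigma_finite_def unif.sigma_finite_measure_axioms)

lemma measurable_coordinate [measurable]:
  "i \<in> I \<Longrightarrow> (\<lambda>d. d i) \<in> borel_measurable (Pi\<^sub>M I (\<lambda>_. unif))"
  using measurable_component_singleton[of i I "\<lambda>_. unif"] by (simp add: measurable_def)

lemma sigma_finite_unif_product: "finite I \<Longrightarrow> sigma_finite_measure (Pi\<^sub>M I (\<lambda>_. unif))"
  by (rule unif_product.sigma_finite)

text \<open>
  The set of coordinates shrinks by one: the integrand receives the value of coordinate \<open>i\<close> as its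
  first argument and must ignore it in the second.
\<close>

lemma peel_coordinate:
  fixes g :: "real \<Rightarrow> ('i \<Rightarrow> real) \<Rightarrow> ennreal"
  assumes I: "finite I" "i \<notin> I"
    and g: "(\<lambda>d. g (d i) d) \<in> borel_measurable (Pi\<^sub>M (insert i I) (\<lambda>_. unif))"
    and g': "case_prod g \<in> borel_measurable (borel \<Otimes>\<^sub>M Pi\<^sub>M I (\<lambda>_. unif))"
    and i: "\<And>x y d. g x (d(i := y)) = g x d"
  shows "(\<integral>\<^sup>+d. g (d i) d \<partial>Pi\<^sub>M (insert i I) (\<lambda>_. unif)) = (\<integral>\<^sup>+x\<in>{0..1}. (\<integral>\<^sup>+d. g x d \<partial>Pi\<^sub>M I (\<lambda>_. unif)) \<partial>lborel)"
proof -
  interpret sigma_finite_measure "Pi\<^sub>M I (\<lambda>_. unif)" using sigma_finite_unif_product I(1) .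
  have "(\<integral>\<^sup>+d. g (d i) d \<partial>Pi\<^sub>M (insert i I) (\<lambda>_. unif)) = (\<integral>\<^sup>+x. (\<integral>\<^sup>+d. g x d \<partial>Pi\<^sub>M I (\<lambda>_. unif)) \<partial>unif)"
    using unif_product.product_nn_integral_insert_rev[OF I g] by (simp add: i)
  also have "\<dots> = (\<integral>\<^sup>+x\<in>{0..1}. (\<integral>\<^sup>+d. g x d \<partial>Pi\<^sub>M I (\<lambda>_. unif)) \<partial>lborel)"
    by (rule nn_integral_unif) (rule borel_measurable_nn_integral[OF g'])
  finally show ?thesis .
qed

lemma measurable_six_arguments:
  assumes [measurable]: "(\<lambda>(a, b, c, d, e, f). \<Phi> a b c d e f) \<in> borel_measurable (borel \<Otimes>\<^sub>M borel \<Otimes>\<^sub>M borel \<Otimes>\<^sub>M borel \<Otimes>\<^sub>M borel \<Otimes>\<^sub>M borel)"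
    "x1 \<in> borel_measurable M" "x2 \<in> borel_measurable M" "x3 \<in> borel_measurable M"
    "x4 \<in> borel_measurable M" "x5 \<in> borel_measurable M" "x6 \<in> borel_measurable M"
  shows "(\<lambda>t. \<Phi> (x1 t) (x2 t) (x3 t) (x4 t) (x5 t) (x6 t)) \<in> borel_measurable M"
proof -
  have "(\<lambda>t. (\<lambda>(a, b, c, d, e, f). \<Phi> a b c d e f) (x1 t, x2 t, x3 t, x4 t, x5 t, x6 t)) \<in> borel_measurable M" by measurable
  then show ?thesis by simp
qed

lemma integral_six_coordinates:
  fixes \<Phi> :: "real \<Rightarrow> real \<Rightarrow> real \<Rightarrow> real \<Rightarrow> real \<Rightarrow> real \<Rightarrow> ennreal"
  assumes dist: "distinct [a, b, c, d, e, f]"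
    and \<Phi>: "(\<lambda>(a, b, c, d, e, f). \<Phi> a b c d e f) \<in> borel_measurable (borel \<Otimes>\<^sub>M borel \<Otimes>\<^sub>M borel \<Otimes>\<^sub>M borel \<Otimes>\<^sub>M borel \<Otimes>\<^sub>M borel)"
  shows "(\<integral>\<^sup>+r. \<Phi> (r a) (r b) (r c) (r d) (r e) (r (f :: 'i)) \<partial>Pi\<^sub>M {a, b, c, d, e, f} (\<lambda>_. unif)) =
    (\<integral>\<^sup>+x1\<in>{0..1}. \<integral>\<^sup>+x2\<in>{0..1}. \<integral>\<^sup>+x3\<in>{0..1}. \<integral>\<^sup>+x4\<in>{0..1}. \<integral>\<^sup>+x5\<in>{0..1}. \<integral>\<^sup>+x6\<in>{0..1}. \<Phi> x1 x2 x3 x4 x5 x6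
      \<partial>lborel \<partial>lborel \<partial>lborel \<partial>lborel \<partial>lborel \<partial>lborel)"
proof -
  note [measurable] = measurable_six_arguments[OF \<Phi>]
  have 1: "(\<integral>\<^sup>+r. \<Phi> (r a) (r b) (r c) (r d) (r e) (r f) \<partial>Pi\<^sub>M {a, b, c, d, e, f} (\<lambda>_. unif)) =
    (\<integral>\<^sup>+x1\<in>{0..1}. (\<integral>\<^sup>+r. \<Phi> x1 (r b) (r c) (r d) (r e) (r f) \<partial>Pi\<^sub>M {b, c, d, e, f} (\<lambda>_. unif)) \<partial>lborel)"
    by (rule peel_coordinate[where g = "\<lambda>x r. \<Phi> x (r b) (r c) (r d) (r e) (r f)"]) (use dist in \<open>auto simp: split_beta'\<close>)
  have 2: "(\<integral>\<^sup>+r. \<Phi> x1 (r b) (r c) (r d) (r e) (r f) \<partial>Pi\<^sub>M {b, c, d, e, f} (\<lambda>_. unif)) =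
    (\<integral>\<^sup>+x2\<in>{0..1}. (\<integral>\<^sup>+r. \<Phi> x1 x2 (r c) (r d) (r e) (r f) \<partial>Pi\<^sub>M {c, d, e, f} (\<lambda>_. unif)) \<partial>lborel)" for x1
    by (rule peel_coordinate[where g = "\<lambda>x r. \<Phi> x1 x (r c) (r d) (r e) (r f)"]) (use dist in \<open>auto simp: split_beta'\<close>)
  have 3: "(\<integral>\<^sup>+r. \<Phi> x1 x2 (r c) (r d) (r e) (r f) \<partial>Pi\<^sub>M {c, d, e, f} (\<lambda>_. unif)) =
    (\<integral>\<^sup>+x3\<in>{0..1}. (\<integral>\<^sup>+r. \<Phi> x1 x2 x3 (r d) (r e) (r f) \<partial>Pi\<^sub>M {d, e, f} (\<lambda>_. unif)) \<partial>lborel)" for x1 x2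
    by (rule peel_coordinate[where g = "\<lambda>x r. \<Phi> x1 x2 x (r d) (r e) (r f)"]) (use dist in \<open>auto simp: split_beta'\<close>)
  have 4: "(\<integral>\<^sup>+r. \<Phi> x1 x2 x3 (r d) (r e) (r f) \<partial>Pi\<^sub>M {d, e, f} (\<lambda>_. unif)) =
    (\<integral>\<^sup>+x4\<in>{0..1}. (\<integral>\<^sup>+r. \<Phi> x1 x2 x3 x4 (r e) (r f) \<partial>Pi\<^sub>M {e, f} (\<lambda>_. unif)) \<partial>lborel)" for x1 x2 x3
    by (rule peel_coordinate[where g = "\<lambda>x r. \<Phi> x1 x2 x3 x (r e) (r f)"]) (use dist in \<open>auto simp: split_beta'\<close>)
  have 5: "(\<integral>\<^sup>+r. \<Phi> x1 x2 x3 x4 (r e) (r f) \<partial>Pi\<^sub>M {e, f} (\<lambda>_. unif)) =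
    (\<integral>\<^sup>+x5\<in>{0..1}. (\<integral>\<^sup>+r. \<Phi> x1 x2 x3 x4 x5 (r f) \<partial>Pi\<^sub>M {f} (\<lambda>_. unif)) \<partial>lborel)" for x1 x2 x3 x4
    by (rule peel_coordinate[where g = "\<lambda>x r. \<Phi> x1 x2 x3 x4 x (r f)"]) (use dist in \<open>auto simp: split_beta'\<close>)
  have 6: "(\<integral>\<^sup>+r. \<Phi> x1 x2 x3 x4 x5 (r f) \<partial>Pi\<^sub>M {f} (\<lambda>_. unif)) = (\<integral>\<^sup>+x6\<in>{0..1}. \<Phi> x1 x2 x3 x4 x5 x6 \<partial>lborel)" for x1 x2 x3 x4 x5
  proof -
    have m: "(\<lambda>x. \<Phi> x1 x2 x3 x4 x5 x) \<in> borel_measurable borel" by measurable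
    then have "(\<lambda>x. \<Phi> x1 x2 x3 x4 x5 x) \<in> borel_measurable unif"
      by (simp only: measurable_cong_sets[OF sets_uniform_measure refl] measurable_lborel2)
    from unif_product.product_nn_integral_singleton[OF this, of f] nn_integral_unif[OF m]
    show ?thesis by (rule trans)
  qed
  show ?thesis unfolding 1 2 3 4 5 6 ..
qed

section \<open>Tetrahedra whose longest edge is prescribed\<close>

text \<open>
  The edge from vertex \<open>0\<close> to vertex \<open>1\<close> is a longest edge (\<open>J = {0..1}\<close>) or the unique
  longest edge (\<open>J = {0..<1}\<close>) of a tetrahedron.
\<close>

definition leading :: "real set \<Rightarrow> real ^ 4 ^ 4 \<Rightarrow> bool" where
  "leading J A \<longleftrightarrow> tetrahedron_distance_matrix A \<and> 0 < A $ 0 $ 1 \<and>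
     (\<forall>i j. i \<noteq> j \<and> {i, j} \<noteq> {0, 1} \<longrightarrow> A $ i $ j / A $ 0 $ 1 \<in> J)"

lemma symmetric_entries: "transpose A = A \<Longrightarrow> A $ i $ j = A $ j $ i"
proof -
  assume "transpose A = A"
  moreover have "A $ i $ j = transpose A $ j $ i" by (simp add: transpose_def)
  ultimately show ?thesis by simp
qed

lemma leading_ratios:
  fixes A :: "real ^ 4 ^ 4"
  assumes sym: "transpose A = A"
  shows "(\<forall>i j. i \<noteq> j \<and> {i, j} \<noteq> {0, 1} \<longrightarrow> A $ i $ j / A $ 0 $ 1 \<in> J) \<longleftrightarrow>
    A $ 0 $ 2 / A $ 0 $ 1 \<in> J \<and> A $ 1 $ 2 / A $ 0 $ 1 \<in> J \<and> A $ 0 $ 3 / A $ 0 $ 1 \<in> J \<and> A $ 1 $ 3 / A $ 0 $ 1 \<in> J \<and> A $ 2 $ 3 / A $ 0 $ 1 \<in> J"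
proof -
  have s: "A $ 2 $ 0 = A $ 0 $ 2" "A $ 2 $ 1 = A $ 1 $ 2" "A $ 3 $ 0 = A $ 0 $ 3" "A $ 3 $ 1 = A $ 1 $ 3" "A $ 3 $ 2 = A $ 2 $ 3"
    by (rule symmetric_entries[OF sym])+
  show ?thesis unfolding all_four by (simp add: doubleton_eq_iff s) blast
qed

text \<open>
  Dividing the matrix by the length of the leading edge leads to the normalised situation, which
  \<open>tetrahedron_iff_flap\<close> decides.
\<close>

lemma leading_iff:
  assumes sym: "transpose A = A" and diag: "\<And>i. A $ i $ i = 0" and J: "J \<subseteq> {0..1}"
  shows "(if leading J A then 1 else 0) = (if 0 < A $ 0 $ 1 then
     flaps_in J (A $ 0 $ 2 / A $ 0 $ 1) (A $ 1 $ 2 / A $ 0 $ 1) (A $ 0 $ 3 / A $ 0 $ 1) (A $ 1 $ 3 / A $ 0 $ 1) (A $ 2 $ 3 / A $ 0 $ 1) else 0)"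
proof (cases "0 < A $ 0 $ 1 \<and> A $ 0 $ 2 / A $ 0 $ 1 \<in> J \<and> A $ 1 $ 2 / A $ 0 $ 1 \<in> J \<and> A $ 0 $ 3 / A $ 0 $ 1 \<in> J \<and> A $ 1 $ 3 / A $ 0 $ 1 \<in> J \<and> A $ 2 $ 3 / A $ 0 $ 1 \<in> J")
  case True
  define B where "B = inverse (A $ 0 $ 1) *\<^sub>R A"
  have entry: "B $ i $ j = A $ i $ j / A $ 0 $ 1" for i j by (simp add: B_def field_simps)
  have "tetrahedron_distance_matrix A \<longleftrightarrow> tetrahedron_distance_matrix B"
    unfolding B_def using True by (subst tetrahedron_scale) auto
  also have "\<dots> \<longleftrightarrow> flaps (B $ 0 $ 2) (B $ 1 $ 2) (B $ 0 $ 3) (B $ 1 $ 3) (B $ 2 $ 3)"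
    unfolding flaps_def
  proof (rule tetrahedron_iff_flap)
    show "transpose B = B" using sym unfolding B_def by (simp add: transpose_def vec_eq_iff)
  qed (use True J in \<open>auto simp: entry diag\<close>)
  finally show ?thesis using True unfolding leading_def leading_ratios[OF sym] flaps_in_def entry by simp
qed (auto simp: leading_def leading_ratios[OF sym] flaps_in_def)

text \<open>
  The probabilistic hypotheses in the form in which they are invariant under relabelling of the
  vertices: independence and uniformity are merged into the joint law of the entries above the
  diagonal.
\<close>

locale random_edge_lengths = prob_space M for M :: "'a measure" +
  fixes \<Delta> :: "'a \<Rightarrow> real ^ 4 ^ 4"
  assumes symmetric: "\<And>\<omega>. \<omega> \<in> space M \<Longrightarrow> transpose (\<Delta> \<omega>) = \<Delta> \<omega>"
    and zero_diagonal: "\<And>\<omega> i. \<omega> \<in> space M \<Longrightarrow> \<Delta> \<omega> $ i $ i = 0"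
    and measurable_entry: "\<And>i j. (\<lambda>\<omega>. \<Delta> \<omega> $ i $ j) \<in> borel_measurable M"
    and joint_law: "distr M (Pi\<^sub>M {(i, j). i < j} (\<lambda>_. borel)) (\<lambda>\<omega>. \<lambda>e\<in>{(i, j). i < j}. \<Delta> \<omega> $ fst e $ snd e)
      = Pi\<^sub>M {(i, j). i < j} (\<lambda>_. unif)"
begin

text \<open>
  The indicator of the event is a function of the six entries, so its expectation is an iterated
  integral; the five inner integrals scale with the fifth power of the leading length.
\<close>

lemma emeasure_leading:
  assumes [measurable]: "J \<in> sets borel" and J: "J \<subseteq> {0..1}"
  shows "{\<omega> \<in> space M. leading J (\<Delta> \<omega>)} \<in> events" "emeasure M {\<omega> \<in> space M. leading J (\<Delta> \<omega>)} = flap_volume J / 6"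
proof -
  let ?I = "{(0,1), (0,2), (1,2), (0,3), (1,3), (2,3)} :: (4 \<times> 4) set"
  define \<Phi> where "\<Phi> e x y z w f = (if 0 < e then flaps_in J (x / e) (y / e) (z / e) (w / e) (f / e) else 0)" for e x y z w f :: real
  have \<Phi>: "(\<lambda>(e, x, y, z, w, f). \<Phi> e x y z w f) \<in> borel_measurable (borel \<Otimes>\<^sub>M borel \<Otimes>\<^sub>M borel \<Otimes>\<^sub>M borel \<Otimes>\<^sub>M borel \<Otimes>\<^sub>M borel)"
    unfolding \<Phi>_def split_beta' by measurable
  have ind: "(if leading J (\<Delta> \<omega>) then 1 else 0) = \<Phi> (\<Delta> \<omega> $ 0 $ 1) (\<Delta> \<omega> $ 0 $ 2) (\<Delta> \<omega> $ 1 $ 2) (\<Delta> \<omega> $ 0 $ 3) (\<Delta> \<omega> $ 1 $ 3) (\<Delta> \<omega> $ 2 $ 3)" if "\<omega> \<in> space M" for \<omega>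
    unfolding \<Phi>_def using leading_iff[OF symmetric[OF that] zero_diagonal[OF that] J] .
  have m: "(\<lambda>\<omega>. if leading J (\<Delta> \<omega>) then 1 else 0 :: ennreal) \<in> borel_measurable M"
    by (subst measurable_cong[OF ind]) (auto intro!: measurable_six_arguments[OF \<Phi>] measurable_entry)
  have "(\<lambda>\<omega>. if leading J (\<Delta> \<omega>) then 1 else 0 :: ennreal) -` {1} \<inter> space M \<in> events"
    by (rule measurable_sets[OF m]) simp
  also have "(\<lambda>\<omega>. if leading J (\<Delta> \<omega>) then 1 else 0 :: ennreal) -` {1} \<inter> space M = {\<omega> \<in> space M. leading J (\<Delta> \<omega>)}"
    by (auto split: if_splits)
  finally show ev: "{\<omega> \<in> space M. leading J (\<Delta> \<omega>)} \<in> events" .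
  have "emeasure M {\<omega> \<in> space M. leading J (\<Delta> \<omega>)} = (\<integral>\<^sup>+\<omega>. indicator {\<omega> \<in> space M. leading J (\<Delta> \<omega>)} \<omega> \<partial>M)"
    using ev by simp
  also have "\<dots> = (\<integral>\<^sup>+\<omega>. \<Phi> (\<Delta> \<omega> $ 0 $ 1) (\<Delta> \<omega> $ 0 $ 2) (\<Delta> \<omega> $ 1 $ 2) (\<Delta> \<omega> $ 0 $ 3) (\<Delta> \<omega> $ 1 $ 3) (\<Delta> \<omega> $ 2 $ 3) \<partial>M)"
    by (rule nn_integral_cong) (simp add: indicator_def flip: ind)
  also have "\<dots> = (\<integral>\<^sup>+r. \<Phi> (r (0,1)) (r (0,2)) (r (1,2)) (r (0,3)) (r (1,3)) (r (2,3)) \<partial>distr M (Pi\<^sub>M ?I (\<lambda>_. borel)) (\<lambda>\<omega>. \<lambda>e\<in>?I. \<Delta> \<omega> $ fst e $ snd e))"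
  proof -
    have X: "(\<lambda>\<omega>. \<lambda>e\<in>?I. \<Delta> \<omega> $ fst e $ snd e) \<in> measurable M (Pi\<^sub>M ?I (\<lambda>_. borel))"
      by (intro measurable_restrict measurable_entry)
    have "(\<lambda>r. \<Phi> (r (0,1)) (r (0,2)) (r (1,2)) (r (0,3)) (r (1,3)) (r (2,3))) \<in> borel_measurable (Pi\<^sub>M ?I (\<lambda>_. borel))"
      by (intro measurable_six_arguments[OF \<Phi>] measurable_component_singleton) blast+
    then show ?thesis by (subst nn_integral_distr[OF X]) simp_all
  qed
  also have "\<dots> = (\<integral>\<^sup>+r. \<Phi> (r (0,1)) (r (0,2)) (r (1,2)) (r (0,3)) (r (1,3)) (r (2,3)) \<partial>Pi\<^sub>M ?I (\<lambda>_. unif))"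
    unfolding joint_law[unfolded edges_four] ..
  also have "\<dots> = (\<integral>\<^sup>+e\<in>{0..1}. \<integral>\<^sup>+x\<in>{0..1}. \<integral>\<^sup>+y\<in>{0..1}. \<integral>\<^sup>+z\<in>{0..1}. \<integral>\<^sup>+w\<in>{0..1}. \<integral>\<^sup>+f\<in>{0..1}. \<Phi> e x y z w f
      \<partial>lborel \<partial>lborel \<partial>lborel \<partial>lborel \<partial>lborel \<partial>lborel)"
    by (rule integral_six_coordinates) (simp_all add: \<Phi>)
  also have "\<dots> = (\<integral>\<^sup>+e\<in>{0..1}. (if 0 < e then ennreal e ^ 5 * flap_volume J else 0) \<partial>lborel)"
  proof (rule nn_integral_cong)
    fix e :: real
    show "(\<integral>\<^sup>+x\<in>{0..1}. \<integral>\<^sup>+y\<in>{0..1}. \<integral>\<^sup>+z\<in>{0..1}. \<integral>\<^sup>+w\<in>{0..1}. \<integral>\<^sup>+f\<in>{0..1}. \<Phi> e x y z w f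
      \<partial>lborel \<partial>lborel \<partial>lborel \<partial>lborel \<partial>lborel) * indicator {0..1} e = (if 0 < e then ennreal e ^ 5 * flap_volume J else 0) * indicator {0..1} e"
      using scaled_flap_volume[OF assms, of e] by (cases "0 < e \<and> e \<le> 1") (auto simp: \<Phi>_def indicator_def)
  qed
  also have "\<dots> = flap_volume J / 6" by (rule integral_fifth_power)
  finally show "emeasure M {\<omega> \<in> space M. leading J (\<Delta> \<omega>)} = flap_volume J / 6" .
qed

text \<open>
  A permutation of the vertices permutes the edges, after each image has been sorted into the form
  \<open>i < j\<close>; the product of equal distributions is invariant under this reindexing.
\<close>

lemma relabelled:
  assumes "bij \<sigma>"
  shows "random_edge_lengths M (\<lambda>\<omega>. \<chi> i j. \<Delta> \<omega> $ \<sigma> i $ \<sigma> j)"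
proof
  have ne: "i \<noteq> j \<Longrightarrow> \<sigma> i \<noteq> \<sigma> j" for i j using assms by (auto simp: bij_def inj_def)
  show "transpose (\<chi> i j. \<Delta> \<omega> $ \<sigma> i $ \<sigma> j) = (\<chi> i j. \<Delta> \<omega> $ \<sigma> i $ \<sigma> j)" if "\<omega> \<in> space M" for \<omega>
    using symmetric_entries[OF symmetric[OF that]] by (simp add: transpose_def vec_eq_iff)
  show "(\<chi> i j. \<Delta> \<omega> $ \<sigma> i $ \<sigma> j) $ i $ i = 0" if "\<omega> \<in> space M" for \<omega> i
    using zero_diagonal[OF that] by simp
  have swap: "\<Delta> \<omega> $ \<sigma> i $ \<sigma> j = \<Delta> \<omega> $ min (\<sigma> i) (\<sigma> j) $ max (\<sigma> i) (\<sigma> j)" if "\<omega> \<in> space M" for \<omega> i j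
    using symmetric_entries[OF symmetric[OF that]] by (simp add: min_def max_def)
  show "(\<lambda>\<omega>. (\<chi> i j. \<Delta> \<omega> $ \<sigma> i $ \<sigma> j) $ i $ j) \<in> borel_measurable M" for i j
    by (simp add: measurable_entry)
  let ?I = "{(i, j). i < j} :: (4 \<times> 4) set"
  let ?g = "\<lambda>e. (min (\<sigma> (fst e)) (\<sigma> (snd e)), max (\<sigma> (fst e)) (\<sigma> (snd e)))"
  have inj: "inj_on ?g ?I"
  proof (rule inj_onI, clarsimp)
    fix i j k l :: 4 assume l: "i < j" "k < l" and e: "min (\<sigma> i) (\<sigma> j) = min (\<sigma> k) (\<sigma> l)" "max (\<sigma> i) (\<sigma> j) = max (\<sigma> k) (\<sigma> l)"
    have "\<sigma> i = \<sigma> k \<and> \<sigma> j = \<sigma> l \<or> \<sigma> i = \<sigma> l \<and> \<sigma> j = \<sigma> k" using e by (auto simp: min_def max_def split: if_splits)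
    then have "i = k \<and> j = l \<or> i = l \<and> j = k" using assms by (simp add: bij_def inj_eq)
    then show "i = k \<and> j = l" using l by auto
  qed
  have sub: "?g \<in> ?I \<rightarrow> ?I"
  proof (rule Pi_I)
    fix e :: "4 \<times> 4" assume "e \<in> ?I"
    then have "fst e < snd e" unfolding mem_Collect_eq split_beta .
    then have "\<sigma> (fst e) \<noteq> \<sigma> (snd e)" by (rule ne[OF less_imp_neq])
    then have "min (\<sigma> (fst e)) (\<sigma> (snd e)) < max (\<sigma> (fst e)) (\<sigma> (snd e))"
      by (cases "\<sigma> (fst e) < \<sigma> (snd e)") (simp_all add: min_def max_def not_less order.strict_iff_order)
    then show "?g e \<in> ?I" unfolding mem_Collect_eq prod.case .
  qed
  let ?X = "\<lambda>\<omega>. \<lambda>e\<in>?I. \<Delta> \<omega> $ fst e $ snd e" and ?B = "Pi\<^sub>M ?I (\<lambda>_. borel :: real measure)" and ?U = "Pi\<^sub>M ?I (\<lambda>_. unif)"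
  have sets: "sets ?U = sets ?B" by (rule sets_PiM_cong) simp_all
  have X: "?X \<in> measurable M ?B" by (intro measurable_restrict measurable_entry)
  have G: "(\<lambda>d. \<lambda>e\<in>?I. d (?g e)) \<in> measurable ?B ?B"
    using sub by (intro measurable_restrict measurable_component_singleton) blast
  have "distr M ?B (\<lambda>\<omega>. \<lambda>e\<in>?I. (\<chi> i j. \<Delta> \<omega> $ \<sigma> i $ \<sigma> j) $ fst e $ snd e) = distr M ?B ((\<lambda>d. \<lambda>e\<in>?I. d (?g e)) \<circ> ?X)"
  proof (rule distr_cong)
    fix \<omega> assume "\<omega> \<in> space M"
    note s = symmetric_entries[OF symmetric[OF this]]
    show "(\<lambda>e\<in>?I. (\<chi> i j. \<Delta> \<omega> $ \<sigma> i $ \<sigma> j) $ fst e $ snd e) = ((\<lambda>d. \<lambda>e\<in>?I. d (?g e)) \<circ> ?X) \<omega>"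
    proof (rule ext)
      fix e :: "4 \<times> 4"
      have "\<Delta> \<omega> $ \<sigma> (fst e) $ \<sigma> (snd e) = \<Delta> \<omega> $ fst (?g e) $ snd (?g e)"
        using s[of "\<sigma> (fst e)" "\<sigma> (snd e)"] by (simp add: min_def max_def)
      then show "(\<lambda>e\<in>?I. (\<chi> i j. \<Delta> \<omega> $ \<sigma> i $ \<sigma> j) $ fst e $ snd e) e = ((\<lambda>d. \<lambda>e\<in>?I. d (?g e)) \<circ> ?X) \<omega> e"
        using Pi_mem[OF sub, of e] by (cases "e \<in> ?I") (simp_all only: restrict_apply comp_apply if_True if_False simp_thms vec_lambda_beta)
    qed
  qed simp_all
  also have "\<dots> = distr (distr M ?B ?X) ?B (\<lambda>d. \<lambda>e\<in>?I. d (?g e))"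
    by (rule distr_distr[OF G X, symmetric])
  also have "\<dots> = distr ?U ?U (\<lambda>d. \<lambda>e\<in>?I. d (?g e))"
    unfolding joint_law by (rule distr_cong) (simp_all add: sets)
  also have "\<dots> = ?U"
    using distr_PiM_reindex[OF prob_space_unif inj sub] by simp
  finally show "distr M ?B (\<lambda>\<omega>. \<lambda>e\<in>?I. (\<chi> i j. \<Delta> \<omega> $ \<sigma> i $ \<sigma> j) $ fst e $ snd e) = ?U" .
qed

end

lemma random_edge_lengthsI:
  assumes "prob_space M"
    and symmetric: "\<And>\<omega>. \<omega> \<in> space M \<Longrightarrow> transpose (\<Delta> \<omega>) = \<Delta> \<omega>"
    and zero_diagonal: "\<And>\<omega> i. \<omega> \<in> space M \<Longrightarrow> \<Delta> \<omega> $ i $ i = 0"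
    and independent: "prob_space.indep_vars M (\<lambda>_. borel) (\<lambda>(i, j) \<omega>. \<Delta> \<omega> $ i $ j) {(i, j). i < j}"
    and uniform: "\<And>i j. i < j \<Longrightarrow> distr M borel (\<lambda>\<omega>. \<Delta> \<omega> $ i $ j) = uniform_measure lborel {0..1}"
  shows "random_edge_lengths M \<Delta>"
proof -
  interpret prob_space M by fact
  have *: "(\<lambda>\<omega>. \<Delta> \<omega> $ i $ j) \<in> borel_measurable M" if "i < j" for i j
  proof -
    have "\<forall>e\<in>{(i, j). i < j}. random_variable borel ((\<lambda>(i, j) \<omega>. \<Delta> \<omega> $ i $ j) e)"
      using independent unfolding indep_vars_def by (rule conjunct1)
    moreover have "(i, j) \<in> {(i, j). i < j}" using that by blast
    ultimately have "random_variable borel ((\<lambda>(i, j) \<omega>. \<Delta> \<omega> $ i $ j) (i, j))" by (rule bspec)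
    then show ?thesis unfolding prod.case .
  qed
  have meas: "(\<lambda>\<omega>. \<Delta> \<omega> $ i $ j) \<in> borel_measurable M" for i j
  proof -
    consider "i < j" | "j < i" | "i = j" by fastforce
    then show ?thesis
    proof cases
      case 2
      have "(\<lambda>\<omega>. \<Delta> \<omega> $ i $ j) \<in> borel_measurable M \<longleftrightarrow> (\<lambda>\<omega>. \<Delta> \<omega> $ j $ i) \<in> borel_measurable M"
        by (rule measurable_cong) (rule symmetric_entries[OF symmetric])
      then show ?thesis using *[OF 2] by blast
    next
      case 3
      have "(\<lambda>\<omega>. \<Delta> \<omega> $ i $ j) \<in> borel_measurable M \<longleftrightarrow> (\<lambda>\<omega>. 0 :: real) \<in> borel_measurable M"
        by (rule measurable_cong) (simp add: 3 zero_diagonal)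
      moreover have "(\<lambda>\<omega>. 0 :: real) \<in> borel_measurable M" by (rule borel_measurable_const)
      ultimately show ?thesis by (rule iffD2)
    qed (rule *)
  qed
  have eq: "(\<lambda>(i, j) \<omega>. \<Delta> \<omega> $ i $ j) = (\<lambda>e \<omega>. \<Delta> \<omega> $ fst e $ snd e)" by (simp add: fun_eq_iff split_beta)
  let ?I = "{(i, j). i < j} :: (4 \<times> 4) set"
  have "distr M (Pi\<^sub>M ?I (\<lambda>_. borel)) (\<lambda>\<omega>. \<lambda>e\<in>?I. \<Delta> \<omega> $ fst e $ snd e) = Pi\<^sub>M ?I (\<lambda>e. distr M borel (\<lambda>\<omega>. \<Delta> \<omega> $ fst e $ snd e))"
  proof (rule indep_vars_iff_distr_eq_PiM'[THEN iffD1, OF _ _ independent[unfolded eq]])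
    show "?I \<noteq> {}" unfolding edges_four by blast
  qed (rule meas)
  also have "\<dots> = Pi\<^sub>M ?I (\<lambda>_. unif)"
    by (rule PiM_cong) (auto intro!: uniform)
  finally have joint: "distr M (Pi\<^sub>M ?I (\<lambda>_. borel)) (\<lambda>\<omega>. \<lambda>e\<in>?I. \<Delta> \<omega> $ fst e $ snd e) = Pi\<^sub>M ?I (\<lambda>_. unif)" .
  show ?thesis by unfold_locales (fact symmetric zero_diagonal meas joint)+
qed

section \<open>From the probability to the normalised volume\<close>

text \<open>
  The notion \<open>leading\<close> for an arbitrary edge in place of the edge between \<open>0\<close> and \<open>1\<close>.
\<close>

definition longest_edge :: "real set \<Rightarrow> 4 \<Rightarrow> 4 \<Rightarrow> real ^ 4 ^ 4 \<Rightarrow> bool" where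
  "longest_edge J a b A \<longleftrightarrow> tetrahedron_distance_matrix A \<and> 0 < A $ a $ b \<and>
     (\<forall>k l. k \<noteq> l \<and> {k, l} \<noteq> {a, b} \<longrightarrow> A $ k $ l / A $ a $ b \<in> J)"

lemma leading_relabel:
  assumes "bij \<sigma>"
  shows "leading J (\<chi> i j. A $ \<sigma> i $ \<sigma> j) \<longleftrightarrow> longest_edge J (\<sigma> 0) (\<sigma> 1) A"
proof -
  have inj: "\<sigma> i = \<sigma> j \<longleftrightarrow> i = j" for i j using assms by (simp add: bij_def inj_eq)
  have surj: "\<exists>i. k = \<sigma> i" for k using assms by (metis bij_pointE)
  have "(\<forall>k l. k \<noteq> l \<and> {k, l} \<noteq> {\<sigma> 0, \<sigma> 1} \<longrightarrow> A $ k $ l / A $ \<sigma> 0 $ \<sigma> 1 \<in> J) \<longleftrightarrow>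
    (\<forall>i j. \<sigma> i \<noteq> \<sigma> j \<and> {\<sigma> i, \<sigma> j} \<noteq> {\<sigma> 0, \<sigma> 1} \<longrightarrow> A $ \<sigma> i $ \<sigma> j / A $ \<sigma> 0 $ \<sigma> 1 \<in> J)" (is "?l \<longleftrightarrow> ?r")
  proof (rule iffI)
    assume r: ?r show ?l
    proof (intro allI)
      fix k l
      obtain i j where ij: "k = \<sigma> i" "l = \<sigma> j" using surj[of k] surj[of l] by (elim exE)
      show "k \<noteq> l \<and> {k, l} \<noteq> {\<sigma> 0, \<sigma> 1} \<longrightarrow> A $ k $ l / A $ \<sigma> 0 $ \<sigma> 1 \<in> J" unfolding ij using r[rule_format, of i j] by (rule impI)
    qed
  qed (intro allI, elim allE)
  then show ?thesis
    unfolding leading_def longest_edge_def tetrahedron_relabel[OF assms] vec_lambda_beta doubleton_eq_iff inj by (simp only:)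
qed

text \<open>
  Two transpositions suffice: one moves \<open>0\<close> to \<open>a\<close>, the other corrects \<open>1\<close> without touching \<open>0\<close>.
\<close>

lemma ex_relabelling:
  assumes "a \<noteq> (b :: 4)"
  shows "\<exists>\<sigma> :: 4 \<Rightarrow> 4. bij \<sigma> \<and> \<sigma> 0 = a \<and> \<sigma> 1 = b"
proof -
  \<comment> \<open>\<open>\<tau>\<close> is an involution, so its value at \<open>b\<close> can only be \<open>0\<close> if \<open>b = a\<close>\<close>
  define \<tau> where "\<tau> = Transposition.transpose 0 a"
  define \<rho> where "\<rho> = Transposition.transpose 1 (\<tau> b)"
  have "\<tau> b \<noteq> 0"
  proof
    assume "\<tau> b = 0"
    then have "\<tau> (\<tau> b) = \<tau> 0" by (rule arg_cong)
    then show False using assms by (simp add: \<tau>_def)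
  qed
  then have "\<rho> 0 = 0" by (simp add: \<rho>_def)
  then have "(\<tau> \<circ> \<rho>) 0 = a" "(\<tau> \<circ> \<rho>) 1 = b" by (simp_all add: \<tau>_def \<rho>_def)
  moreover have "bij (\<tau> \<circ> \<rho>)" unfolding \<tau>_def \<rho>_def by (intro bij_comp bij_transpose)
  ultimately show ?thesis by blast
qed

lemma tetrahedron_positive:
  assumes "tetrahedron_distance_matrix A" "i \<noteq> j"
  shows "0 < A $ i $ j"
proof -
  obtain p :: "4 \<Rightarrow> real^3" where p: "inj p" and d: "\<forall>i j. dist (p i) (p j) = A $ i $ j"
    using assms unfolding tetrahedron_distance_matrix_def by blast
  have "p i \<noteq> p j" using p assms(2) by (simp add: inj_eq)
  then show ?thesis using d[rule_format, of i j] by (metis zero_less_dist_iff)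
qed

lemma ex_longest_edge:
  assumes t: "tetrahedron_distance_matrix A" and sym: "transpose A = A"
  shows "\<exists>(a, b) \<in> {(i, j). i < j}. longest_edge {0..1} a b A"
proof -
  let ?I = "{(i, j). i < j} :: (4 \<times> 4) set"
  let ?f = "\<lambda>e. A $ fst e $ snd e"
  have I: "finite ?I" "?I \<noteq> {}" unfolding edges_four by simp_all
  have "Max (?f ` ?I) \<in> ?f ` ?I" using I(2) by (intro Max_in finite_imageI I(1)) blast
  then obtain e where e: "Max (?f ` ?I) = ?f e" "e \<in> ?I" by (rule imageE)
  have max: "?f e' \<le> ?f e" if "e' \<in> ?I" for e'
    unfolding e(1)[symmetric] by (rule Max_ge[OF finite_imageI[OF I(1)] imageI[OF that]])
  obtain a b where ab: "e = (a, b)" by (rule prod.exhaust)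
  have "a < b" using e(2) unfolding ab mem_Collect_eq prod.case .
  then have pos: "0 < A $ a $ b" by (intro tetrahedron_positive[OF t] less_imp_neq)
  have m: "A $ k $ l \<le> A $ a $ b" if "k < l" for k l
    using max[of "(k, l)"] that unfolding ab mem_Collect_eq prod.case fst_conv snd_conv .
  have "A $ k $ l / A $ a $ b \<in> {0..1}" if "k \<noteq> l" for k l
  proof -
    have "A $ k $ l \<le> A $ a $ b"
    proof (rule linorder_cases[of k l])
      assume "l < k"
      then show ?thesis unfolding symmetric_entries[OF sym, of k l] by (rule m)
    qed (use that m in blast)+
    then show ?thesis using pos tetrahedron_positive[OF t that] by simp
  qed
  then have "longest_edge {0..1} a b A" unfolding longest_edge_def using t pos by blast
  then show ?thesis using e(2) unfolding ab by (intro bexI[of _ "(a, b)"]) (simp_all only: prod.case)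
qed

context random_edge_lengths begin

lemma emeasure_longest_edge:
  assumes J: "J \<in> sets borel" "J \<subseteq> {0..1}" and ab: "a \<noteq> b"
  shows "{\<omega> \<in> space M. longest_edge J a b (\<Delta> \<omega>)} \<in> events" "emeasure M {\<omega> \<in> space M. longest_edge J a b (\<Delta> \<omega>)} = flap_volume J / 6"
proof -
  obtain \<sigma> :: "4 \<Rightarrow> 4" where s: "bij \<sigma>" "\<sigma> 0 = a" "\<sigma> 1 = b" using ex_relabelling[OF ab] by blast
  interpret R: random_edge_lengths M "\<lambda>\<omega>. \<chi> i j. \<Delta> \<omega> $ \<sigma> i $ \<sigma> j" using relabelled[OF s(1)] .
  show "{\<omega> \<in> space M. longest_edge J a b (\<Delta> \<omega>)} \<in> events" "emeasure M {\<omega> \<in> space M. longest_edge J a b (\<Delta> \<omega>)} = flap_volume J / 6"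
    using R.emeasure_leading[OF J] unfolding leading_relabel[OF s(1)] s(2,3) by (simp_all only:)
qed

text \<open>
  Every tetrahedron has a longest edge, so the six events with \<open>J = {0..1}\<close> cover the event; the
  six events with \<open>J = {0..<1}\<close> are disjoint parts of it. Both families have total probability
  \<open>flap_volume {0..1}\<close>.
\<close>

lemma emeasure_tetrahedron:
  "emeasure M {\<omega> \<in> space M. tetrahedron_distance_matrix (\<Delta> \<omega>)} = flap_volume {0..1}"
proof -
  let ?I = "{(i, j). i < j} :: (4 \<times> 4) set"
  let ?T = "{\<omega> \<in> space M. tetrahedron_distance_matrix (\<Delta> \<omega>)}"
  let ?L = "\<lambda>J e. {\<omega> \<in> space M. longest_edge J (fst e) (snd e) (\<Delta> \<omega>)}"
  have I: "finite ?I" "card ?I = 6" unfolding edges_four by simp_all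
  have ne: "fst e \<noteq> snd e" if "e \<in> ?I" for e
    using that unfolding mem_Collect_eq split_beta by (rule less_imp_neq)
  have six: "(\<Sum>e\<in>?I. flap_volume {0..1} / 6) = flap_volume {0..1}"
  proof -
    have "(6::ennreal) / 6 = 1" by (rule ennreal_divide_self) simp_all
    moreover have "(\<Sum>e\<in>?I. flap_volume {0..1} / 6) = flap_volume {0..1} * (6 / 6)"
      unfolding sum_constant I(2) divide_ennreal_def of_nat_numeral by (simp only: mult_ac)
    ultimately show ?thesis by simp
  qed
  have J: "{0..1} \<in> sets (borel :: real measure)" "{0..1} \<subseteq> {0..1::real}" "{0..<1} \<in> sets (borel :: real measure)" "{0..<1} \<subseteq> {0..1::real}"
    by auto
  have T: "?T = (\<Union>e\<in>?I. ?L {0..1} e)"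
  proof (intro equalityI subsetI)
    fix \<omega> assume w: "\<omega> \<in> ?T"
    then have "\<omega> \<in> space M" "tetrahedron_distance_matrix (\<Delta> \<omega>)" by blast+
    from ex_longest_edge[OF this(2) symmetric[OF this(1)]] this(1)
    show "\<omega> \<in> (\<Union>e\<in>?I. ?L {0..1} e)" by force
  qed (auto simp: longest_edge_def)
  have Tm: "?T \<in> events" unfolding T using I(1) emeasure_longest_edge(1)[OF J(1,2) ne] by (intro sets.finite_UN) blast+
  have "emeasure M ?T \<le> (\<Sum>e\<in>?I. emeasure M (?L {0..1} e))"
    unfolding T using emeasure_longest_edge(1)[OF J(1,2) ne] I(1) by (intro emeasure_subadditive_finite) blast+
  also have "\<dots> = (\<Sum>e\<in>?I. flap_volume {0..1} / 6)"
    by (rule sum.cong[OF refl]) (rule emeasure_longest_edge(2)[OF J(1,2) ne])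
  finally have le: "emeasure M ?T \<le> flap_volume {0..1}" unfolding six .
  have disj: "disjoint_family_on (?L {0..<1}) ?I" unfolding disjoint_family_on_def
  proof (intro ballI impI equals0I)
    fix e e' \<omega> assume e: "e \<in> ?I" "e' \<in> ?I" "e \<noteq> e'" and w: "\<omega> \<in> ?L {0..<1} e \<inter> ?L {0..<1} e'"
    have o: "fst e < snd e" "fst e' < snd e'" using e(1,2) unfolding mem_Collect_eq split_beta .
    have sets: "{fst e, snd e} \<noteq> {fst e', snd e'}"
    proof
      assume "{fst e, snd e} = {fst e', snd e'}"
      then consider "fst e = fst e'" "snd e = snd e'" | "fst e = snd e'" "snd e = fst e'" unfolding doubleton_eq_iff by blast
      then show False
      proof cases
        case 1 then show False using e(3) by (simp add: prod_eq_iff)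
      next
        case 2 then show False using o by (metis order.asym)
      qed
    qed
    let ?a = "\<Delta> \<omega> $ fst e $ snd e" and ?b = "\<Delta> \<omega> $ fst e' $ snd e'"
    have w1: "longest_edge {0..<1} (fst e) (snd e) (\<Delta> \<omega>)" and w2: "longest_edge {0..<1} (fst e') (snd e') (\<Delta> \<omega>)" using w by blast+
    have "0 < ?a" "?b / ?a \<in> {0..<1}" using w1 sets[symmetric] ne[OF e(2)] unfolding longest_edge_def by blast+
    moreover have "0 < ?b" "?a / ?b \<in> {0..<1}" using w2 sets ne[OF e(1)] unfolding longest_edge_def by blast+
    ultimately show False by (simp add: field_simps)
  qed
  have "flap_volume {0..1} = (\<Sum>e\<in>?I. emeasure M (?L {0..<1} e))"
    using six emeasure_longest_edge(2)[OF J(3,4) ne] unfolding flap_volume_half_open by (simp cong: sum.cong_simp)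
  also have "\<dots> = emeasure M (\<Union>e\<in>?I. ?L {0..<1} e)"
    using emeasure_longest_edge(1)[OF J(3,4) ne] disj I(1) by (intro sum_emeasure) blast+
  also have "\<dots> \<le> emeasure M ?T"
    by (rule emeasure_mono[OF _ Tm]) (auto simp: longest_edge_def)
  finally show ?thesis using le by (rule antisym[rotated])
qed

end

section \<open>The admissible lengths of the opposite edge\<close>

definition gap :: "real \<times> real \<Rightarrow> real \<times> real \<Rightarrow> real" where
  "gap q q' = min 1 (far_dist q q') - near_dist q q'"

text \<open>
  The squared distance of the apex from the midpoint of the common edge, by the median formula; it
  is polynomial in the sides, unlike the altitude.
\<close>

definition sqradius :: "real \<times> real \<Rightarrow> real" where
  "sqradius q = ((fst q)\<^sup>2 + (snd q)\<^sup>2) / 2 - 1 / 4"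

lemma measurable_abscissa:
  assumes "f \<in> borel_measurable M" shows "(\<lambda>t. abscissa (f t)) \<in> borel_measurable M"
proof -
  have "abscissa \<in> borel_measurable (borel \<Otimes>\<^sub>M borel)" unfolding abscissa_def[abs_def] by measurable
  then have "abscissa \<in> borel_measurable borel" unfolding borel_prod .
  from measurable_compose[OF assms this] show ?thesis .
qed

lemma measurable_altitude:
  assumes "f \<in> borel_measurable M" shows "(\<lambda>t. altitude (f t)) \<in> borel_measurable M"
proof -
  have "altitude \<in> borel_measurable (borel \<Otimes>\<^sub>M borel)" unfolding altitude_def[abs_def] by measurable
  then have "altitude \<in> borel_measurable borel" unfolding borel_prod .
  from measurable_compose[OF assms this] show ?thesis .
qed

lemma measurable_sqradius:
  assumes "f \<in> borel_measurable M" shows "(\<lambda>t. sqradius (f t)) \<in> borel_measurable M"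
proof -
  have "sqradius \<in> borel_measurable (borel \<Otimes>\<^sub>M borel)" unfolding sqradius_def[abs_def] by measurable
  then have "sqradius \<in> borel_measurable borel" unfolding borel_prod .
  from measurable_compose[OF assms this] show ?thesis .
qed

lemma measurable_triangles [measurable]: "triangles \<in> sets borel"
proof -
  have eq: "triangles = {q. fst q \<le> 1} \<inter> {q. snd q \<le> 1} \<inter> {q. 1 < fst q + snd q}"
    by (auto simp: triangles_def)
  show ?thesis unfolding eq
    by (intro sets.Int borel_closed[OF closed_Collect_le] borel_open[OF open_Collect_less] continuous_intros)
qed

lemma measurable_near:
  assumes "f \<in> borel_measurable M" "g \<in> borel_measurable M"
  shows "(\<lambda>t. near_dist (f t) (g t)) \<in> borel_measurable M"
proof -
  have "sqrt \<in> borel_measurable borel" by (intro borel_measurable_continuous_onI continuous_intros)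
  moreover have "(\<lambda>t. (abscissa (f t) - abscissa (g t))\<^sup>2 + (altitude (f t) - altitude (g t))\<^sup>2) \<in> borel_measurable M"
    by (intro borel_measurable_add borel_measurable_power borel_measurable_diff measurable_abscissa measurable_altitude assms)
  ultimately show ?thesis unfolding near_dist_def by (rule measurable_compose[rotated])
qed

lemma measurable_far:
  assumes "f \<in> borel_measurable M" "g \<in> borel_measurable M"
  shows "(\<lambda>t. far_dist (f t) (g t)) \<in> borel_measurable M"
proof -
  have "sqrt \<in> borel_measurable borel" by (intro borel_measurable_continuous_onI continuous_intros)
  moreover have "(\<lambda>t. (abscissa (f t) - abscissa (g t))\<^sup>2 + (altitude (f t) + altitude (g t))\<^sup>2) \<in> borel_measurable M"
    by (intro borel_measurable_add borel_measurable_power borel_measurable_diff measurable_abscissa measurable_altitude assms)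
  ultimately show ?thesis unfolding far_dist_def by (rule measurable_compose[rotated])
qed

lemma measurable_gap:
  assumes "f \<in> borel_measurable M" "g \<in> borel_measurable M"
  shows "(\<lambda>t. gap (f t) (g t)) \<in> borel_measurable M"
  unfolding gap_def by (intro borel_measurable_diff borel_measurable_min borel_measurable_const measurable_near measurable_far assms)

lemma measurable_gap_right: "(\<lambda>q'. gap q q') \<in> borel_measurable borel"
  by (intro measurable_gap borel_measurable_const measurable_ident_sets refl)

lemma sqradius_eq:
  assumes "q \<in> triangles" shows "sqradius q = (abscissa q)\<^sup>2 + (altitude q)\<^sup>2"
proof -
  have "(abscissa q + 1 / 2)\<^sup>2 = (abscissa q)\<^sup>2 + abscissa q + 1 / 4" "(abscissa q - 1 / 2)\<^sup>2 = (abscissa q)\<^sup>2 - abscissa q + 1 / 4"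
    by (simp_all add: power2_sum power2_diff power_divide)
  then have "(abscissa q)\<^sup>2 + abscissa q + 1 / 4 + (altitude q)\<^sup>2 = (fst q)\<^sup>2" "(abscissa q)\<^sup>2 - abscissa q + 1 / 4 + (altitude q)\<^sup>2 = (snd q)\<^sup>2"
    using sides_from_apex[OF assms] by (simp_all only:)
  then show ?thesis unfolding sqradius_def by (simp add: field_simps)
qed

lemma unit_interval_bounds:
  fixes X Y :: real
  assumes "0 \<le> X" "X \<le> 1" "0 \<le> Y" "Y \<le> 1"
  shows "\<bar>(X - Y) / 2\<bar> \<le> 1 / 2" "(X + Y) / 2 - 1 / 4 \<le> 1"
  using assms by (auto simp: abs_le_iff field_simps)

lemma triangles_bounds:
  assumes q: "q \<in> triangles"
  shows "\<bar>abscissa q\<bar> \<le> 1 / 2" "0 \<le> altitude q" "altitude q \<le> 1" "0 \<le> sqradius q" "sqradius q \<le> 1"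
proof -
  have s: "0 \<le> fst q" "fst q \<le> 1" "0 \<le> snd q" "snd q \<le> 1" using q by (auto simp: triangles_def)
  have X: "0 \<le> (fst q)\<^sup>2" "(fst q)\<^sup>2 \<le> 1" "0 \<le> (snd q)\<^sup>2" "(snd q)\<^sup>2 \<le> 1" using s by (simp_all add: power_le_one)
  then show "\<bar>abscissa q\<bar> \<le> 1 / 2" unfolding abscissa_def by (rule unit_interval_bounds)
  show "sqradius q \<le> 1" unfolding sqradius_def using X by (rule unit_interval_bounds)
  show "0 \<le> altitude q" using altitude_square(2)[OF q] by simp
  show "0 \<le> sqradius q" unfolding sqradius_eq[OF q] by simp
  have "(altitude q)\<^sup>2 \<le> 1" using sides_from_apex(1)[OF q] X(2) zero_le_power2[of "abscissa q + 1 / 2"] by linarith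
  then show "altitude q \<le> 1" by (simp add: abs_square_le_1 abs_le_iff)
qed

lemma near_dist_commute: "near_dist q q' = near_dist q' q"
  by (simp add: near_dist_def power2_commute)

lemma near_dist_nonneg: "0 \<le> near_dist q q'" and far_dist_nonneg: "0 \<le> far_dist q q'"
  by (simp_all add: near_dist_def far_dist_def)

text \<open>
  Let the first apex be the higher one. Moving the lower apex to the endpoint of the
  common edge on the far side increases the distance, and the distance from an endpoint is a side of
  the first triangle. Hence the cut-off at \<open>1\<close> affects only the far end of the interval.
\<close>

lemma near_dist_le_1:
  assumes "q \<in> triangles" "q' \<in> triangles"
  shows "near_dist q q' \<le> 1"
proof -
  have *: "near_dist q q' \<le> 1" if q: "q \<in> triangles" "q' \<in> triangles" and le: "altitude q' \<le> altitude q" for q q'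
  proof -
    have "\<bar>abscissa q - abscissa q'\<bar> \<le> \<bar>abscissa q\<bar> + 1 / 2" using triangles_bounds(1)[OF q(2)] by linarith
    then have "(abscissa q - abscissa q')\<^sup>2 \<le> (\<bar>abscissa q\<bar> + 1 / 2)\<^sup>2" by (metis abs_ge_zero power2_abs power_mono)
    moreover have "(altitude q - altitude q')\<^sup>2 \<le> (altitude q)\<^sup>2" using le triangles_bounds(2)[OF q(2)] by (intro power_mono) auto
    moreover have "(\<bar>abscissa q\<bar> + 1 / 2)\<^sup>2 + (altitude q)\<^sup>2 \<le> 1"
    proof (cases "0 \<le> abscissa q")
      case True
      have "(fst q)\<^sup>2 \<le> 1" using q(1) by (auto simp: triangles_def abs_square_le_1)
      then show ?thesis using sides_from_apex(1)[OF q(1)] True by simp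
    next
      case False
      have "(snd q)\<^sup>2 \<le> 1" using q(1) by (auto simp: triangles_def abs_square_le_1)
      moreover have "(\<bar>abscissa q\<bar> + 1 / 2)\<^sup>2 = (abscissa q - 1 / 2)\<^sup>2" using False by (simp add: power2_eq_square algebra_simps)
      ultimately show ?thesis using sides_from_apex(2)[OF q(1)] by simp
    qed
    ultimately have "(abscissa q - abscissa q')\<^sup>2 + (altitude q - altitude q')\<^sup>2 \<le> 1" by linarith
    then show ?thesis by (simp add: near_dist_def)
  qed
  show ?thesis using *[of q q'] *[of q' q] assms near_dist_commute[of q q'] by (cases "altitude q' \<le> altitude q") auto
qed

lemma near_le_far:
  assumes "q \<in> triangles" "q' \<in> triangles"
  shows "near_dist q q' \<le> far_dist q q'"
proof (rule power2_le_imp_le[OF _ far_dist_nonneg])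
  show "(near_dist q q')\<^sup>2 \<le> (far_dist q q')\<^sup>2"
    using far_minus_near[of q q'] triangles_bounds(2)[OF assms(1)] triangles_bounds(2)[OF assms(2)] by simp
qed

lemma gap_bounds:
  assumes "q \<in> triangles" "q' \<in> triangles"
  shows "0 \<le> gap q q'" "gap q q' \<le> 1"
  using near_le_far[OF assms] near_dist_le_1[OF assms] near_dist_nonneg[of q q'] by (auto simp: gap_def)

lemma nn_integral_lborel_pair:
  fixes f :: "real \<times> real \<Rightarrow> ennreal"
  assumes "f \<in> borel_measurable borel"
  shows "(\<integral>\<^sup>+q. f q \<partial>lborel) = (\<integral>\<^sup>+x. \<integral>\<^sup>+y. f (x, y) \<partial>lborel \<partial>lborel)"
proof -
  have "f \<in> borel_measurable (lborel \<Otimes>\<^sub>M lborel)" using assms unfolding lborel_prod by simp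
  from lborel.nn_integral_fst[OF this] show ?thesis unfolding lborel_prod ..
qed

text \<open>
  The innermost integral measures an interval of lengths of the opposite edge.
\<close>

lemma integral_flaps_in:
  "(\<integral>\<^sup>+f. flaps_in {0..1} x y z w f \<partial>lborel) =
    ennreal (gap (x, y) (z, w)) * indicator triangles (z, w) * indicator triangles (x, y)"
proof (cases "(x, y) \<in> triangles \<and> (z, w) \<in> triangles")
  case True
  then have T: "(x, y) \<in> triangles" "(z, w) \<in> triangles" by auto
  let ?n = "near_dist (x, y) (z, w)" and ?f = "far_dist (x, y) (z, w)"
  have I: "x \<in> {0..1}" "y \<in> {0..1}" "z \<in> {0..1}" "w \<in> {0..1}" using T by (auto simp: triangles_def)
  define A where "A = {f \<in> {0..1}. ?n < f \<and> f < ?f}"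
  have A: "A = (if ?f \<le> 1 then {?n<..<?f} else {?n<..1})"
    using near_dist_nonneg[of "(x, y)" "(z, w)"] by (auto simp: A_def)
  have "(\<integral>\<^sup>+f. flaps_in {0..1} x y z w f \<partial>lborel) = (\<integral>\<^sup>+f. indicator A f \<partial>lborel)"
    by (rule nn_integral_cong) (use T I in \<open>auto simp: flaps_in_def flaps_def A_def indicator_def\<close>)
  also have "\<dots> = emeasure lborel A" by (rule nn_integral_indicator) (simp add: A)
  also have "\<dots> = ennreal (gap (x, y) (z, w))"
    using near_le_far[OF T] near_dist_le_1[OF T] by (auto simp: A gap_def min_def)
  finally show ?thesis using T by simp
next
  case False
  then have "\<not> flaps x y z w f" for f unfolding flaps_def by blast
  then have "flaps_in {0..1} x y z w f = 0" for f by (simp add: flaps_in_def)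
  then show ?thesis using False by (auto simp: indicator_def)
qed

lemma flap_volume_eq_gap_integral:
  "flap_volume {0..1} = (\<integral>\<^sup>+q\<in>triangles. \<integral>\<^sup>+q'\<in>triangles. ennreal (gap q q') \<partial>lborel \<partial>lborel)"
proof -
  have inner: "(\<integral>\<^sup>+z. \<integral>\<^sup>+w. ennreal (gap p (z, w)) * indicator triangles (z, w) * c \<partial>lborel \<partial>lborel)
    = (\<integral>\<^sup>+q'\<in>triangles. ennreal (gap p q') \<partial>lborel) * c" for p c
  proof -
    have "(\<lambda>q'. ennreal (gap p q') * indicator triangles q' * c) \<in> borel_measurable borel"
      by (intro borel_measurable_times_ennreal borel_measurable_indicator measurable_triangles borel_measurable_const measurable_compose_rev[OF measurable_ennreal] measurable_gap_right)
    from nn_integral_lborel_pair[OF this, symmetric]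
    have "(\<integral>\<^sup>+z. \<integral>\<^sup>+w. ennreal (gap p (z, w)) * indicator triangles (z, w) * c \<partial>lborel \<partial>lborel)
      = (\<integral>\<^sup>+q'. ennreal (gap p q') * indicator triangles q' * c \<partial>lborel)" .
    also have "\<dots> = (\<integral>\<^sup>+q'\<in>triangles. ennreal (gap p q') \<partial>lborel) * c"
    proof (rule nn_integral_multc, unfold measurable_lborel2)
      show "(\<lambda>q'. ennreal (gap p q') * indicator triangles q') \<in> borel_measurable borel"
        by (intro borel_measurable_times_ennreal borel_measurable_indicator measurable_triangles measurable_compose_rev[OF measurable_ennreal] measurable_gap_right)
    qed
    finally show ?thesis .
  qed
  have "(\<lambda>(q, q'). ennreal (gap q q') * indicator triangles q') \<in> borel_measurable (borel \<Otimes>\<^sub>M lborel)"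
    unfolding split_beta'
    by (intro borel_measurable_times_ennreal measurable_compose_rev[OF measurable_ennreal] measurable_gap measurable_fst
      measurable_compose[OF measurable_snd borel_measurable_indicator]) (simp_all add: measurable_triangles)
  then have "(\<lambda>q. (\<integral>\<^sup>+q'\<in>triangles. ennreal (gap q q') \<partial>lborel) * indicator triangles q) \<in> borel_measurable borel"
    by (intro borel_measurable_times_ennreal lborel.borel_measurable_nn_integral borel_measurable_indicator measurable_triangles)
  note outer = nn_integral_lborel_pair[OF this, symmetric]
  show ?thesis unfolding flap_volume_def integral_flaps_in inner by (rule outer)
qed

section \<open>Bounds for the mean gap by low moments\<close>

text \<open>
  Both the Lebesgue measure on all triangles and its restrictions to grid cells are treated as
  instances, so that one moment computation serves the lower and the upper bound.
\<close>

locale triangle_measure = finite_measure M for M :: "(real \<times> real) measure" +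
  assumes sets_M: "sets M = sets borel" and AE_triangles: "AE q in M. q \<in> triangles"
begin

lemma borel_measurable_M: "f \<in> borel_measurable borel \<Longrightarrow> f \<in> borel_measurable M"
  unfolding measurable_cong_sets[OF sets_M refl] .

lemma integrable_bounded:
  fixes f :: "real \<times> real \<Rightarrow> real"
  assumes "f \<in> borel_measurable borel" and B: "\<And>q. q \<in> triangles \<Longrightarrow> \<bar>f q\<bar> \<le> B"
  shows "integrable M f"
proof (rule integrable_const_bound[where B = B])
  show "AE q in M. norm (f q) \<le> B" using AE_triangles by (rule AE_mp) (use B in simp)
qed (rule borel_measurable_M[OF assms(1)])

lemma nn_integral_le_integral:
  assumes "integrable M g" and f: "\<And>q. q \<in> triangles \<Longrightarrow> 0 \<le> g q" "\<And>q. q \<in> triangles \<Longrightarrow> f q \<le> ennreal (g q)"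
  shows "(\<integral>\<^sup>+q. f q \<partial>M) \<le> ennreal (\<integral>q. g q \<partial>M)"
proof -
  have "(\<integral>\<^sup>+q. f q \<partial>M) \<le> (\<integral>\<^sup>+q. ennreal (g q) \<partial>M)"
    by (rule nn_integral_mono_AE, rule AE_mp[OF AE_triangles]) (use f in simp)
  also have "\<dots> = ennreal (\<integral>q. g q \<partial>M)"
    by (rule nn_integral_eq_integral[OF assms(1)], rule AE_mp[OF AE_triangles]) (use f in simp)
  finally show ?thesis .
qed

lemma integral_le_nn_integral:
  assumes g: "integrable M g" and f: "\<And>q. q \<in> triangles \<Longrightarrow> ennreal (g q) \<le> f q"
  shows "ennreal (\<integral>q. g q \<partial>M) \<le> (\<integral>\<^sup>+q. f q \<partial>M)"
proof -
  have m: "integrable M (\<lambda>q. max 0 (g q))" using g by (intro integrable_max) auto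
  have "(\<integral>q. g q \<partial>M) \<le> (\<integral>q. max 0 (g q) \<partial>M)" by (rule integral_mono[OF g m]) simp
  then have "ennreal (\<integral>q. g q \<partial>M) \<le> ennreal (\<integral>q. max 0 (g q) \<partial>M)" by (rule ennreal_leI)
  also have "\<dots> = (\<integral>\<^sup>+q. ennreal (max 0 (g q)) \<partial>M)" by (rule nn_integral_eq_integral[OF m, symmetric]) simp
  also have "\<dots> \<le> (\<integral>\<^sup>+q. f q \<partial>M)"
    by (rule nn_integral_mono_AE, rule AE_mp[OF AE_triangles]) (use f in \<open>simp add: ennreal_max_0\<close>)
  finally show ?thesis .
qed

lemma integrable_coordinates:
  "integrable M (\<lambda>q. c :: real)" "integrable M abscissa" "integrable M altitude" "integrable M sqradius"
  "integrable M (\<lambda>q. sqradius q * altitude q)" "integrable M (\<lambda>q. abscissa q * altitude q)" "integrable M (\<lambda>q. (altitude q)\<^sup>2)"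
  "integrable M (\<lambda>q. (abscissa q)\<^sup>2)"
proof -
  note m = measurable_abscissa[OF measurable_ident_sets[OF refl]] measurable_altitude[OF measurable_ident_sets[OF refl]]
    measurable_sqradius[OF measurable_ident_sets[OF refl]]
  note b = triangles_bounds
  show "integrable M (\<lambda>q. c :: real)" by simp
  show "integrable M abscissa" by (rule integrable_bounded[OF m(1), of "1/2"]) (rule b(1))
  show "integrable M altitude" by (rule integrable_bounded[OF m(2), of 1]) (use b in simp)
  show "integrable M sqradius" by (rule integrable_bounded[OF m(3), of 1]) (use b in simp)
  show "integrable M (\<lambda>q. sqradius q * altitude q)"
    by (rule integrable_bounded[OF borel_measurable_times[OF m(3) m(2)], of 1]) (use b in \<open>simp add: mult_le_one\<close>)
  show "integrable M (\<lambda>q. abscissa q * altitude q)"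
  proof (rule integrable_bounded[OF borel_measurable_times[OF m(1) m(2)], of 1])
    fix q assume q: "q \<in> triangles"
    have "\<bar>abscissa q\<bar> * \<bar>altitude q\<bar> \<le> 1 * 1" using b(1-3)[OF q] by (intro mult_mono) auto
    then show "\<bar>abscissa q * altitude q\<bar> \<le> 1" by (simp add: abs_mult)
  qed
  show "integrable M (\<lambda>q. (altitude q)\<^sup>2)"
    by (rule integrable_bounded[OF borel_measurable_power[OF m(2)], where B = 1]) (use b in \<open>simp add: power_le_one\<close>)
  show "integrable M (\<lambda>q. (abscissa q)\<^sup>2)"
  proof (rule integrable_bounded[OF borel_measurable_power[OF m(1)], where B = 1])
    fix q assume q: "q \<in> triangles"
    have "\<bar>abscissa q\<bar> \<le> 1" using b(1)[OF q] by linarith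
    then have "\<bar>abscissa q\<bar>\<^sup>2 \<le> 1" by (intro power_le_one) auto
    then show "\<bar>(abscissa q)\<^sup>2\<bar> \<le> 1" by simp
  qed
qed

abbreviation "mass \<equiv> measure M (space M)"

lemma integral_affine:
  "(\<integral>q. a + b * sqradius q + c * abscissa q + d * altitude q \<partial>M) =
     a * mass + b * (\<integral>q. sqradius q \<partial>M) + c * (\<integral>q. abscissa q \<partial>M) + d * (\<integral>q. altitude q \<partial>M)"
  "integrable M (\<lambda>q. a + b * sqradius q + c * abscissa q + d * altitude q)"
  using integrable_coordinates by (simp_all add: mult.commute)

lemma integral_altitude_multiples:
  "(\<integral>q. a * altitude q + b * (sqradius q * altitude q) + c * (abscissa q * altitude q) + d * (altitude q)\<^sup>2 \<partial>M) =
     a * (\<integral>q. altitude q \<partial>M) + b * (\<integral>q. sqradius q * altitude q \<partial>M) + c * (\<integral>q. abscissa q * altitude q \<partial>M) + d * (\<integral>q. (altitude q)\<^sup>2 \<partial>M)"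
  "integrable M (\<lambda>q. a * altitude q + b * (sqradius q * altitude q) + c * (abscissa q * altitude q) + d * (altitude q)\<^sup>2)"
  using integrable_coordinates by (simp_all add: mult.commute)

end

text \<open>
  A norm dominates every projection onto a direction \<open>(e1, e2)\<close> of length at most \<open>1\<close>. With a fixed
  direction the bound is linear in both triangles.
\<close>

lemma near_dist_ge_projection:
  assumes "e1\<^sup>2 + e2\<^sup>2 \<le> 1"
  shows "e1 * (abscissa q - abscissa q') + e2 * (altitude q - altitude q') \<le> near_dist q q'"
proof -
  define a b where "a = abscissa q - abscissa q'" and "b = altitude q - altitude q'"
  have "(e1 * a + e2 * b)\<^sup>2 \<le> (e1\<^sup>2 + e2\<^sup>2) * (a\<^sup>2 + b\<^sup>2)"
  proof -
    have "(e1\<^sup>2 + e2\<^sup>2) * (a\<^sup>2 + b\<^sup>2) = (e1 * a + e2 * b)\<^sup>2 + (e1 * b - e2 * a)\<^sup>2" by algebra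
    then show ?thesis by simp
  qed
  also have "\<dots> \<le> 1 * (a\<^sup>2 + b\<^sup>2)" using assms by (intro mult_right_mono) auto
  finally have "e1 * a + e2 * b \<le> sqrt (a\<^sup>2 + b\<^sup>2)" by (intro real_le_rsqrt) simp
  then show ?thesis by (simp add: near_dist_def a_def b_def)
qed

lemma far_dist_square:
  assumes "q \<in> triangles" "q' \<in> triangles"
  shows "(far_dist q q')\<^sup>2 = sqradius q + sqradius q' - 2 * abscissa q * abscissa q' + 2 * altitude q * altitude q'"
  unfolding sqradius_eq[OF assms(1)] sqradius_eq[OF assms(2)] far_dist_def real_sqrt_pow2[OF sum_power2_ge_zero]
  by algebra

lemma near_dist_square:
  assumes "q \<in> triangles" "q' \<in> triangles"
  shows "(near_dist q q')\<^sup>2 = sqradius q + sqradius q' - 2 * abscissa q * abscissa q' - 2 * altitude q * altitude q'"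
  unfolding sqradius_eq[OF assms(1)] sqradius_eq[OF assms(2)] near_dist_def real_sqrt_pow2[OF sum_power2_ge_zero]
  by algebra

text \<open>
  Jensen's inequality in dual form. The concave function \<open>min 1 \<circ> sqrt\<close> of \<open>far\<^sup>2\<close> is replaced by a
  line \<open>c0 + c1 far\<^sup>2\<close> above it and the norm by a projection below it; the resulting
  majorant of the gap is bilinear in \<open>1\<close>, \<open>r\<close>, \<open>u\<close>, \<open>h\<close> and integrates to the right-hand side. The
  second statement is what lets the bound pass through \<open>ennreal\<close>.
\<close>

lemma gap_pair_upper:
  assumes "triangle_measure M" "triangle_measure N"
    and e: "e1\<^sup>2 + e2\<^sup>2 \<le> 1" and c: "\<And>t. 0 \<le> t \<Longrightarrow> min 1 t \<le> c0 + c1 * t\<^sup>2"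
  defines "w \<equiv> measure M (space M)" and "w' \<equiv> measure N (space N)"
  defines "R \<equiv> \<integral>q. sqradius q \<partial>M" and "R' \<equiv> \<integral>q. sqradius q \<partial>N" and "U \<equiv> \<integral>q. abscissa q \<partial>M" and "U' \<equiv> \<integral>q. abscissa q \<partial>N"
    and "H \<equiv> \<integral>q. altitude q \<partial>M" and "H' \<equiv> \<integral>q. altitude q \<partial>N"
  shows "(\<integral>\<^sup>+q. \<integral>\<^sup>+q'. ennreal (gap q q') \<partial>N \<partial>M) \<le>
    ennreal (c0 * w * w' + c1 * (R * w' + w * R' - 2 * U * U' + 2 * H * H') - e1 * (U * w' - w * U') - e2 * (H * w' - w * H'))"
    and "0 \<le> c0 * w * w' + c1 * (R * w' + w * R' - 2 * U * U' + 2 * H * H') - e1 * (U * w' - w * U') - e2 * (H * w' - w * H')"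
proof -
  interpret M: triangle_measure M by fact
  interpret N: triangle_measure N by fact
  \<comment> \<open>the integral of the majorant over the second triangle, affine in the coordinates of the first\<close>
  define g where "g q = (c0 * w' + c1 * R' + e1 * U' + e2 * H') + (c1 * w') * sqradius q
    + (- e1 * w' - 2 * c1 * U') * abscissa q + (- e2 * w' + 2 * c1 * H') * altitude q" for q
  have inner: "(\<integral>\<^sup>+q'. ennreal (gap q q') \<partial>N) \<le> ennreal (g q) \<and> 0 \<le> g q" if q: "q \<in> triangles" for q
  proof -
    define G where "G q' = (c0 + c1 * sqradius q - e1 * abscissa q - e2 * altitude q) + c1 * sqradius q'
      + (e1 - 2 * c1 * abscissa q) * abscissa q' + (e2 + 2 * c1 * altitude q) * altitude q'" for q'
    have G: "gap q q' \<le> G q'" if q': "q' \<in> triangles" for q'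
    proof -
      have "G q' = c0 + c1 * (far_dist q q')\<^sup>2 - (e1 * (abscissa q - abscissa q') + e2 * (altitude q - altitude q'))"
        unfolding G_def far_dist_square[OF q q'] by (simp add: algebra_simps)
      then show ?thesis using c[OF far_dist_nonneg[of q q']] near_dist_ge_projection[OF e, of q q'] unfolding gap_def by linarith
    qed
    have G0: "0 \<le> G q'" if "q' \<in> triangles" for q' using G[OF that] gap_bounds(1)[OF q that] by linarith
    have int: "(\<integral>q'. G q' \<partial>N) = g q" unfolding G_def[abs_def] N.integral_affine(1) g_def
      unfolding w'_def R'_def U'_def H'_def by (simp add: algebra_simps)
    have i: "integrable N G" unfolding G_def[abs_def] by (rule N.integral_affine(2))
    have "(\<integral>\<^sup>+q'. ennreal (gap q q') \<partial>N) \<le> ennreal (\<integral>q'. G q' \<partial>N)"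
      by (rule N.nn_integral_le_integral[OF i G0]) (use G in \<open>auto intro: ennreal_leI\<close>)
    moreover have "0 \<le> (\<integral>q'. G q' \<partial>N)"
      by (rule integral_nonneg_AE, rule AE_mp[OF N.AE_triangles]) (use G0 in simp)
    ultimately show ?thesis unfolding int by blast
  qed
  have "(\<integral>\<^sup>+q. \<integral>\<^sup>+q'. ennreal (gap q q') \<partial>N \<partial>M) \<le> ennreal (\<integral>q. g q \<partial>M)"
    by (rule M.nn_integral_le_integral) (use inner in \<open>auto simp: g_def[abs_def] intro!: M.integral_affine(2)\<close>)
  moreover have "0 \<le> (\<integral>q. g q \<partial>M)"
    by (rule integral_nonneg_AE, rule AE_mp[OF M.AE_triangles]) (use inner in simp)
  moreover have "(\<integral>q. g q \<partial>M) = c0 * w * w' + c1 * (R * w' + w * R' - 2 * U * U' + 2 * H * H') - e1 * (U * w' - w * U') - e2 * (H * w' - w * H')"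
    unfolding g_def[abs_def] M.integral_affine(1) unfolding w_def R_def U_def H_def by (simp add: algebra_simps)
  ultimately show "(\<integral>\<^sup>+q. \<integral>\<^sup>+q'. ennreal (gap q q') \<partial>N \<partial>M) \<le>
    ennreal (c0 * w * w' + c1 * (R * w' + w * R' - 2 * U * U' + 2 * H * H') - e1 * (U * w' - w * U') - e2 * (H * w' - w * H'))"
    and "0 \<le> c0 * w * w' + c1 * (R * w' + w * R' - 2 * U * U' + 2 * H * H') - e1 * (U * w' - w * U') - e2 * (H * w' - w * H')"
    by (simp_all only:)
qed

text \<open>
  Write \<open>min 1 b - a\<close> as \<open>(b\<^sup>2 - a\<^sup>2) / 2\<close> times \<open>2 / (a + b)\<close> when \<open>b \<le> 1\<close>. The second factor is
  minorised by a linear function of \<open>a\<^sup>2\<close> and \<open>b\<^sup>2\<close>; its coefficients satisfy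
  \<open>501/200 = 63/40 + 93/100\<close>, so that it vanishes for \<open>a = b = 1\<close>, and were chosen numerically to make
  the integral of the minorant large while the inequality persists for \<open>b > 1\<close>.
\<close>

lemma gap_ge_polynomial:
  fixes a b :: real
  assumes "0 \<le> a" "a \<le> 1" "a \<le> b"
  shows "(b\<^sup>2 - a\<^sup>2) / 2 * (501/200 - 63/40 * a\<^sup>2 - 93/100 * b\<^sup>2) \<le> min 1 b - a"
proof (cases "b \<le> 1")
  case True
  define y where "y = a + b"
  have y0: "0 \<le> y" using assms by (simp add: y_def)
  \<comment> \<open>the minimum of the right-hand side for given \<open>a + b\<close> has coefficient \<open>(63/40) (93/100) / (501/200) = 0.58473\<dots>\<close>\<close>
  have n: "58472/100000 * y\<^sup>2 \<le> 63/40 * a\<^sup>2 + 93/100 * b\<^sup>2"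
  proof -
    have "0 \<le> (99028 * a - 58472 * b)\<^sup>2 + 264000 * b\<^sup>2" by simp
    also have "\<dots> = 99028 * (99028 * a\<^sup>2 - 116944 * (a * b) + 34528 * b\<^sup>2)" by algebra
    finally have "0 \<le> 99028 * a\<^sup>2 - 116944 * (a * b) + 34528 * b\<^sup>2" by simp
    then show ?thesis unfolding y_def power2_sum by simp
  qed
  have "y * (501/200 - 58472/100000 * y\<^sup>2) \<le> 2"
  proof -
    \<comment> \<open>\<open>11951/10000\<close> approximates the maximiser of the cubic polynomial on the left\<close>
    have "0 \<le> (y - 11951/10000)\<^sup>2 * (y + 2 * (11951/10000))" using y0 by simp
    also have "\<dots> = y ^ 3 - 3 * (11951/10000)\<^sup>2 * y + 2 * (11951/10000) ^ 3" by algebra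
    finally have "3 * (11951/10000)\<^sup>2 * y - 2 * (11951/10000) ^ 3 \<le> y ^ 3" by simp
    moreover have "y * (501/200 - 58472/100000 * y\<^sup>2) = 501/200 * y - 58472/100000 * y ^ 3" by (simp add: power2_eq_square power3_eq_cube algebra_simps)
    ultimately show ?thesis using y0 by (simp add: power2_eq_square power3_eq_cube)
  qed
  moreover have "y * (501/200 - 63/40 * a\<^sup>2 - 93/100 * b\<^sup>2) \<le> y * (501/200 - 58472/100000 * y\<^sup>2)"
    using n y0 by (intro mult_left_mono) auto
  ultimately have "y * (501/200 - 63/40 * a\<^sup>2 - 93/100 * b\<^sup>2) \<le> 2" by linarith
  then have "(b - a) / 2 * (y * (501/200 - 63/40 * a\<^sup>2 - 93/100 * b\<^sup>2)) \<le> (b - a) / 2 * 2"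
    using assms by (intro mult_left_mono) auto
  also have "(b - a) / 2 * (y * (501/200 - 63/40 * a\<^sup>2 - 93/100 * b\<^sup>2)) = (b\<^sup>2 - a\<^sup>2) / 2 * (501/200 - 63/40 * a\<^sup>2 - 93/100 * b\<^sup>2)"
  proof -
    have "(b - a) / 2 * (y * E) = (b\<^sup>2 - a\<^sup>2) / 2 * E" for E by (simp add: y_def power2_eq_square field_simps)
    then show ?thesis .
  qed
  finally show ?thesis using True by simp
next
  case False
  define s where "s = b\<^sup>2 - a\<^sup>2"
  define k where "k = 501/200 * (1 - a\<^sup>2)"
  \<comment> \<open>for given \<open>a\<close> the minorant is quadratic in \<open>s\<close>, with its maximum at \<open>s = k / (2 (93/100))\<close>\<close>
  have "s * (k - 93/100 * s) \<le> k\<^sup>2 / (4 * (93/100))"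
  proof -
    have "0 \<le> (k - 2 * (93/100) * s)\<^sup>2" by simp
    then show ?thesis by (simp add: power2_eq_square algebra_simps)
  qed
  also have "\<dots> = (501/200)\<^sup>2 / (4 * (93/100)) * ((1 - a) * ((1 - a) * (1 + a)\<^sup>2))"
  proof -
    have "(1 - a\<^sup>2)\<^sup>2 = (1 - a) * ((1 - a) * (1 + a)\<^sup>2)" by algebra
    then show ?thesis unfolding k_def power_mult_distrib by simp
  qed
  also have "\<dots> \<le> (501/200)\<^sup>2 / (4 * (93/100)) * ((1 - a) * (32 / 27))"
  proof (intro mult_left_mono)
    \<comment> \<open>the cubic polynomial \<open>(1 - a) (1 + a)\<^sup>2\<close> is largest, among \<open>a \<ge> 0\<close>, at \<open>a = 1/3\<close>\<close>
    have "0 \<le> (3 * a - 1)\<^sup>2 * (3 * a + 5)" using assms by simp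
    also have "\<dots> = 32 - 27 * ((1 - a) * (1 + a)\<^sup>2)" by algebra
    finally show "(1 - a) * (1 + a)\<^sup>2 \<le> 32 / 27" by simp
  qed (use assms in auto)
  also have "\<dots> \<le> 2 * (1 - a)" using assms by (simp add: power2_eq_square)
  finally have "s * (k - 93/100 * s) \<le> 2 * (1 - a)" .
  moreover have "k - 93/100 * s = 501/200 - 63/40 * a\<^sup>2 - 93/100 * b\<^sup>2"
    unfolding s_def k_def by (simp add: algebra_simps add_divide_distrib diff_divide_distrib)
  ultimately show ?thesis using False unfolding s_def by simp
qed

lemma gap_ge:
  assumes q: "q \<in> triangles" and q': "q' \<in> triangles"
  defines "h \<equiv> altitude q" and "h' \<equiv> altitude q'"
  shows "501/100 * (h * h') - 501/100 * (sqradius q * h * h' + h * (sqradius q' * h')) + 501/50 * (abscissa q * h) * (abscissa q' * h')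
    + 129/50 * (h\<^sup>2 * h'\<^sup>2) \<le> gap q q'"
proof -
  define A where "A = sqradius q + sqradius q' - 2 * abscissa q * abscissa q'"
  have a: "(near_dist q q')\<^sup>2 = A - 2 * h * h'" and b: "(far_dist q q')\<^sup>2 = A + 2 * h * h'"
    using near_dist_square[OF q q'] far_dist_square[OF q q'] by (simp_all add: A_def h_def h'_def)
  have "501/100 * (h * h') - 501/100 * (sqradius q * h * h' + h * (sqradius q' * h')) + 501/50 * (abscissa q * h) * (abscissa q' * h')
    + 129/50 * (h\<^sup>2 * h'\<^sup>2) = (2 * h * h') * (501/200 - 501/200 * A + 129/200 * (2 * h * h'))"
  proof -
    have "h * h' * A = sqradius q * h * h' + h * (sqradius q' * h') - 2 * ((abscissa q * h) * (abscissa q' * h'))"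
      unfolding A_def by algebra
    moreover have "h\<^sup>2 * h'\<^sup>2 = h * h' * (h * h')" by algebra
    moreover have "(2 * h * h') * (501/200 - 501/200 * A + 129/200 * (2 * h * h')) = 501/100 * (h * h') - 501/100 * (h * h' * A) + 129/50 * (h * h' * (h * h'))"
      by (simp add: algebra_simps)
    ultimately show ?thesis by (simp add: add_divide_distrib diff_divide_distrib)
  qed
  also have "\<dots> = ((A + 2 * h * h') - (A - 2 * h * h')) / 2 * (501/200 - 63/40 * (A - 2 * h * h') - 93/100 * (A + 2 * h * h'))"
    by (simp add: algebra_simps add_divide_distrib diff_divide_distrib)
  also have "\<dots> \<le> gap q q'"
    using gap_ge_polynomial[OF near_dist_nonneg near_dist_le_1[OF q q'] near_le_far[OF q q']] unfolding a b gap_def .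
  finally show ?thesis .
qed

text \<open>
  The minorant of \<open>gap_ge\<close> is a sum of products of functions of one triangle each.
\<close>

lemma (in triangle_measure) gap_pair_lower:
  defines "H \<equiv> \<integral>q. altitude q \<partial>M" and "R \<equiv> \<integral>q. sqradius q * altitude q \<partial>M" and "U \<equiv> \<integral>q. abscissa q * altitude q \<partial>M" and "S \<equiv> \<integral>q. (altitude q)\<^sup>2 \<partial>M"
  shows "ennreal (501/100 * H\<^sup>2 - 501/50 * R * H + 501/50 * U\<^sup>2 + 129/50 * S\<^sup>2) \<le> (\<integral>\<^sup>+q. \<integral>\<^sup>+q'. ennreal (gap q q') \<partial>M \<partial>M)"
proof -
  define g where "g q = (501/100 * H - 501/100 * R) * altitude q + (- 501/100 * H) * (sqradius q * altitude q)
    + (501/50 * U) * (abscissa q * altitude q) + (129/50 * S) * (altitude q)\<^sup>2" for q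
  have inner: "ennreal (g q) \<le> (\<integral>\<^sup>+q'. ennreal (gap q q') \<partial>M)" if q: "q \<in> triangles" for q
  proof -
    define G where "G q' = (501/100 * altitude q - 501/100 * (sqradius q * altitude q)) * altitude q' + (- 501/100 * altitude q) * (sqradius q' * altitude q')
      + (501/50 * (abscissa q * altitude q)) * (abscissa q' * altitude q') + (129/50 * (altitude q)\<^sup>2) * (altitude q')\<^sup>2" for q'
    have "G q' \<le> gap q q'" if "q' \<in> triangles" for q'
      using gap_ge[OF q that] unfolding G_def by (simp add: algebra_simps add_divide_distrib)
    moreover have "integrable M G" unfolding G_def[abs_def] by (rule integral_altitude_multiples(2))
    ultimately have "ennreal (\<integral>q'. G q' \<partial>M) \<le> (\<integral>\<^sup>+q'. ennreal (gap q q') \<partial>M)"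
      by (intro integral_le_nn_integral ennreal_leI)
    moreover have "(\<integral>q'. G q' \<partial>M) = g q"
      unfolding G_def[abs_def] integral_altitude_multiples(1) g_def unfolding H_def R_def U_def S_def by (simp add: algebra_simps)
    ultimately show ?thesis by simp
  qed
  have "ennreal (\<integral>q. g q \<partial>M) \<le> (\<integral>\<^sup>+q. \<integral>\<^sup>+q'. ennreal (gap q q') \<partial>M \<partial>M)"
    by (rule integral_le_nn_integral[OF _ inner]) (simp_all only: g_def[abs_def] integral_altitude_multiples(2))
  also have "(\<integral>q. g q \<partial>M) = 501/100 * H\<^sup>2 - 501/50 * R * H + 501/50 * U\<^sup>2 + 129/50 * S\<^sup>2"
    unfolding g_def[abs_def] integral_altitude_multiples(1) unfolding H_def[symmetric] R_def[symmetric] U_def[symmetric] S_def[symmetric]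
    by (simp add: power2_eq_square algebra_simps)
  finally show ?thesis .
qed

section \<open>Lebesgue measure on the triangles\<close>

definition shape_measure :: "(real \<times> real) set \<Rightarrow> (real \<times> real) measure" where
  "shape_measure C = density lborel (indicator C)"

lemma nn_integral_shape_measure:
  assumes C: "C \<in> sets borel" and f: "f \<in> borel_measurable borel"
  shows "(\<integral>\<^sup>+q. f q \<partial>shape_measure C) = (\<integral>\<^sup>+q\<in>C. f q \<partial>lborel)"
proof -
  have "(\<integral>\<^sup>+q. f q \<partial>shape_measure C) = (\<integral>\<^sup>+q. indicator C q * f q \<partial>lborel)"
    unfolding shape_measure_def
  proof (rule nn_integral_density)
    show "indicator C \<in> borel_measurable lborel" unfolding measurable_lborel2 by (rule borel_measurable_indicator[OF C])
    show "f \<in> borel_measurable lborel" unfolding measurable_lborel2 by (rule f)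
  qed
  then show ?thesis by (simp only: mult.commute)
qed

lemma triangle_measure_shape:
  assumes C: "C \<in> sets borel" and sub: "C \<subseteq> triangles"
  shows "triangle_measure (shape_measure C)"
proof -
  have s: "sets (shape_measure C) = sets borel" by (simp add: shape_measure_def)
  have sp: "space (shape_measure C) = UNIV" by (simp add: shape_measure_def)
  have "emeasure (shape_measure C) UNIV = (\<integral>\<^sup>+q. 1 \<partial>shape_measure C)" using sp by simp
  also have "\<dots> = (\<integral>\<^sup>+q\<in>C. 1 \<partial>lborel)" by (rule nn_integral_shape_measure[OF C]) simp
  also have "\<dots> \<le> (\<integral>\<^sup>+q. indicator (cbox (0::real, 0::real) (1, 1)) q \<partial>lborel)"
  proof (rule nn_integral_mono)
    fix q :: "real \<times> real"
    have "q \<in> cbox (0, 0) (1, 1)" if "q \<in> C" using that sub by (cases q) (auto simp: triangles_def)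
    then show "1 * indicator C q \<le> (indicator (cbox (0, 0) (1, 1)) q :: ennreal)" by (auto simp: indicator_def)
  qed
  also have "\<dots> = emeasure lborel (cbox (0::real, 0::real) (1, 1))" by (rule nn_integral_indicator) simp
  also have "\<dots> < \<infinity>" by (rule emeasure_lborel_cbox_finite)
  finally have fin: "emeasure (shape_measure C) (space (shape_measure C)) \<noteq> \<infinity>" unfolding sp by simp
  have ae: "AE q in shape_measure C. q \<in> triangles" unfolding shape_measure_def
  proof (subst AE_density)
    show "indicator C \<in> borel_measurable lborel" unfolding measurable_lborel2 by (rule borel_measurable_indicator[OF C])
    show "AE q in lborel. 0 < (indicator C q :: ennreal) \<longrightarrow> q \<in> triangles"
      by (rule AE_I2) (use sub in \<open>auto simp: indicator_def split: if_splits\<close>)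
  qed
  show ?thesis by (intro triangle_measure.intro finite_measureI triangle_measure_axioms.intro fin s ae)
qed

abbreviation all_triangles :: "(real \<times> real) measure" where
  "all_triangles \<equiv> shape_measure triangles"

interpretation all: triangle_measure all_triangles
  by (rule triangle_measure_shape[OF measurable_triangles order_refl])

lemma measurable_inner_gap:
  assumes "triangle_measure N"
  shows "(\<lambda>q. \<integral>\<^sup>+q'. ennreal (gap q q') \<partial>N) \<in> borel_measurable borel"
proof -
  interpret N: triangle_measure N by fact
  have "(\<lambda>(q, q'). ennreal (gap q q')) \<in> borel_measurable (borel \<Otimes>\<^sub>M N)"
    unfolding split_beta'
    by (intro measurable_compose_rev[OF measurable_ennreal] measurable_gap measurable_fst
       measurable_compose[OF measurable_snd N.borel_measurable_M] measurable_ident_sets refl)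
  then show ?thesis by (rule N.borel_measurable_nn_integral)
qed

lemma flap_volume_eq_double_integral:
  "flap_volume {0..1} = (\<integral>\<^sup>+q. \<integral>\<^sup>+q'. ennreal (gap q q') \<partial>all_triangles \<partial>all_triangles)"
proof -
  have inner: "(\<integral>\<^sup>+q'. ennreal (gap q q') \<partial>all_triangles) = (\<integral>\<^sup>+q'\<in>triangles. ennreal (gap q q') \<partial>lborel)" for q
    by (intro nn_integral_shape_measure[OF measurable_triangles] measurable_compose_rev[OF measurable_ennreal] measurable_gap_right)
  have "(\<integral>\<^sup>+q. \<integral>\<^sup>+q'. ennreal (gap q q') \<partial>all_triangles \<partial>all_triangles) = (\<integral>\<^sup>+q\<in>triangles. \<integral>\<^sup>+q'. ennreal (gap q q') \<partial>all_triangles \<partial>lborel)"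
    by (rule nn_integral_shape_measure[OF measurable_triangles measurable_inner_gap[OF all.triangle_measure_axioms]])
  then show ?thesis unfolding flap_volume_eq_gap_integral inner by (rule sym)
qed

text \<open>
  Passage from the sides \<open>(x, y)\<close> to \<open>(x, t)\<close> with the excess \<open>t = x + y - 1\<close> over the triangle
  inequality, followed by a change of the order of integration.
\<close>

lemma nn_integral_triangles:
  fixes f :: "real \<times> real \<Rightarrow> ennreal"
  assumes [measurable]: "f \<in> borel_measurable borel"
  shows "(\<integral>\<^sup>+q\<in>triangles. f q \<partial>lborel) = (\<integral>\<^sup>+t\<in>{0..1}. (\<integral>\<^sup>+x\<in>{t..1}. f (x, 1 - x + t) \<partial>lborel) \<partial>lborel)"
proof -
  have fi: "(\<lambda>q. f q * indicator triangles q) \<in> borel_measurable borel"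
    by (intro borel_measurable_times_ennreal assms borel_measurable_indicator measurable_triangles)
  define g where "g = (\<lambda>(x, t). f (x, 1 - x + t) * indicator triangles (x, 1 - x + t))"
  have c: "(\<lambda>p :: real \<times> real. (fst p, 1 - fst p + snd p)) \<in> borel_measurable borel"
    by (intro borel_measurable_continuous_onI continuous_intros)
  have g: "g \<in> borel_measurable borel" unfolding g_def split_beta' by (rule measurable_compose[OF c fi])
  have "(\<integral>\<^sup>+q\<in>triangles. f q \<partial>lborel) = (\<integral>\<^sup>+x. \<integral>\<^sup>+y. f (x, y) * indicator triangles (x, y) \<partial>lborel \<partial>lborel)"
    by (rule nn_integral_lborel_pair[OF fi])
  also have "\<dots> = (\<integral>\<^sup>+x. \<integral>\<^sup>+t. g (x, t) \<partial>lborel \<partial>lborel)"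
  proof (rule nn_integral_cong)
    fix x :: real
    have p: "(\<lambda>y. (x, y)) \<in> borel_measurable borel" by (intro borel_measurable_continuous_onI continuous_intros)
    have "(\<lambda>y. f (x, y) * indicator triangles (x, y)) \<in> borel_measurable borel"
      using measurable_compose[OF p fi] .
    from nn_integral_real_affine[OF this, of 1 "1 - x"]
    show "(\<integral>\<^sup>+y. f (x, y) * indicator triangles (x, y) \<partial>lborel) = (\<integral>\<^sup>+t. g (x, t) \<partial>lborel)"
      unfolding g_def prod.case by simp
  qed
  also have "\<dots> = (\<integral>\<^sup>+t. \<integral>\<^sup>+x. g (x, t) \<partial>lborel \<partial>lborel)"
  proof (rule lborel_pair.Fubini'[symmetric])
    show "(\<lambda>(x, y). g (x, y)) \<in> borel_measurable (lborel \<Otimes>\<^sub>M lborel)" using g unfolding lborel_prod measurable_lborel2 case_prod_eta .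
  qed
  also have "\<dots> = (\<integral>\<^sup>+t\<in>{0..1}. (\<integral>\<^sup>+x\<in>{t..1}. f (x, 1 - x + t) \<partial>lborel) \<partial>lborel)"
  proof (rule nn_integral_cong_AE, rule AE_mp[OF AE_lborel_singleton[of 0]], rule AE_I2, rule impI)
    fix t :: real assume t: "t \<noteq> 0"
    have "(\<integral>\<^sup>+x. g (x, t) \<partial>lborel) = (\<integral>\<^sup>+x. (f (x, 1 - x + t) * indicator {t..1} x) * indicator {0..1} t \<partial>lborel)"
      by (rule nn_integral_cong) (use t in \<open>auto simp: g_def indicator_def triangles_def\<close>)
    also have "\<dots> = (\<integral>\<^sup>+x\<in>{t..1}. f (x, 1 - x + t) \<partial>lborel) * indicator {0..1} t"
      by (cases "t \<in> {0..1}") simp_all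
    finally show "(\<integral>\<^sup>+x. g (x, t) \<partial>lborel) = (\<integral>\<^sup>+x\<in>{t..1}. f (x, 1 - x + t) \<partial>lborel) * indicator {0..1} t" .
  qed
  finally show ?thesis .
qed

text \<open>
  In the coordinates \<open>t = x + y - 1\<close> and \<open>m = x - y\<close> the triangles form the region
  \<open>\<bar>m\<bar> \<le> 1 - t\<close>, and \<open>dx dy = dt dm / 2\<close>. A product integrand leaves
  half the integral of \<open>v\<close> from \<open>t - 1\<close> to \<open>1 - t\<close>, which is \<open>V (1 - t)\<close> for an odd
  antiderivative \<open>V\<close>.
\<close>

lemma nn_integral_triangles_product:
  fixes a v V :: "real \<Rightarrow> real"
  assumes a: "a \<in> borel_measurable borel" "\<And>t. 0 \<le> t \<Longrightarrow> t \<le> 1 \<Longrightarrow> 0 \<le> a t"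
    and v: "continuous_on UNIV v" "\<And>m. \<bar>m\<bar> \<le> 1 \<Longrightarrow> 0 \<le> v m"
    and V: "\<And>m. (V has_real_derivative v m) (at m)" "\<And>m. V (- m) = - V m"
  shows "(\<integral>\<^sup>+q\<in>triangles. ennreal (a (fst q + snd q - 1) * v (fst q - snd q)) \<partial>lborel) = (\<integral>\<^sup>+t\<in>{0..1}. ennreal (a t * V (1 - t)) \<partial>lborel)"
proof -
  have vm: "v \<in> borel_measurable borel" using v(1) by (rule borel_measurable_continuous_onI)
  have fm: "(\<lambda>q :: real \<times> real. ennreal (a (fst q + snd q - 1) * v (fst q - snd q))) \<in> borel_measurable borel"
  proof -
    have p: "(\<lambda>q :: real \<times> real. fst q + snd q - 1) \<in> borel_measurable borel" and m: "(\<lambda>q :: real \<times> real. fst q - snd q) \<in> borel_measurable borel"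
      by (intro borel_measurable_continuous_onI continuous_intros)+
    show ?thesis
      by (intro measurable_compose_rev[OF measurable_ennreal] borel_measurable_times measurable_compose[OF p a(1)] measurable_compose[OF m vm])
  qed
  show ?thesis unfolding nn_integral_triangles[OF fm] fst_conv snd_conv
  proof (rule nn_integral_cong)
    fix t :: real
    show "(\<integral>\<^sup>+x\<in>{t..1}. ennreal (a (x + (1 - x + t) - 1) * v (x - (1 - x + t))) \<partial>lborel) * indicator {0..1} t = ennreal (a t * V (1 - t)) * indicator {0..1} t"
    proof (cases "t \<in> {0..1}")
      case True
      then have t: "0 \<le> t" "t \<le> 1" by auto
      have "(\<integral>\<^sup>+x\<in>{t..1}. ennreal (a t * v (2 * x - 1 - t)) \<partial>lborel) = ennreal (a t * V (2 * 1 - 1 - t) / 2 - a t * V (2 * t - 1 - t) / 2)"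
      proof -
        have 1: "(\<lambda>x. a t * v (2 * x - 1 - t)) \<in> borel_measurable borel"
          by (intro borel_measurable_continuous_onI continuous_intros continuous_on_compose2[OF v(1)]) auto
        have 2: "((\<lambda>x. a t * V (2 * x - 1 - t) / 2) has_real_derivative a t * v (2 * x - 1 - t)) (at x)" for x
          by (rule derivative_eq_intros DERIV_chain2[OF V(1)] refl | simp)+
        have 3: "0 \<le> a t * v (2 * x - 1 - t)" if "t \<le> x" "x \<le> 1" for x
          using that t by (intro mult_nonneg_nonneg a(2) v(2)) (auto simp: abs_le_iff)
        show ?thesis using nn_integral_FTC_Icc[OF 1, of t 1 "\<lambda>x. a t * V (2 * x - 1 - t) / 2"] 2 3 t by simp
      qed
      also have "a t * V (2 * 1 - 1 - t) / 2 - a t * V (2 * t - 1 - t) / 2 = a t * V (1 - t)"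
        using V(2)[of "1 - t"] by (simp add: algebra_simps)
      finally have *: "(\<integral>\<^sup>+x\<in>{t..1}. ennreal (a t * v (2 * x - 1 - t)) \<partial>lborel) = ennreal (a t * V (1 - t))" .
      have "x + (1 - x + t) - 1 = t" "x - (1 - x + t) = 2 * x - 1 - t" for x by simp_all
      then show ?thesis using True * by (simp only:)
    qed simp
  qed
qed

section \<open>Lower bound from three moments\<close>

text \<open>
  At \<open>t = 0\<close> the square root is not differentiable, but its product with \<open>t\<close> is; this lets the
  fundamental theorem of calculus be applied on the whole interval.
\<close>

lemma has_derivative_power_sqrt:
  assumes "0 \<le> (t::real)"
  shows "((\<lambda>t. t ^ Suc i * sqrt t / (i + 3/2)) has_real_derivative sqrt t * t ^ i) (at t)"
proof (cases "t = 0")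
  case True
  have "((\<lambda>t::real. t ^ Suc i * sqrt t) has_real_derivative 0) (at 0)"
    unfolding CARAT_DERIV
  proof (intro exI conjI allI)
    show "z ^ Suc i * sqrt z - 0 ^ Suc i * sqrt 0 = (z ^ i * sqrt z) * (z - 0)" for z :: real by simp
    show "isCont (\<lambda>z::real. z ^ i * sqrt z) 0" by (intro continuous_intros)
  qed simp
  from DERIV_cdivide[OF this, of "i + 3/2"] show ?thesis using True by simp
next
  case False
  then have t: "0 < t" using assms by simp
  have s: "sqrt t * sqrt t = t" using t by simp
  have "((\<lambda>t. t ^ Suc i * sqrt t / (i + 3/2)) has_real_derivative
    (real (Suc i) * t ^ (Suc i - Suc 0) * sqrt t + inverse (sqrt t) / 2 * t ^ Suc i) / (i + 3/2)) (at t)"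
    by (rule DERIV_cdivide[OF DERIV_mult[OF DERIV_pow DERIV_real_sqrt[OF t]]])
  moreover have "inverse (sqrt t) / 2 * t ^ Suc i = t ^ i * sqrt t / 2"
    using s t by (simp add: field_simps)
  moreover have "(real (Suc i) * t ^ (Suc i - Suc 0) * sqrt t + t ^ i * sqrt t / 2) / (i + 3/2) = sqrt t * t ^ i"
    by (simp add: field_simps)
  ultimately show ?thesis by (simp only:)
qed

lemma nn_integral_sqrt_polynomial:
  fixes c :: "nat \<Rightarrow> real"
  assumes "\<And>t. 0 \<le> t \<Longrightarrow> t \<le> 1 \<Longrightarrow> 0 \<le> sqrt t * (\<Sum>i<n. c i * t ^ i)"
  shows "(\<integral>\<^sup>+t\<in>{0..1}. ennreal (sqrt t * (\<Sum>i<n. c i * t ^ i)) \<partial>lborel) = ennreal (\<Sum>i<n. c i / (i + 3/2))"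
proof -
  let ?G = "\<lambda>t::real. \<Sum>i<n. c i * (t ^ Suc i * sqrt t / (i + 3/2))"
  have m: "(\<lambda>t. sqrt t * (\<Sum>i<n. c i * t ^ i)) \<in> borel_measurable borel"
    by (intro borel_measurable_continuous_onI continuous_intros)
  have d: "(?G has_real_derivative sqrt t * (\<Sum>i<n. c i * t ^ i)) (at t)" if "0 \<le> t" for t
  proof -
    have "(?G has_real_derivative (\<Sum>i<n. c i * (sqrt t * t ^ i))) (at t)"
      by (intro DERIV_sum DERIV_cmult has_derivative_power_sqrt that)
    then show ?thesis by (simp add: sum_distrib_left mult.left_commute)
  qed
  have "(\<integral>\<^sup>+t\<in>{0..1}. ennreal (sqrt t * (\<Sum>i<n. c i * t ^ i)) \<partial>lborel) = ennreal (?G 1 - ?G 0)"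
    by (rule nn_integral_FTC_Icc[OF m]) (use d assms in auto)
  then show ?thesis by simp
qed

text \<open>
  The Taylor polynomial of \<open>sqrt (1 - v)\<close> of degree three in \<open>v = m\<^sup>2\<close>, with an additional term that makes
  it vanish at \<open>v = 1\<close>. Then a factor \<open>1 - v\<close> splits off, and squaring compares polynomials.
\<close>

lemma sqrt_one_minus_ge:
  assumes "\<bar>m\<bar> \<le> (1::real)"
  shows "1 - m^2 / 2 - m^4 / 8 - m^6 / 16 - 5 * m^8 / 16 \<le> sqrt (1 - m\<^sup>2)"
    and "0 \<le> 1 - m^2 / 2 - m^4 / 8 - m^6 / 16 - 5 * m^8 / 16"
proof -
  define v where "v = m\<^sup>2"
  have v: "0 \<le> v" "v \<le> 1" using assms by (simp_all add: v_def abs_square_le_1)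
  define T where "T = 1 + v / 2 + 3 * v^2 / 8 + 5 * v^3 / 16"
  have e: "1 - m^2 / 2 - m^4 / 8 - m^6 / 16 - 5 * m^8 / 16 = (1 - v) * T"
    unfolding T_def v_def by (simp add: field_simps flip: power_mult power_add power_Suc)
  have T0: "0 \<le> T" using v by (simp add: T_def)
  then show "0 \<le> 1 - m^2 / 2 - m^4 / 8 - m^6 / 16 - 5 * m^8 / 16" unfolding e using v by simp
  have "(1 - v) * T\<^sup>2 = 1 - (35/64 * v^4 + 7/32 * v^5 + 35/256 * v^6 + 25/256 * v^7)"
    unfolding T_def by (simp add: power2_eq_square power3_eq_cube eval_nat_numeral field_simps)
  also have "\<dots> \<le> 1"
  proof -
    have "0 \<le> 35/64 * v^4 + 7/32 * v^5 + 35/256 * v^6 + 25/256 * v^7" using v(1) by (intro add_nonneg_nonneg mult_nonneg_nonneg) simp_all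
    then show ?thesis by linarith
  qed
  finally have "(1 - v) * ((1 - v) * T\<^sup>2) \<le> (1 - v) * 1" using v by (intro mult_left_mono) auto
  then have "((1 - v) * T)\<^sup>2 \<le> 1 - v" by (simp add: power2_eq_square mult_ac)
  then show "1 - m^2 / 2 - m^4 / 8 - m^6 / 16 - 5 * m^8 / 16 \<le> sqrt (1 - m\<^sup>2)"
    unfolding e unfolding v_def[symmetric] by (rule real_le_rsqrt)
qed

lemma sqrt_one_minus_le:
  assumes "\<bar>m\<bar> \<le> (1::real)"
  shows "sqrt (1 - m\<^sup>2) \<le> 1 - m^2 / 2 - m^4 / 8 - m^6 / 16"
    and "0 \<le> 1 - m^2 / 2 - m^4 / 8 - m^6 / 16"
proof -
  define v where "v = m\<^sup>2"
  have v: "0 \<le> v" "v \<le> 1" using assms by (simp_all add: v_def abs_square_le_1)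
  define T where "T = 1 - v / 2 - v^2 / 8 - v^3 / 16"
  have e: "1 - m^2 / 2 - m^4 / 8 - m^6 / 16 = T"
    unfolding T_def v_def by (simp flip: power_mult)
  have "v^2 \<le> 1" "v^3 \<le> 1" using v by (simp_all add: power_le_one)
  then have T0: "0 \<le> T" using v by (simp add: T_def)
  then show "0 \<le> 1 - m^2 / 2 - m^4 / 8 - m^6 / 16" unfolding e .
  have "T\<^sup>2 = 1 - v + (5/64 * v^4 + 1/64 * v^5 + 1/256 * v^6)"
    unfolding T_def by (simp add: power2_eq_square power3_eq_cube eval_nat_numeral field_simps)
  moreover have "0 \<le> 5/64 * v^4 + 1/64 * v^5 + 1/256 * v^6" using v(1) by (intro add_nonneg_nonneg mult_nonneg_nonneg) simp_all
  ultimately have "1 - v \<le> T\<^sup>2" by linarith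
  then show "sqrt (1 - m\<^sup>2) \<le> 1 - m^2 / 2 - m^4 / 8 - m^6 / 16"
    unfolding e unfolding v_def[symmetric] using T0 by (intro real_le_lsqrt)
qed

text \<open>
  The upper bound is the tangent at \<open>t = 14/25\<close>, where the square root equals \<open>8/5\<close>; the lower bound
  is close to a Taylor polynomial at \<open>0\<close>, with the coefficients tuned to the unit interval.
\<close>

lemma sqrt_two_plus_bounds:
  assumes "0 \<le> t" "t \<le> (1::real)"
  shows "707/500 + 7/20 * t - t\<^sup>2 / 30 \<le> sqrt (2 + t)" "sqrt (2 + t) \<le> 57/40 + 5/16 * t"
proof -
  have "t ^ 4 \<le> t ^ 3" using assms by (intro power_decreasing) auto
  moreover have "0 \<le> t * (51/5000 - 847/30000 * t + 1/45 * t\<^sup>2)"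
  proof (rule mult_nonneg_nonneg[OF assms(1)])
    have "51/5000 - 847/30000 * t + 1/45 * t\<^sup>2 = 1/45 * (t - 127/200)\<^sup>2 + 2231/1800000 - t / 90000"
      by (simp add: power2_eq_square field_simps)
    moreover have "0 \<le> 1/45 * (t - 127/200)\<^sup>2" by simp
    ultimately show "0 \<le> 51/5000 - 847/30000 * t + 1/45 * t\<^sup>2" using assms by linarith
  qed
  moreover have "2 + t - (707/500 + 7/20 * t - t\<^sup>2 / 30)\<^sup>2 =
    151/250000 + t * (51/5000 - 847/30000 * t + 1/45 * t\<^sup>2) + t ^ 3 / 900 - t ^ 4 / 900"
    by (simp add: power2_eq_square power3_eq_cube eval_nat_numeral field_simps)
  ultimately have "(707/500 + 7/20 * t - t\<^sup>2 / 30)\<^sup>2 \<le> 2 + t" by simp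
  then show "707/500 + 7/20 * t - t\<^sup>2 / 30 \<le> sqrt (2 + t)" by (rule real_le_rsqrt)
  have "(57/40 + 5/16 * t)\<^sup>2 = 2 + t + (7/40 - 5/16 * t)\<^sup>2" by (simp add: power2_eq_square field_simps)
  then have "2 + t \<le> (57/40 + 5/16 * t)\<^sup>2" by simp
  then show "sqrt (2 + t) \<le> 57/40 + 5/16 * t" using assms by (intro real_le_lsqrt) auto
qed

text \<open>
  In the coordinates \<open>t = fst q + snd q - 1\<close> and \<open>m = fst q - snd q\<close> the altitude is a product of
  functions of \<open>t\<close> and \<open>m\<close>. The factor \<open>sqrt t\<close> is kept exact, as it is not smooth at \<open>0\<close>; the two others are
  replaced by polynomials.
\<close>

lemma altitude_factors:
  "altitude q = sqrt (fst q + snd q - 1) * sqrt (2 + (fst q + snd q - 1)) * sqrt (1 - (fst q - snd q)\<^sup>2) / 2"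
proof -
  have "(fst q + snd q)\<^sup>2 - 1 = (fst q + snd q - 1) * (2 + (fst q + snd q - 1))" by algebra
  then show ?thesis unfolding altitude_def by (simp only: real_sqrt_mult mult.assoc)
qed

lemma triangles_sum_diff:
  assumes "q \<in> triangles"
  shows "0 \<le> fst q + snd q - 1" "fst q + snd q - 1 \<le> 1" "\<bar>fst q - snd q\<bar> \<le> 1"
  using assms by (auto simp: triangles_def)

lemma (in triangle_measure) integral_nonneg_triangles:
  fixes f :: "real \<times> real \<Rightarrow> real"
  assumes "\<And>q. q \<in> triangles \<Longrightarrow> 0 \<le> f q"
  shows "0 \<le> (\<integral>q. f q \<partial>M)"
  by (rule integral_nonneg_AE, rule AE_mp[OF AE_triangles]) (use assms in simp)

text \<open>
  The list \<open>cs\<close> holds the coefficients, times a common denominator, of the polynomial that remains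
  after the minorant of the altitude has been integrated over \<open>m\<close>.
\<close>

lemma integral_altitude_ge: "19265 / 100000 \<le> (\<integral>q. altitude q \<partial>all_triangles)"
proof -
  define a where "a t = sqrt t * (707/500 + 7/20 * t - t\<^sup>2 / 30) / 2" for t :: real
  define v where "v m = 1 - m^2 / 2 - m^4 / 8 - m^6 / 16 - 5 * m^8 / 16" for m :: real
  define V where "V m = m - m^3 / 6 - m^5 / 40 - m^7 / 112 - 5 * m^9 / 144" for m :: real
  define cs :: "real list" where "cs = [163486680, 40467000, -471534500, 663705000, -824934600, 707740320, -369910800, 88376400, 14826000, -15459000, 3412500, -175000]"
  define c where "c i = cs ! i / 302400000" for i
  have q0: "0 \<le> 707/500 + 7/20 * t - t\<^sup>2 / 30" if "0 \<le> t" "t \<le> 1" for t :: real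
  proof -
    have "t\<^sup>2 \<le> 1" using that by (simp add: power_le_one)
    then show ?thesis using that by simp
  qed
  have V0: "0 \<le> V s" if "0 \<le> s" "s \<le> 1" for s
  proof -
    have "s^3 \<le> s" "s^5 \<le> s" "s^7 \<le> s" "s^9 \<le> s" using that power_decreasing[of 1 _ s] by auto
    then show ?thesis using that(1) unfolding V_def by simp
  qed
  have eq: "a t * V (1 - t) = sqrt t * (\<Sum>i<12. c i * t ^ i)" for t
  proof -
    have "(42420 + 10500 * t - 1000 * t\<^sup>2) * (5040 * (1 - t) - 840 * (1 - t)^3 - 126 * (1 - t)^5 - 45 * (1 - t)^7 - 175 * (1 - t)^9)
      = 163486680 + 40467000 * t + -471534500 * t^2 + 663705000 * t^3 + -824934600 * t^4 + 707740320 * t^5 + -369910800 * t^6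
        + 88376400 * t^7 + 14826000 * t^8 + -15459000 * t^9 + 3412500 * t^10 + -175000 * t^11"
      by algebra
    moreover have "(707/500 + 7/20 * t - t\<^sup>2 / 30) / 2 * V (1 - t) = (42420 + 10500 * t - 1000 * t\<^sup>2) *
      (5040 * (1 - t) - 840 * (1 - t)^3 - 126 * (1 - t)^5 - 45 * (1 - t)^7 - 175 * (1 - t)^9) / 302400000"
    proof -
      have e1: "707/500 + 7/20 * t - t\<^sup>2 / 30 = (42420 + 10500 * t - 1000 * t\<^sup>2) / 30000" by simp
      have e2: "V s = (5040 * s - 840 * s^3 - 126 * s^5 - 45 * s^7 - 175 * s^9) / 5040" for s unfolding V_def by simp
      show ?thesis unfolding e1 e2[of "1 - t"] by simp
    qed
    moreover have "(\<Sum>i<12. c i * t ^ i) = (163486680 + 40467000 * t + -471534500 * t^2 + 663705000 * t^3 + -824934600 * t^4 + 707740320 * t^5 + -369910800 * t^6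
        + 88376400 * t^7 + 14826000 * t^8 + -15459000 * t^9 + 3412500 * t^10 + -175000 * t^11) / 302400000"
      unfolding c_def cs_def by (simp add: eval_nat_numeral(2,3) lessThan_Suc add_divide_distrib diff_divide_distrib)
    ultimately have e: "(707/500 + 7/20 * t - t\<^sup>2 / 30) / 2 * V (1 - t) = (\<Sum>i<12. c i * t ^ i)" by (simp only:)
    have "a t * V (1 - t) = sqrt t * ((707/500 + 7/20 * t - t\<^sup>2 / 30) / 2 * V (1 - t))" by (simp add: a_def)
    then show ?thesis unfolding e .
  qed
  have a0: "0 \<le> a t" if "0 \<le> t" "t \<le> 1" for t unfolding a_def using q0[OF that] that by simp
  have "ennreal (\<Sum>i<12. c i / (i + 3/2)) = (\<integral>\<^sup>+t\<in>{0..1}. ennreal (a t * V (1 - t)) \<partial>lborel)"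
    unfolding eq by (rule nn_integral_sqrt_polynomial[symmetric]) (use a0 V0 in \<open>simp flip: eq\<close>)
  also have "\<dots> = (\<integral>\<^sup>+q\<in>triangles. ennreal (a (fst q + snd q - 1) * v (fst q - snd q)) \<partial>lborel)"
  proof (rule nn_integral_triangles_product[symmetric])
    show "a \<in> borel_measurable borel" unfolding a_def[abs_def] by (intro borel_measurable_continuous_onI continuous_intros) auto
    show "continuous_on UNIV v" unfolding v_def[abs_def] by (intro continuous_intros) auto
    show "0 \<le> v m" if "\<bar>m\<bar> \<le> 1" for m unfolding v_def by (rule sqrt_one_minus_ge(2)[OF that])
    show "(V has_real_derivative v m) (at m)" for m
      unfolding V_def[abs_def] v_def by (auto intro!: derivative_eq_intros simp: field_simps)
    show "V (- m) = - V m" for m unfolding V_def by simp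
  qed (rule a0)
  also have "\<dots> \<le> (\<integral>\<^sup>+q\<in>triangles. ennreal (altitude q) \<partial>lborel)"
  proof (rule nn_integral_mono)
    fix q :: "real \<times> real"
    show "ennreal (a (fst q + snd q - 1) * v (fst q - snd q)) * indicator triangles q \<le> ennreal (altitude q) * indicator triangles q"
    proof (cases "q \<in> triangles")
      case True
      note b = triangles_sum_diff[OF True]
      have "(707/500 + 7/20 * (fst q + snd q - 1) - (fst q + snd q - 1)\<^sup>2 / 30) * v (fst q - snd q) \<le> sqrt (2 + (fst q + snd q - 1)) * sqrt (1 - (fst q - snd q)\<^sup>2)"
        unfolding v_def by (intro mult_mono sqrt_two_plus_bounds(1) sqrt_one_minus_ge q0 b) (use b in auto)
      then have "sqrt (fst q + snd q - 1) * ((707/500 + 7/20 * (fst q + snd q - 1) - (fst q + snd q - 1)\<^sup>2 / 30) * v (fst q - snd q))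
        \<le> sqrt (fst q + snd q - 1) * (sqrt (2 + (fst q + snd q - 1)) * sqrt (1 - (fst q - snd q)\<^sup>2))"
        using b by (intro mult_left_mono) auto
      then have "a (fst q + snd q - 1) * v (fst q - snd q) \<le> altitude q" unfolding a_def altitude_factors by simp
      then show ?thesis using True by (simp add: ennreal_leI)
    qed simp
  qed
  also have "\<dots> = (\<integral>\<^sup>+q. ennreal (altitude q) \<partial>all_triangles)"
    by (rule nn_integral_shape_measure[OF measurable_triangles, symmetric])
      (intro measurable_compose_rev[OF measurable_ennreal] measurable_altitude measurable_ident_sets refl)
  also have "\<dots> \<le> ennreal (\<integral>q. altitude q \<partial>all_triangles)"
    by (rule all.nn_integral_le_integral[OF all.integrable_coordinates(3)]) (auto intro: triangles_bounds)
  finally have "ennreal (\<Sum>i<12. c i / (i + 3/2)) \<le> ennreal (\<integral>q. altitude q \<partial>all_triangles)" .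
  moreover have "0 \<le> (\<integral>q. altitude q \<partial>all_triangles)"
    by (rule all.integral_nonneg_triangles) (rule triangles_bounds(2))
  ultimately have "(\<Sum>i<12. c i / (i + 3/2)) \<le> (\<integral>q. altitude q \<partial>all_triangles)"
    using ennreal_le_iff by blast
  moreover have "19265 / 100000 \<le> (\<Sum>i<12. c i / (i + 3/2))"
    unfolding c_def cs_def by (simp add: eval_nat_numeral(2,3) lessThan_Suc)
  ultimately show ?thesis by linarith
qed

text \<open>
  As \<open>sqradius q = (t\<^sup>2 + 2 t + m\<^sup>2) / 4\<close> is not a product, the majorant is split into two
  product terms \<open>F1\<close> and \<open>F2\<close>.
\<close>

lemma integral_sqradius_altitude_le: "(\<integral>q. sqradius q * altitude q \<partial>all_triangles) \<le> 615 / 10000"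
proof -
  define a1 where "a1 t = sqrt t * (57/40 + 5/16 * t) * (2 * t + t\<^sup>2) / 8" for t :: real
  define a2 where "a2 t = sqrt t * (57/40 + 5/16 * t) / 8" for t :: real
  define v1 where "v1 m = 1 - m^2 / 2 - m^4 / 8 - m^6 / 16" for m :: real
  define v2 where "v2 m = m^2 * v1 m" for m :: real
  define V1 where "V1 m = m - m^3 / 6 - m^5 / 40 - m^7 / 112" for m :: real
  define V2 where "V2 m = m^3 / 3 - m^5 / 10 - m^7 / 56 - m^9 / 144" for m :: real
  define cs :: "real list" where "cs = [239628, 1530674, -193638, -472650, -1778490, 1010982, -524874, 226698, -33570, -8760, 4000]"
  define c where "c i = cs ! i / 6451200" for i
  have eq: "a1 t * V1 (1 - t) + a2 t * V2 (1 - t) = sqrt t * (\<Sum>i<11. c i * t ^ i)" for t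
  proof -
    have f1: "(228 + 50 * t) * ((2 * t + t\<^sup>2) * (5040 * (1 - t) - 840 * (1 - t)^3 - 126 * (1 - t)^5 - 45 * (1 - t)^7)
        + (1680 * (1 - t)^3 - 504 * (1 - t)^5 - 90 * (1 - t)^7 - 35 * (1 - t)^9))
      = 239628 + 1530674 * t + -193638 * t^2 + -472650 * t^3 + -1778490 * t^4 + 1010982 * t^5 + -524874 * t^6 + 226698 * t^7
        + -33570 * t^8 + -8760 * t^9 + 4000 * t^10"
      by algebra
    have f2: "(\<Sum>i<11. c i * t ^ i) = (239628 + 1530674 * t + -193638 * t^2 + -472650 * t^3 + -1778490 * t^4 + 1010982 * t^5 + -524874 * t^6 + 226698 * t^7
        + -33570 * t^8 + -8760 * t^9 + 4000 * t^10) / 6451200"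
      unfolding c_def cs_def by (simp add: eval_nat_numeral(2,3) lessThan_Suc add_divide_distrib diff_divide_distrib)
    have e0: "57/40 + 5/16 * t = (228 + 50 * t) / 160" by simp
    have e1: "V1 s = (5040 * s - 840 * s^3 - 126 * s^5 - 45 * s^7) / 5040" for s unfolding V1_def by simp
    have e2: "V2 s = (1680 * s^3 - 504 * s^5 - 90 * s^7 - 35 * s^9) / 5040" for s unfolding V2_def by simp
    have "x * (A / 160) * B / 8 * (C / 5040) + x * (A / 160) / 8 * (D / 5040) = x * (A * (B * C + D) / 6451200)" for x A B C D :: real
      by (simp add: algebra_simps add_divide_distrib)
    then show ?thesis unfolding a1_def a2_def e0 e1[of "1 - t"] e2[of "1 - t"] f2 f1[symmetric] .
  qed
  have V1: "0 \<le> V1 s" if "0 \<le> s" "s \<le> 1" for s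
  proof -
    have "s^3 \<le> s" "s^5 \<le> s" "s^7 \<le> s" using that power_decreasing[of 1 _ s] by auto
    then show ?thesis using that(1) unfolding V1_def by simp
  qed
  have V2: "0 \<le> V2 s" if "0 \<le> s" "s \<le> 1" for s
  proof -
    have "s^5 \<le> s^3" "s^7 \<le> s^3" "s^9 \<le> s^3" "0 \<le> s^3" using that power_decreasing[of 3 _ s] by auto
    then show ?thesis unfolding V2_def by linarith
  qed
  have a1: "0 \<le> a1 t" and a2: "0 \<le> a2 t" if "0 \<le> t" "t \<le> 1" for t
    using that by (simp_all add: a1_def a2_def)
  have ma1: "a1 \<in> borel_measurable borel" unfolding a1_def[abs_def] by (intro borel_measurable_continuous_onI continuous_intros) auto
  have ma2: "a2 \<in> borel_measurable borel" unfolding a2_def[abs_def] by (intro borel_measurable_continuous_onI continuous_intros) auto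
  have cv1: "continuous_on UNIV v1" unfolding v1_def[abs_def] by (intro continuous_intros) auto
  have cv2: "continuous_on UNIV v2" unfolding v2_def[abs_def] v1_def by (intro continuous_intros) auto
  have v1: "0 \<le> v1 m" and v2: "0 \<le> v2 m" if "\<bar>m\<bar> \<le> 1" for m
    using sqrt_one_minus_le(2)[OF that] by (simp_all add: v1_def v2_def)
  define F1 where "F1 q = a1 (fst q + snd q - 1) * v1 (fst q - snd q)" for q :: "real \<times> real"
  define F2 where "F2 q = a2 (fst q + snd q - 1) * v2 (fst q - snd q)" for q :: "real \<times> real"
  have s: "(\<lambda>q :: real \<times> real. fst q + snd q - 1) \<in> borel_measurable borel" and d: "(\<lambda>q :: real \<times> real. fst q - snd q) \<in> borel_measurable borel"
    by (intro borel_measurable_continuous_onI continuous_intros)+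
  have mF1: "(\<lambda>q. ennreal (F1 q) * indicator triangles q) \<in> borel_measurable lborel" unfolding measurable_lborel2 F1_def
    by (intro borel_measurable_times_ennreal borel_measurable_indicator measurable_triangles measurable_compose_rev[OF measurable_ennreal]
      borel_measurable_times measurable_compose[OF s ma1] measurable_compose[OF d borel_measurable_continuous_onI[OF cv1]])
  have mF2: "(\<lambda>q. ennreal (F2 q) * indicator triangles q) \<in> borel_measurable lborel" unfolding measurable_lborel2 F2_def
    by (intro borel_measurable_times_ennreal borel_measurable_indicator measurable_triangles measurable_compose_rev[OF measurable_ennreal]
      borel_measurable_times measurable_compose[OF s ma2] measurable_compose[OF d borel_measurable_continuous_onI[OF cv2]])
  have i1: "(\<integral>\<^sup>+q\<in>triangles. ennreal (F1 q) \<partial>lborel) = (\<integral>\<^sup>+t\<in>{0..1}. ennreal (a1 t * V1 (1 - t)) \<partial>lborel)" unfolding F1_def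
  proof (rule nn_integral_triangles_product[OF ma1 a1 cv1 v1])
    show "(V1 has_real_derivative v1 m) (at m)" for m unfolding V1_def[abs_def] v1_def by (auto intro!: derivative_eq_intros simp: field_simps)
    show "V1 (- m) = - V1 m" for m unfolding V1_def by simp
  qed
  have i2: "(\<integral>\<^sup>+q\<in>triangles. ennreal (F2 q) \<partial>lborel) = (\<integral>\<^sup>+t\<in>{0..1}. ennreal (a2 t * V2 (1 - t)) \<partial>lborel)" unfolding F2_def
  proof (rule nn_integral_triangles_product[OF ma2 a2 cv2 v2])
    show "(V2 has_real_derivative v2 m) (at m)" for m unfolding V2_def[abs_def] v2_def v1_def
      by (auto intro!: derivative_eq_intros simp: field_simps eval_nat_numeral)
    show "V2 (- m) = - V2 m" for m unfolding V2_def by simp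
  qed
  have "ennreal (\<integral>q. sqradius q * altitude q \<partial>all_triangles) \<le> (\<integral>\<^sup>+q. ennreal (sqradius q * altitude q) \<partial>all_triangles)"
    by (rule all.integral_le_nn_integral[OF all.integrable_coordinates(5)]) simp
  also have "\<dots> = (\<integral>\<^sup>+q\<in>triangles. ennreal (sqradius q * altitude q) \<partial>lborel)"
    by (rule nn_integral_shape_measure[OF measurable_triangles])
      (intro measurable_compose_rev[OF measurable_ennreal] borel_measurable_times measurable_altitude measurable_sqradius measurable_ident_sets refl)
  also have "\<dots> \<le> (\<integral>\<^sup>+q. ennreal (F1 q) * indicator triangles q + ennreal (F2 q) * indicator triangles q \<partial>lborel)"
  proof (rule nn_integral_mono)
    fix q :: "real \<times> real"
    show "ennreal (sqradius q * altitude q) * indicator triangles q \<le> ennreal (F1 q) * indicator triangles q + ennreal (F2 q) * indicator triangles q"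
    proof (cases "q \<in> triangles")
      case True
      note b = triangles_sum_diff[OF True]
      define t m where "t = fst q + snd q - 1" and "m = fst q - snd q"
      have r: "sqradius q = (2 * t + t\<^sup>2) / 4 + m\<^sup>2 / 4"
        unfolding sqradius_def t_def m_def by (simp add: power2_eq_square field_simps)
      have "sqrt (2 + t) * sqrt (1 - m\<^sup>2) \<le> (57/40 + 5/16 * t) * v1 m"
        unfolding v1_def using b by (intro mult_mono sqrt_two_plus_bounds(2) sqrt_one_minus_le(1)) (auto simp: t_def m_def abs_square_le_1)
      then have "sqrt t * (sqrt (2 + t) * sqrt (1 - m\<^sup>2)) \<le> sqrt t * ((57/40 + 5/16 * t) * v1 m)"
        using b by (intro mult_left_mono) (auto simp: t_def)
      then have alt: "altitude q \<le> sqrt t * ((57/40 + 5/16 * t) * v1 m) / 2"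
        unfolding altitude_factors t_def m_def by simp
      have "sqradius q * altitude q \<le> sqradius q * (sqrt t * ((57/40 + 5/16 * t) * v1 m) / 2)"
        using alt triangles_bounds(4)[OF True] by (rule mult_left_mono)
      also have "\<dots> = F1 q + F2 q"
        unfolding r F1_def F2_def t_def[symmetric] m_def[symmetric] a1_def a2_def v2_def by (simp add: algebra_simps add_divide_distrib)
      finally have "sqradius q * altitude q \<le> F1 q + F2 q" .
      moreover have "0 \<le> F1 q" "0 \<le> F2 q" unfolding F1_def F2_def using b by (auto intro!: mult_nonneg_nonneg a1 a2 v1 v2)
      ultimately show ?thesis using True by (simp add: ennreal_leI flip: ennreal_plus)
    qed simp
  qed
  also have "\<dots> = (\<integral>\<^sup>+t\<in>{0..1}. ennreal (a1 t * V1 (1 - t)) \<partial>lborel) + (\<integral>\<^sup>+t\<in>{0..1}. ennreal (a2 t * V2 (1 - t)) \<partial>lborel)"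
    unfolding nn_integral_add[OF mF1 mF2] i1 i2 ..
  also have "\<dots> = (\<integral>\<^sup>+t\<in>{0..1}. ennreal (sqrt t * (\<Sum>i<11. c i * t ^ i)) \<partial>lborel)"
  proof -
    have m: "(\<lambda>t. ennreal (a1 t * V1 (1 - t)) * indicator {0..1} t) \<in> borel_measurable lborel" "(\<lambda>t. ennreal (a2 t * V2 (1 - t)) * indicator {0..1} t) \<in> borel_measurable lborel"
      unfolding measurable_lborel2 a1_def a2_def V1_def V2_def
      by (intro borel_measurable_times_ennreal borel_measurable_indicator measurable_compose_rev[OF measurable_ennreal]
        borel_measurable_continuous_onI continuous_intros; simp)+
    show ?thesis unfolding nn_integral_add[OF m, symmetric]
    proof (rule nn_integral_cong)
      fix t :: real
      show "ennreal (a1 t * V1 (1 - t)) * indicator {0..1} t + ennreal (a2 t * V2 (1 - t)) * indicator {0..1} t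
        = ennreal (sqrt t * (\<Sum>i<11. c i * t ^ i)) * indicator {0..1} t"
        unfolding eq[symmetric] by (cases "t \<in> {0..1}") (simp_all add: a1 a2 V1 V2)
    qed
  qed
  also have "\<dots> = ennreal (\<Sum>i<11. c i / (i + 3/2))"
    by (rule nn_integral_sqrt_polynomial) (simp add: a1 a2 V1 V2 flip: eq)
  also have "\<dots> \<le> ennreal (615 / 10000)"
    by (rule ennreal_leI) (simp add: c_def cs_def eval_nat_numeral(2,3) lessThan_Suc)
  finally show ?thesis by (subst (asm) ennreal_le_iff) simp_all
qed

lemma integral_altitude_square: "17 / 180 \<le> (\<integral>q. (altitude q)\<^sup>2 \<partial>all_triangles)"
proof -
  define a where "a t = (2 * t + t\<^sup>2) / 4" for t :: real
  define v where "v m = 1 - m\<^sup>2" for m :: real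
  define V where "V m = m - m ^ 3 / 3" for m :: real
  define G where "G t = t^2 / 6 + t^3 / 18 - t^4 / 8 - t^5 / 60 + t^6 / 72" for t :: real
  have V0: "0 \<le> V s" if "0 \<le> s" "s \<le> 1" for s
  proof -
    have "s^3 \<le> s" using that power_decreasing[of 1 3 s] by auto
    then show ?thesis using that(1) unfolding V_def by simp
  qed
  have "(\<integral>\<^sup>+t\<in>{0..1}. ennreal (a t * V (1 - t)) \<partial>lborel) = ennreal (G 1 - G 0)"
  proof -
    have 1: "(\<lambda>t. a t * V (1 - t)) \<in> borel_measurable borel" unfolding a_def V_def
      by (intro borel_measurable_continuous_onI continuous_intros) auto
    have 2: "(G has_real_derivative a t * V (1 - t)) (at t)" for t
    proof -
      have "(G has_real_derivative 2 * t / 6 + 3 * t^2 / 18 - 4 * t^3 / 8 - 5 * t^4 / 60 + 6 * t^5 / 72) (at t)"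
        unfolding G_def[abs_def] by (auto intro!: derivative_eq_intros)
      moreover have "a t * V (1 - t) = 2 * t / 6 + 3 * t^2 / 18 - 4 * t^3 / 8 - 5 * t^4 / 60 + 6 * t^5 / 72"
        unfolding a_def V_def by (simp add: eval_nat_numeral field_simps)
      ultimately show ?thesis by (simp only:)
    qed
    have 3: "0 \<le> a t * V (1 - t)" if "0 \<le> t" "t \<le> 1" for t using that V0[of "1 - t"] by (simp add: a_def)
    show ?thesis using nn_integral_FTC_Icc[OF 1, of 0 1 G] 2 3 by simp
  qed
  then have "ennreal (17 / 180) = (\<integral>\<^sup>+t\<in>{0..1}. ennreal (a t * V (1 - t)) \<partial>lborel)" by (simp add: G_def)
  also have "\<dots> = (\<integral>\<^sup>+q\<in>triangles. ennreal (a (fst q + snd q - 1) * v (fst q - snd q)) \<partial>lborel)"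
  proof (rule nn_integral_triangles_product[symmetric])
    show "a \<in> borel_measurable borel" unfolding a_def[abs_def] by (intro borel_measurable_continuous_onI continuous_intros) auto
    show "continuous_on UNIV v" unfolding v_def[abs_def] by (intro continuous_intros)
    show "0 \<le> a t" if "0 \<le> t" "t \<le> 1" for t using that by (simp add: a_def)
    show "0 \<le> v m" if "\<bar>m\<bar> \<le> 1" for m using that by (simp add: v_def abs_square_le_1)
    show "(V has_real_derivative v m) (at m)" for m unfolding V_def[abs_def] v_def by (auto intro!: derivative_eq_intros)
    show "V (- m) = - V m" for m unfolding V_def by simp
  qed
  also have "\<dots> = (\<integral>\<^sup>+q\<in>triangles. ennreal ((altitude q)\<^sup>2) \<partial>lborel)"
  proof (rule nn_integral_cong)
    fix q :: "real \<times> real"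
    have e: "2 * (fst q + snd q - 1) + (fst q + snd q - 1)\<^sup>2 = (fst q + snd q)\<^sup>2 - 1" by algebra
    show "ennreal (a (fst q + snd q - 1) * v (fst q - snd q)) * indicator triangles q = ennreal ((altitude q)\<^sup>2) * indicator triangles q"
      unfolding a_def v_def e by (cases "q \<in> triangles") (simp_all add: altitude_square(1))
  qed
  also have "\<dots> = (\<integral>\<^sup>+q. ennreal ((altitude q)\<^sup>2) \<partial>all_triangles)"
    by (rule nn_integral_shape_measure[OF measurable_triangles, symmetric])
      (intro measurable_compose_rev[OF measurable_ennreal] borel_measurable_power measurable_altitude measurable_ident_sets refl)
  also have "\<dots> \<le> ennreal (\<integral>q. (altitude q)\<^sup>2 \<partial>all_triangles)"
    by (rule all.nn_integral_le_integral[OF all.integrable_coordinates(7)]) simp_all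
  finally have "ennreal (17 / 180) \<le> ennreal (\<integral>q. (altitude q)\<^sup>2 \<partial>all_triangles)" .
  moreover have "0 \<le> (\<integral>q. (altitude q)\<^sup>2 \<partial>all_triangles)" by (rule all.integral_nonneg_triangles) simp
  ultimately show ?thesis using ennreal_le_iff by blast
qed

text \<open>
  The term \<open>U\<^sup>2\<close>, which is zero by symmetry, is estimated by its sign.
\<close>

lemma flap_volume_ge: "ennreal (90 / 1000) \<le> flap_volume {0..1}"
proof -
  define H R U S where "H = (\<integral>q. altitude q \<partial>all_triangles)" and "R = (\<integral>q. sqradius q * altitude q \<partial>all_triangles)"
    and "U = (\<integral>q. abscissa q * altitude q \<partial>all_triangles)" and "S = (\<integral>q. (altitude q)\<^sup>2 \<partial>all_triangles)"
  have H: "19265 / 100000 \<le> H" and R: "R \<le> 615 / 10000" and S: "17 / 180 \<le> S"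
    unfolding H_def R_def S_def by (rule integral_altitude_ge integral_sqradius_altitude_le integral_altitude_square)+
  have "19265 / 100000 * (501/100 * (19265 / 100000) - 501/50 * (615 / 10000)) \<le> H * (501/100 * H - 501/50 * R)"
    using H R by (intro mult_mono) auto
  then have "672 / 10000 \<le> H * (501/100 * H - 501/50 * R)" by simp
  moreover have "H * (501/100 * H - 501/50 * R) = 501/100 * H\<^sup>2 - 501/50 * R * H" by (simp add: power2_eq_square algebra_simps)
  moreover have "(17 / 180)\<^sup>2 \<le> S\<^sup>2" using S by (intro power_mono) auto
  then have "89 / 10000 \<le> S\<^sup>2" by (simp add: power2_eq_square)
  moreover have "0 \<le> U\<^sup>2" by simp
  ultimately have "90 / 1000 \<le> 501/100 * H\<^sup>2 - 501/50 * R * H + 501/50 * U\<^sup>2 + 129/50 * S\<^sup>2" by linarith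
  then have "ennreal (90 / 1000) \<le> ennreal (501/100 * H\<^sup>2 - 501/50 * R * H + 501/50 * U\<^sup>2 + 129/50 * S\<^sup>2)" by (rule ennreal_leI)
  also have "\<dots> \<le> flap_volume {0..1}" unfolding flap_volume_eq_double_integral H_def R_def U_def S_def by (rule all.gap_pair_lower)
  finally show ?thesis .
qed

section \<open>Integer bounds for pairs of grid cells\<close>

text \<open>
  One Newton step for the square root, rounded up. By the inequality of arithmetic and geometric
  means the result bounds \<open>sqrt n\<close> from above for every positive start value \<open>b\<close>, so the quality of
  the iteration matters for the size of the bounds only.
\<close>

definition newton_step :: "int \<Rightarrow> int \<Rightarrow> int" where
  "newton_step n b = max 1 ((n div b + b) div 2 + 1)"

definition sqrt_up :: "int \<Rightarrow> int" where
  "sqrt_up n = newton_step n (newton_step n (newton_step n (newton_step n 2000)))"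

definition sqrt_down :: "int \<Rightarrow> int" where
  "sqrt_down n = n div sqrt_up n"

text \<open>
  The five numbers for a grid cell: its area in units of \<open>1/128\<close> (half a grid square) and, multiplied
  by \<open>4608 = 72 * 8\<^sup>2\<close>, the means over the cell of \<open>sqradius\<close> and \<open>abscissa\<close> and a lower and an upper
  bound for the mean of \<open>altitude\<close>. The factor makes the two exact means integers. Cells with
  \<open>i + j = 7\<close> are the half squares cut by the hypotenuse of the region of triangles; the trivial
  lower bound \<open>0\<close> suffices there. In the remaining cells \<open>a\<close> and \<open>b\<close> are bounds for the altitude at
  two opposite corners, \<open>108 * s + 15\<close> is the variance of the abscissa, rounded up, and
  \<open>altitude_integral_ge\<close> explains the quotient.
\<close>

definition cell_data :: "int \<Rightarrow> int \<Rightarrow> int \<times> int \<times> int \<times> int \<times> int" where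
  "cell_data i j =
    (if i + j = 7 then
      let U = 4 * ((3 * i + 2)\<^sup>2 - (3 * j + 2)\<^sup>2);
          R = 4 * ((3 * i + 2)\<^sup>2 + (3 * j + 2)\<^sup>2) - 1148
      in (1, R, U, 0, sqrt_up (4608 * R - U\<^sup>2))
     else
      let s = (2 * i + 1)\<^sup>2 + (2 * j + 1)\<^sup>2;
          U = 9 * ((2 * i + 1)\<^sup>2 - (2 * j + 1)\<^sup>2);
          R = 9 * s - 1146;
          a = sqrt_down (1296 * ((i + j)\<^sup>2 - 64) * (64 - (i - j)\<^sup>2));
          b = sqrt_up (1296 * ((i + j + 2)\<^sup>2 - 64) * (64 - (i - j)\<^sup>2))
      in (2, R, U, (4608 * R - U\<^sup>2 - 108 * s - 15 + a * b) div (a + b), sqrt_up (4608 * R - U\<^sup>2)))"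

text \<open>
  In units of \<open>1 / (4608 * 128\<^sup>2)\<close>: the product of the areas times the difference of an upper bound
  for the root mean square of \<open>far_dist\<close>, cut off at \<open>1\<close>, and a lower bound for the distance of the
  mean apexes. The altitudes of these enter through the distance of two intervals.
\<close>

fun pair_bound :: "int \<times> int \<times> int \<times> int \<times> int \<Rightarrow> int \<times> int \<times> int \<times> int \<times> int \<Rightarrow> int" where
  "pair_bound (W, R, U, L, H) (W', R', U', L', H') =
     W * W' * (min 4608 (sqrt_up (4608 * (R + R') - 2 * U * U' + 2 * H * H'))
       - sqrt_down ((U - U')\<^sup>2 + (max 0 (max (L - H') (L' - H)))\<^sup>2))"

definition cell_index :: "(int \<times> int) list" where
  "cell_index = [(i, j). i \<leftarrow> [0..7], j \<leftarrow> [7 - i..7]]"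

text \<open>
  The evaluated cell data, as literals, so that they are not recomputed for each of the pairs; the
  table is in four parts to keep the single evaluations short.
\<close>

definition cells1 :: "(int \<times> int \<times> int \<times> int \<times> int) list" where
  "cells1 = [(1, 984, -2100, 0, 356), (1, 552, -1500, 0, 543), (2, 960, -1944, 541, 803),
    (1, 264, -900, 0, 638), (2, 600, -1296, 710, 1042), (2, 1104, -1800, 1292, 1360),
    (1, 120, -300, 0, 681), (2, 384, -648, 795, 1162), (2, 816, -1080, 1536, 1611)]"

definition cells2 :: "(int \<times> int \<times> int \<times> int \<times> int) list" where
  "cells2 = [(2, 1320, -1584, 1846, 1891), (1, 120, 300, 0, 681), (2, 312, 0, 821, 1200),
    (2, 672, -360, 1644, 1723), (2, 1104, -792, 2064, 2112), (2, 1608, -1296, 2359, 2394),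
    (1, 264, 900, 0, 638), (2, 384, 648, 795, 1162), (2, 672, 360, 1644, 1723)]"

definition cells3 :: "(int \<times> int \<times> int \<times> int \<times> int) list" where
  "cells3 = [(2, 1032, 0, 2132, 2181), (2, 1464, -432, 2525, 2562), (2, 1968, -936, 2833, 2863),
    (1, 552, 1500, 0, 543), (2, 600, 1296, 710, 1042), (2, 816, 1080, 1536, 1611),
    (2, 1104, 792, 2064, 2112), (2, 1464, 432, 2525, 2562), (2, 1896, 0, 2926, 2956)]"

definition cells4 :: "(int \<times> int \<times> int \<times> int \<times> int) list" where
  "cells4 = [(2, 2400, -504, 3262, 3288), (1, 984, 2100, 0, 356), (2, 960, 1944, 541, 803),
    (2, 1104, 1800, 1292, 1360), (2, 1320, 1584, 1846, 1891), (2, 1608, 1296, 2359, 2394),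
    (2, 1968, 936, 2833, 2863), (2, 2400, 504, 3262, 3288), (2, 2904, 0, 3635, 3659)]"

lemma cells_eval: "map (\<lambda>(i, j). cell_data i j) cell_index = cells1 @ cells2 @ cells3 @ cells4"
  by code_simp

lemma pair_bounds_1:
  "sum_list (map (\<lambda>p. sum_list (map (pair_bound p) (cells1 @ cells2 @ cells3 @ cells4))) cells1) \<le> 1257318"
  by code_simp

lemma pair_bounds_2:
  "sum_list (map (\<lambda>p. sum_list (map (pair_bound p) (cells1 @ cells2 @ cells3 @ cells4))) cells2) \<le> 2108189"
  by code_simp

lemma pair_bounds_3:
  "sum_list (map (\<lambda>p. sum_list (map (pair_bound p) (cells1 @ cells2 @ cells3 @ cells4))) cells3) \<le> 2584219"
  by code_simp

lemma pair_bounds_4: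
  "sum_list (map (\<lambda>p. sum_list (map (pair_bound p) (cells1 @ cells2 @ cells3 @ cells4))) cells4) \<le> 2286018"
  by code_simp

section \<open>The integer bounds dominate the mean gap\<close>

lemma newton_step_ge:
  assumes "0 < b" shows "0 < newton_step n b" "n \<le> (newton_step n b)\<^sup>2"
proof -
  define s where "s = n div b"
  define t where "t = (s + b) div 2 + 1"
  have N: "newton_step n b = max 1 t" by (simp add: newton_step_def s_def t_def)
  show "0 < newton_step n b" unfolding N by simp
  have "n = b * s + n mod b" by (simp add: s_def)
  moreover have "n mod b < b" using assms by simp
  ultimately have nb: "n < b * (s + 1)" by (simp add: algebra_simps)
  have t2: "s + b + 1 \<le> 2 * t" unfolding t_def by presburger
  show "n \<le> (newton_step n b)\<^sup>2"
  proof (cases "0 \<le> s + b + 1")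
    case True
    have "4 * (b * (s + 1)) \<le> (s + b + 1)\<^sup>2"
    proof -
      have "(s + b + 1)\<^sup>2 = 4 * (b * (s + 1)) + (s + 1 - b)\<^sup>2" by algebra
      then show ?thesis by simp
    qed
    also have "\<dots> \<le> (2 * t)\<^sup>2" using t2 True by (intro power_mono)
    finally have "b * (s + 1) \<le> t\<^sup>2" by (simp add: power_mult_distrib)
    moreover have "t\<^sup>2 \<le> (newton_step n b)\<^sup>2" unfolding N using t2 True by (intro power_mono) auto
    ultimately show ?thesis using nb by linarith
  next
    case False
    then have "s + 1 \<le> 0" using assms by linarith
    then have "b * (s + 1) \<le> 0" using assms by (simp add: mult_nonneg_nonpos)
    then show ?thesis using nb zero_le_power2[of "newton_step n b"] by linarith
  qed
qed

lemma sqrt_up: "0 < sqrt_up n" "n \<le> (sqrt_up n)\<^sup>2"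
  unfolding sqrt_up_def by (intro newton_step_ge; simp)+

lemma sqrt_down:
  assumes "0 \<le> n" shows "0 \<le> sqrt_down n" "(sqrt_down n)\<^sup>2 \<le> n"
proof -
  define B J where "B = sqrt_up n" and "J = sqrt_down n"
  have J: "J = n div B" by (simp add: J_def B_def sqrt_down_def)
  have B: "0 < B" "n \<le> B\<^sup>2" using sqrt_up by (simp_all add: B_def)
  show J0: "0 \<le> sqrt_down n" using assms B(1) unfolding J_def[symmetric] J by (simp add: pos_imp_zdiv_nonneg_iff)
  have "n = J * B + n mod B" unfolding J by simp
  then have JB: "J * B \<le> n" using pos_mod_sign[OF B(1), of n] by linarith
  have "J \<le> B"
  proof (rule ccontr)
    assume "\<not> J \<le> B"
    then have "B * B < J * B" using B(1) by simp
    then show False using JB B(2) by (simp add: power2_eq_square)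
  qed
  then have "J * J \<le> J * B" using J0 unfolding J_def[symmetric] by (intro mult_left_mono)
  then show "(sqrt_down n)\<^sup>2 \<le> n" using JB unfolding J_def[symmetric] by (simp add: power2_eq_square)
qed

text \<open>
  \<open>M\<close> is a measure whose mass and moments are described by a tuple in the format of \<open>cell_data\<close>.
\<close>

definition cell_ok :: "(real \<times> real) measure \<Rightarrow> int \<times> int \<times> int \<times> int \<times> int \<Rightarrow> bool" where
  "cell_ok M = (\<lambda>(W, R, U, L, H). triangle_measure M \<and> 0 < W \<and> 0 \<le> H \<and>
     measure M (space M) = W / 128 \<and>
     (\<integral>q. sqradius q \<partial>M) = W / 128 * (R / 4608) \<and>
     (\<integral>q. abscissa q \<partial>M) = W / 128 * (U / 4608) \<and>
     W / 128 * (L / 4608) \<le> (\<integral>q. altitude q \<partial>M) \<and> (\<integral>q. altitude q \<partial>M) \<le> W / 128 * (H / 4608))"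

text \<open>
  The tangent of \<open>sqrt\<close> at \<open>(B / 4608)\<^sup>2\<close>, or the constant \<open>1\<close> if that point lies beyond the
  cut-off, majorises \<open>min 1 t\<close> as a function of \<open>t\<^sup>2\<close> and is at most \<open>min 4608 B / 4608\<close> at every
  point \<open>x\<close> before the contact.
\<close>

lemma sup_le_pair:
  fixes x y :: real and B :: int
  assumes "x \<le> y" "y \<le> (B / 4608)\<^sup>2" "0 < B"
  shows "\<exists>c0 c1. (\<forall>t\<ge>0. min 1 t \<le> c0 + c1 * t\<^sup>2) \<and> 0 \<le> c1 \<and> c0 + c1 * x \<le> min 4608 B / 4608"
proof (cases "4608 \<le> B")
  case True
  then show ?thesis by (intro exI[of _ 1] exI[of _ 0]) simp
next
  case False
  define b :: real where "b = B / 4608"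
  have b: "0 < b" using assms(3) by (simp add: b_def)
  have "min 1 t \<le> b / 2 + 1 / (2 * b) * t\<^sup>2" for t
  proof -
    have "0 \<le> (t - b)\<^sup>2 / (2 * b)" using b by simp
    also have "\<dots> = b / 2 + 1 / (2 * b) * t\<^sup>2 - t" using b by (simp add: power2_eq_square field_simps)
    finally show ?thesis by linarith
  qed
  note f1 = this
  have f2: "b / 2 + 1 / (2 * b) * x \<le> b"
  proof -
    have "1 / (2 * b) * x \<le> 1 / (2 * b) * b\<^sup>2" using assms b by (intro mult_left_mono) (auto simp: b_def)
    also have "\<dots> = b / 2" using b by (simp add: power2_eq_square)
    finally show ?thesis by simp
  qed
  have f3: "b = min 4608 B / 4608" using False by (simp add: b_def)
  show ?thesis
  proof (intro exI conjI allI impI)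
    show "min 1 t \<le> b / 2 + 1 / (2 * b) * t\<^sup>2" for t by (rule f1)
    show "b / 2 + 1 / (2 * b) * x \<le> min 4608 B / 4608" using f2 unfolding f3[symmetric] .
  qed (use b in simp)
qed

text \<open>
  The direction in which the projection attains the norm; for the zero vector any direction, here
  \<open>(0, 0)\<close>.
\<close>

lemma unit_direction: "\<exists>e1 e2. e1\<^sup>2 + e2\<^sup>2 \<le> 1 \<and> e1 * x + e2 * y = sqrt (x\<^sup>2 + y\<^sup>2)" for x y :: real
proof (cases "x\<^sup>2 + y\<^sup>2 = 0")
  case True
  then show ?thesis by (intro exI[of _ 0]) simp
next
  case False
  define n where "n = sqrt (x\<^sup>2 + y\<^sup>2)"
  have n: "n\<^sup>2 = x\<^sup>2 + y\<^sup>2" "n \<noteq> 0" using False by (simp_all add: n_def)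
  have "(x / n)\<^sup>2 + (y / n)\<^sup>2 = (x\<^sup>2 + y\<^sup>2) / n\<^sup>2" by (simp add: power_divide add_divide_distrib)
  then have "(x / n)\<^sup>2 + (y / n)\<^sup>2 = 1" unfolding n(1)[symmetric] using n(2) by simp
  moreover have "x / n * x + y / n * y = n"
  proof -
    have "x / n * x + y / n * y = n\<^sup>2 / n" unfolding n(1) by (simp add: power2_eq_square add_divide_distrib)
    then show ?thesis using n(2) by (simp add: power2_eq_square)
  qed
  ultimately show ?thesis unfolding n_def[symmetric] by (intro exI[of _ "x / n"] exI[of _ "y / n"]) simp
qed

text \<open>
  The line is taken tangent at the bound for the mean of \<open>far\<^sup>2\<close>, the direction along the
  difference of the mean apexes, where \<open>gap_pair_upper\<close> becomes Jensen's inequality.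
\<close>

lemma cell_pair_bound:
  assumes M: "cell_ok M p" and N: "cell_ok N p'"
  shows "(\<integral>\<^sup>+q. \<integral>\<^sup>+q'. ennreal (gap q q') \<partial>N \<partial>M) \<le> ennreal (pair_bound p p' / (4608 * 16384))"
    and "0 \<le> pair_bound p p'"
proof -
  obtain W R U L H where p: "p = (W, R, U, L, H)" by (metis prod.exhaust)
  obtain W' R' U' L' H' where p': "p' = (W', R', U', L', H')" by (metis prod.exhaust)
  have M: "triangle_measure M" "0 < W" "0 \<le> H" "measure M (space M) = W / 128" "(\<integral>q. sqradius q \<partial>M) = W / 128 * (R / 4608)"
    "(\<integral>q. abscissa q \<partial>M) = W / 128 * (U / 4608)" "W / 128 * (L / 4608) \<le> (\<integral>q. altitude q \<partial>M)" "(\<integral>q. altitude q \<partial>M) \<le> W / 128 * (H / 4608)"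
    using assms(1) unfolding cell_ok_def p prod.case by - (elim conjE, simp only: of_int_0_less_iff of_int_0_le_iff)+
  have N: "triangle_measure N" "0 < W'" "0 \<le> H'" "measure N (space N) = W' / 128" "(\<integral>q. sqradius q \<partial>N) = W' / 128 * (R' / 4608)"
    "(\<integral>q. abscissa q \<partial>N) = W' / 128 * (U' / 4608)" "W' / 128 * (L' / 4608) \<le> (\<integral>q. altitude q \<partial>N)" "(\<integral>q. altitude q \<partial>N) \<le> W' / 128 * (H' / 4608)"
    using assms(2) unfolding cell_ok_def p' prod.case by - (elim conjE, simp only: of_int_0_less_iff of_int_0_le_iff)+
  define h where "h = (\<integral>q. altitude q \<partial>M) / (W / 128)"
  define h' where "h' = (\<integral>q. altitude q \<partial>N) / (W' / 128)"
  have hM: "(\<integral>q. altitude q \<partial>M) = W / 128 * h" and hN: "(\<integral>q. altitude q \<partial>N) = W' / 128 * h'"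
    using M(2) N(2) by (simp_all add: h_def h'_def)
  have h: "L / 4608 \<le> h" "h \<le> H / 4608" and h': "L' / 4608 \<le> h'" "h' \<le> H' / 4608"
    using M(2,7,8) N(2,7,8) unfolding hM hN by simp_all
  have h0: "0 \<le> h" "0 \<le> h'"
    using triangle_measure.integral_nonneg_triangles[OF M(1), of altitude] triangle_measure.integral_nonneg_triangles[OF N(1), of altitude]
      triangles_bounds(2) M(2) N(2) unfolding h_def h'_def by simp_all
  define n where "n = 4608 * (R + R') - 2 * U * U' + 2 * H * H'"
  define D where "D = max 0 (max (L - H') (L' - H))"
  define J where "J = sqrt_down ((U - U')\<^sup>2 + D\<^sup>2)"
  define X where "X = R / 4608 + R' / 4608 - 2 * (U / 4608) * (U' / 4608) + 2 * h * h'"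
  have "X \<le> R / 4608 + R' / 4608 - 2 * (U / 4608) * (U' / 4608) + 2 * (H / 4608) * (H' / 4608)"
  proof -
    have "h * h' \<le> H / 4608 * (H' / 4608)" using h h' h0 by (intro mult_mono) auto
    then show ?thesis unfolding X_def by simp
  qed
  moreover have "R / 4608 + R' / 4608 - 2 * (U / 4608) * (U' / 4608) + 2 * (H / 4608) * (H' / 4608) = real_of_int n / 4608\<^sup>2"
    unfolding n_def by (simp add: power2_eq_square field_simps)
  moreover have "real_of_int n / 4608\<^sup>2 \<le> (sqrt_up n / 4608)\<^sup>2"
  proof -
    have "real_of_int n \<le> (real_of_int (sqrt_up n))\<^sup>2" using sqrt_up(2)[of n] by (metis of_int_le_iff of_int_power)
    then show ?thesis unfolding power_divide by (intro divide_right_mono) auto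
  qed
  ultimately have "X \<le> real_of_int n / 4608\<^sup>2" "real_of_int n / 4608\<^sup>2 \<le> (sqrt_up n / 4608)\<^sup>2" by linarith+
  from sup_le_pair[OF this sqrt_up(1)] obtain c0 c1 where c: "\<And>t. 0 \<le> t \<Longrightarrow> min 1 t \<le> c0 + c1 * t\<^sup>2" and cX: "c0 + c1 * X \<le> min 4608 (sqrt_up n) / 4608" by blast
  obtain e1 e2 where e: "e1\<^sup>2 + e2\<^sup>2 \<le> 1" and eD: "e1 * (U / 4608 - U' / 4608) + e2 * (h - h') = sqrt ((U / 4608 - U' / 4608)\<^sup>2 + (h - h')\<^sup>2)"
    using unit_direction[of "U / 4608 - U' / 4608" "h - h'"] by blast
  have JD: "J / 4608 \<le> sqrt ((U / 4608 - U' / 4608)\<^sup>2 + (h - h')\<^sup>2)"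
  proof (rule real_le_rsqrt)
    have s: "real_of_int L \<le> h * 4608" "h * 4608 \<le> real_of_int H" "real_of_int L' \<le> h' * 4608" "h' * 4608 \<le> real_of_int H'"
      using h h' by (simp_all add: field_simps)
    have a: "real_of_int L - real_of_int H' \<le> (h - h') * 4608" "real_of_int L' - real_of_int H \<le> - (h - h') * 4608"
      using s by (simp_all add: left_diff_distrib)
    have b: "(h - h') * 4608 \<le> 4608 * \<bar>h - h'\<bar>" "- (h - h') * 4608 \<le> 4608 * \<bar>h - h'\<bar>"
      unfolding mult.commute[of _ 4608] by (rule mult_left_mono[OF abs_ge_self] mult_left_mono[OF abs_ge_minus_self]; simp)+
    have "D / 4608 \<le> \<bar>h - h'\<bar>" using order_trans[OF a(1) b(1)] order_trans[OF a(2) b(2)] unfolding D_def by (simp add: of_int_max)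
    moreover have "0 \<le> D / (4608 :: real)" unfolding D_def by simp
    ultimately have "(D / 4608)\<^sup>2 \<le> \<bar>h - h'\<bar>\<^sup>2" by (rule power_mono)
    then have "(D / 4608)\<^sup>2 \<le> (h - h')\<^sup>2" unfolding power2_abs .
    moreover have "(J / 4608)\<^sup>2 \<le> (U / 4608 - U' / 4608)\<^sup>2 + (D / 4608)\<^sup>2"
    proof -
      have "J\<^sup>2 \<le> (U - U')\<^sup>2 + D\<^sup>2" unfolding J_def by (rule sqrt_down(2)) simp
      then have "real_of_int (J\<^sup>2) \<le> real_of_int ((U - U')\<^sup>2 + D\<^sup>2)" by (simp only: of_int_le_iff)
      then have "(real_of_int J)\<^sup>2 \<le> (real_of_int U - real_of_int U')\<^sup>2 + (real_of_int D)\<^sup>2" by simp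
      then show ?thesis unfolding power_divide diff_divide_distrib[symmetric] add_divide_distrib[symmetric] by (intro divide_right_mono) auto
    qed
    ultimately show "(J / 4608)\<^sup>2 \<le> (U / 4608 - U' / 4608)\<^sup>2 + (h - h')\<^sup>2" by linarith
  qed
  note B = gap_pair_upper[OF M(1) N(1) e c, unfolded M(4-6) N(4-6) hM hN]
  let ?E = "c0 * (W / 128) * (W' / 128) + c1 * (W / 128 * (R / 4608) * (W' / 128) + W / 128 * (W' / 128 * (R' / 4608)) - 2 * (W / 128 * (U / 4608)) * (W' / 128 * (U' / 4608)) +
     2 * (W / 128 * h) * (W' / 128 * h')) - e1 * (W / 128 * (U / 4608) * (W' / 128) - W / 128 * (W' / 128 * (U' / 4608))) - e2 * (W / 128 * h * (W' / 128) - W / 128 * (W' / 128 * h'))"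
  have E: "?E = W / 128 * (W' / 128) * (c0 + c1 * X - (e1 * (U / 4608 - U' / 4608) + e2 * (h - h')))"
  proof -
    have "c0 * w * w' + c1 * (w * r * w' + w * (w' * r') - 2 * (w * u) * (w' * u') + 2 * (w * h) * (w' * h')) - e1 * (w * u * w' - w * (w' * u')) - e2 * (w * h * w' - w * (w' * h'))
      = w * w' * (c0 + c1 * (r + r' - 2 * u * u' + 2 * h * h') - (e1 * (u - u') + e2 * (h - h')))" for w w' r r' u u' :: real by algebra
    then show ?thesis unfolding X_def .
  qed
  have "?E \<le> W / 128 * (W' / 128) * (min 4608 (sqrt_up n) / 4608 - J / 4608)"
    unfolding E eD using cX JD M(2) N(2) by (intro mult_left_mono) auto
  also have "\<dots> = pair_bound p p' / (4608 * 16384)"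
    unfolding p p' pair_bound.simps n_def[symmetric] D_def[symmetric] J_def[symmetric] by (simp add: field_simps)
  finally have le: "?E \<le> pair_bound p p' / (4608 * 16384)" .
  show "(\<integral>\<^sup>+q. \<integral>\<^sup>+q'. ennreal (gap q q') \<partial>N \<partial>M) \<le> ennreal (pair_bound p p' / (4608 * 16384))"
    using B(1) ennreal_leI[OF le] by (rule order_trans)
  have "0 \<le> pair_bound p p' / (4608 * 16384 :: real)" using B(2) le by (rule order_trans)
  then show "0 \<le> pair_bound p p'" by simp
qed

section \<open>Mean altitude and moments of a grid cell\<close>

context triangle_measure begin

lemma altitude_square_integral:
  "(\<integral>q. (altitude q)\<^sup>2 \<partial>M) = (\<integral>q. sqradius q \<partial>M) - (\<integral>q. (abscissa q)\<^sup>2 \<partial>M)"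
proof -
  have "(\<integral>q. (altitude q)\<^sup>2 \<partial>M) = (\<integral>q. sqradius q - (abscissa q)\<^sup>2 \<partial>M)"
  proof (rule integral_cong_AE)
    show "AE q in M. (altitude q)\<^sup>2 = sqradius q - (abscissa q)\<^sup>2"
      by (rule AE_mp[OF AE_triangles]) (simp add: sqradius_eq)
  qed (use integrable_coordinates in \<open>auto intro: borel_measurable_integrable\<close>)
  then show ?thesis using integrable_coordinates by simp
qed

text \<open>
  The Cauchy--Schwarz inequality against the constant function, as nonnegativity of the variance.
\<close>

lemma variance_nonneg:
  assumes f: "integrable M f" "integrable M (\<lambda>q. (f q)\<^sup>2)" and w: "0 < mass"
  shows "(\<integral>q. f q \<partial>M)\<^sup>2 / mass \<le> (\<integral>q. (f q)\<^sup>2 \<partial>M)"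
proof -
  define c where "c = (\<integral>q. f q \<partial>M) / mass"
  have "0 \<le> (\<integral>q. (f q - c)\<^sup>2 \<partial>M)" by simp
  also have "\<dots> = (\<integral>q. (f q)\<^sup>2 + (- 2 * c) * f q + c\<^sup>2 \<partial>M)"
    by (rule Bochner_Integration.integral_cong) (simp_all add: power2_diff)
  also have "\<dots> = (\<integral>q. (f q)\<^sup>2 \<partial>M) + (- 2 * c) * (\<integral>q. f q \<partial>M) + c\<^sup>2 * mass"
    using f by simp
  also have "\<dots> = (\<integral>q. (f q)\<^sup>2 \<partial>M) - (\<integral>q. f q \<partial>M)\<^sup>2 / mass"
    using w by (simp add: c_def power2_eq_square field_simps)
  finally show ?thesis by simp
qed

text \<open>
  The mean of \<open>h\<close> is bounded by the root of the mean of \<open>h\<^sup>2 = r - u\<^sup>2\<close>, and the mean of \<open>u\<^sup>2\<close> from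
  below by the square of the mean of \<open>u\<close>.
\<close>

lemma altitude_integral_le:
  fixes W R U H :: real
  assumes m: "mass = W / 128" "(\<integral>q. sqradius q \<partial>M) = W / 128 * (R / 4608)" "(\<integral>q. abscissa q \<partial>M) = W / 128 * (U / 4608)"
    and W: "0 < W" and H: "0 \<le> H" "4608 * R - U\<^sup>2 \<le> H\<^sup>2"
  shows "(\<integral>q. altitude q \<partial>M) \<le> W / 128 * (H / 4608)"
proof -
  define w where "w = W / 128"
  have w: "0 < w" using W by (simp add: w_def)
  define h where "h = (\<integral>q. altitude q \<partial>M) / w"
  have hw: "(\<integral>q. altitude q \<partial>M) = w * h" using w by (simp add: h_def)
  have "(w * h)\<^sup>2 / w \<le> w * (R / 4608) - (w * (U / 4608))\<^sup>2 / w"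
    using variance_nonneg[OF integrable_coordinates(3,7)] variance_nonneg[OF integrable_coordinates(2,8)] w
    unfolding altitude_square_integral m hw w_def[symmetric] by simp
  moreover have "(w * a)\<^sup>2 / w = w * a\<^sup>2" for a using w by (simp add: power2_eq_square)
  ultimately have "w * h\<^sup>2 \<le> w * (R / 4608 - (U / 4608)\<^sup>2)" by (simp only: right_diff_distrib)
  then have "h\<^sup>2 \<le> R / 4608 - (U / 4608)\<^sup>2" using w by simp
  also have "\<dots> = (4608 * R - U\<^sup>2) / 4608\<^sup>2" by (simp add: power_divide diff_divide_distrib)
  also have "\<dots> \<le> H\<^sup>2 / 4608\<^sup>2" using H(2) by (intro divide_right_mono) auto
  finally have "h\<^sup>2 \<le> (H / 4608)\<^sup>2" by (simp add: power_divide)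
  then have "h \<le> H / 4608" by (rule power2_le_imp_le) (use H(1) in simp)
  then show ?thesis unfolding hw w_def[symmetric] using w by simp
qed

text \<open>
  If \<open>h\<close> ranges between \<open>a\<close> and \<open>b\<close>, then \<open>(h - a) (b - h) \<ge> 0\<close>, so \<open>(a + b) h \<ge> h\<^sup>2 + a b\<close>: the chord
  of the square root. The mean of \<open>h\<^sup>2 = r - u\<^sup>2\<close> is known exactly.
\<close>

lemma altitude_integral_ge:
  fixes W R V a b L :: real
  assumes m: "mass = W / 128" "(\<integral>q. sqradius q \<partial>M) = W / 128 * (R / 4608)" "(\<integral>q. (abscissa q)\<^sup>2 \<partial>M) = W / 128 * (V / 4608\<^sup>2)"
    and W: "0 < W" and ae: "AE q in M. a / 4608 \<le> altitude q \<and> altitude q \<le> b / 4608"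
    and L: "L * (a + b) \<le> 4608 * R - V + a * b" and ab: "0 < a + b"
  shows "W / 128 * (L / 4608) \<le> (\<integral>q. altitude q \<partial>M)"
proof -
  define w where "w = W / 128"
  have w: "0 < w" using W by (simp add: w_def)
  define h where "h = (\<integral>q. altitude q \<partial>M) / w"
  have hw: "(\<integral>q. altitude q \<partial>M) = w * h" using w by (simp add: h_def)
  have "0 \<le> (\<integral>q. (altitude q - a / 4608) * (b / 4608 - altitude q) \<partial>M)"
    by (rule integral_nonneg_AE, rule AE_mp[OF ae], rule AE_I2) (auto intro: mult_nonneg_nonneg)
  also have "\<dots> = (\<integral>q. ((a + b) / 4608) * altitude q + - ((altitude q)\<^sup>2) + - (a * b / 4608\<^sup>2) \<partial>M)"
    by (rule Bochner_Integration.integral_cong) (simp_all add: power2_eq_square field_simps)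
  also have "\<dots> = ((a + b) / 4608) * (w * h) - (w * (R / 4608) - w * (V / 4608\<^sup>2)) - (a * b / 4608\<^sup>2) * w"
    using integrable_coordinates unfolding hw[symmetric] by (simp add: altitude_square_integral m w_def)
  also have "\<dots> = w / 4608\<^sup>2 * ((a + b) * (4608 * h) - (4608 * R - V + a * b))"
    by (simp add: power2_eq_square field_simps)
  finally have "0 \<le> (a + b) * (4608 * h) - (4608 * R - V + a * b)" using w by (simp add: zero_le_mult_iff)
  then have "L * (a + b) \<le> (4608 * h) * (a + b)" using L by (simp add: mult.commute)
  then have "L / 4608 \<le> h" using ab by (simp add: mult_le_cancel_right_pos)
  then show ?thesis unfolding hw w_def[symmetric] using w by simp
qed

end

text \<open>
  Half-open squares, so that every triangle lies in a cell.
\<close>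

definition cell :: "int \<Rightarrow> int \<Rightarrow> (real \<times> real) set" where
  "cell i j = {q \<in> triangles. i / 8 < fst q \<and> fst q \<le> (i + 1) / 8 \<and> j / 8 < snd q \<and> snd q \<le> (j + 1) / 8}"

lemma cell_subset: "cell i j \<subseteq> triangles"
  by (auto simp: cell_def)

lemma cell_borel: "cell i j \<in> sets borel"
proof -
  have eq: "cell i j = triangles \<inter> {q. i / 8 < fst q} \<inter> {q. fst q \<le> (i + 1) / 8} \<inter> {q. j / 8 < snd q} \<inter> {q. snd q \<le> (j + 1) / 8}"
    by (auto simp: cell_def)
  show ?thesis unfolding eq
    by (intro sets.Int measurable_triangles borel_closed[OF closed_Collect_le] borel_open[OF open_Collect_less] continuous_intros)
qed

lemma triangle_measure_cell: "triangle_measure (shape_measure (cell i j))"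
  by (rule triangle_measure_shape[OF cell_borel cell_subset])

lemma AE_cell: "AE q in shape_measure (cell i j). q \<in> cell i j"
  unfolding shape_measure_def
proof (subst AE_density)
  show "indicator (cell i j) \<in> borel_measurable lborel" unfolding measurable_lborel2 by (rule borel_measurable_indicator[OF cell_borel])
  show "AE q in lborel. 0 < (indicator (cell i j) q :: ennreal) \<longrightarrow> q \<in> cell i j"
    by (rule AE_I2) (auto simp: indicator_def split: if_splits)
qed

lemma monomial_borel: "(\<lambda>q :: real \<times> real. fst q ^ m * snd q ^ n) \<in> borel_measurable borel"
  by (intro borel_measurable_continuous_onI continuous_intros)

lemma integrable_monomial: "triangle_measure M \<Longrightarrow> integrable M (\<lambda>q. fst q ^ m * snd q ^ n)"
proof (rule triangle_measure.integrable_bounded[OF _ monomial_borel, where B = 1])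
  fix q :: "real \<times> real" assume "q \<in> triangles"
  then have "0 \<le> fst q" "fst q \<le> 1" "0 \<le> snd q" "snd q \<le> 1" by (auto simp: triangles_def)
  then show "\<bar>fst q ^ m * snd q ^ n\<bar> \<le> 1" by (simp add: power_le_one mult_le_one)
qed

text \<open>
  Tonelli's theorem computes nonnegative integrals; this transfers the result to the Bochner integral.
\<close>

lemma integral_monomial_eq:
  assumes "(\<integral>\<^sup>+q\<in>cell i j. ennreal (fst q ^ m * snd q ^ n) \<partial>lborel) = ennreal c" "0 \<le> c"
  shows "(\<integral>q. fst q ^ m * snd q ^ n \<partial>shape_measure (cell i j)) = c"
proof -
  interpret triangle_measure "shape_measure (cell i j)" by (rule triangle_measure_cell)
  have "AE q in shape_measure (cell i j). 0 \<le> fst q ^ m * snd q ^ n"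
    by (rule AE_mp[OF AE_triangles], rule AE_I2) (auto simp: triangles_def)
  from nn_integral_eq_integral[OF integrable_monomial[OF triangle_measure_cell] this]
  have "ennreal (\<integral>q. fst q ^ m * snd q ^ n \<partial>shape_measure (cell i j)) = ennreal c"
    using nn_integral_shape_measure[OF cell_borel measurable_compose_rev[OF measurable_ennreal monomial_borel], of i j m n] assms(1) by simp
  moreover have "0 \<le> (\<integral>q. fst q ^ m * snd q ^ n \<partial>shape_measure (cell i j))"
    by (rule integral_nonneg_triangles) (auto simp: triangles_def)
  ultimately show ?thesis using assms(2) by simp
qed

lemma coordinates_by_monomials:
  assumes "triangle_measure M"
  defines "I \<equiv> \<lambda>m n. \<integral>q. fst q ^ m * snd q ^ n \<partial>M"
  shows "measure M (space M) = I 0 0" "(\<integral>q. sqradius q \<partial>M) = (I 2 0 + I 0 2) / 2 - I 0 0 / 4"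
    "(\<integral>q. abscissa q \<partial>M) = (I 2 0 - I 0 2) / 2" "(\<integral>q. (abscissa q)\<^sup>2 \<partial>M) = (I 4 0 - 2 * I 2 2 + I 0 4) / 4"
proof -
  interpret triangle_measure M by fact
  have i: "integrable M (\<lambda>q. fst q ^ m * snd q ^ n)" for m n by (rule integrable_monomial) fact
  have i': "integrable M (\<lambda>q. (fst q)\<^sup>2)" "integrable M (\<lambda>q. (snd q)\<^sup>2)" "integrable M (\<lambda>q. (fst q) ^ 4)" "integrable M (\<lambda>q. (snd q) ^ 4)"
    using i[of 2 0] i[of 0 2] i[of 4 0] i[of 0 4] by simp_all
  show "measure M (space M) = I 0 0" by (simp add: I_def)
  show "(\<integral>q. sqradius q \<partial>M) = (I 2 0 + I 0 2) / 2 - I 0 0 / 4"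
    unfolding sqradius_def[abs_def] I_def using i' by simp
  show "(\<integral>q. abscissa q \<partial>M) = (I 2 0 - I 0 2) / 2"
    unfolding abscissa_def[abs_def] I_def using i' by simp
  have "(\<integral>q. (abscissa q)\<^sup>2 \<partial>M) = (\<integral>q. (fst q ^ 4 * snd q ^ 0 + - 2 * (fst q ^ 2 * snd q ^ 2) + fst q ^ 0 * snd q ^ 4) / 4 \<partial>M)"
    by (rule Bochner_Integration.integral_cong) (simp_all add: abscissa_def power_divide power2_diff flip: power_mult)
  also have "\<dots> = (I 4 0 + - 2 * I 2 2 + I 0 4) / 4"
    unfolding I_def using i by (simp only: integral_divide_zero Bochner_Integration.integral_add Bochner_Integration.integrable_add integrable_mult_right integral_mult_right_zero)
  finally show "(\<integral>q. (abscissa q)\<^sup>2 \<partial>M) = (I 4 0 - 2 * I 2 2 + I 0 4) / 4" by simp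
qed

lemma nn_integral_half_open:
  fixes f :: "real \<Rightarrow> ennreal"
  shows "(\<integral>\<^sup>+x. f x * indicator {a<..b} x \<partial>lborel) = (\<integral>\<^sup>+x\<in>{a..b}. f x \<partial>lborel)"
  by (rule nn_integral_cong_AE, rule AE_mp[OF AE_lborel_singleton[of a]], rule AE_I2) (auto simp: indicator_def)

lemma nn_integral_power:
  assumes "0 \<le> a" "a \<le> b"
  shows "(\<integral>\<^sup>+x\<in>{a..b}. ennreal (x ^ n) \<partial>lborel) = ennreal ((b ^ Suc n - a ^ Suc n) / Suc n)"
proof -
  have "(\<integral>\<^sup>+x\<in>{a..b}. ennreal (x ^ n) \<partial>lborel) = ennreal (b ^ Suc n / Suc n - a ^ Suc n / Suc n)"
  proof (rule nn_integral_FTC_Icc)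
    show "(\<lambda>x::real. x ^ n) \<in> borel_measurable borel" by (intro borel_measurable_continuous_onI continuous_intros)
    show "((\<lambda>x::real. x ^ Suc n / Suc n) has_real_derivative x ^ n) (at x)" for x
      using DERIV_cdivide[OF DERIV_pow[of "Suc n" x], of "Suc n"] by (simp del: power_Suc)
  qed (use assms in auto)
  then show ?thesis by (simp add: diff_divide_distrib)
qed

section \<open>Upper bound by summation over the grid\<close>

text \<open>
  The integral of \<open>x ^ m\<close> over the interval from \<open>i / 8\<close> to \<open>(i + 1) / 8\<close>.
\<close>

definition slab_moment :: "int \<Rightarrow> nat \<Rightarrow> real" where
  "slab_moment i m = (((i + 1) / 8) ^ Suc m - (i / 8) ^ Suc m) / Suc m"

lemma slab_moment_nonneg: "0 \<le> i \<Longrightarrow> 0 \<le> slab_moment i m"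
  unfolding slab_moment_def by (intro divide_nonneg_nonneg) (auto intro!: power_mono simp del: power_Suc)

lemma square_cell_eq:
  assumes "0 \<le> i" "i \<le> 7" "0 \<le> j" "j \<le> 7" "8 \<le> i + j"
  shows "(x, y) \<in> cell i j \<longleftrightarrow> x \<in> {i / 8<..(i + 1) / 8} \<and> y \<in> {j / 8<..(j + 1) / 8}"
proof -
  have r: "real_of_int i \<le> 7" "real_of_int j \<le> 7" "8 \<le> real_of_int i + real_of_int j" using assms by linarith+
  then have "x \<le> 1 \<and> y \<le> 1 \<and> 1 < x + y" if "i / 8 < x" "x \<le> (i + 1) / 8" "j / 8 < y" "y \<le> (j + 1) / 8"
    using that by (simp add: field_simps)
  then show ?thesis by (auto simp: cell_def triangles_def)
qed

lemma measurable_power_ind: "(\<lambda>x :: real. ennreal (x ^ m) * indicator {a<..b} x) \<in> borel_measurable lborel"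
  unfolding measurable_lborel2
  by (intro borel_measurable_times_ennreal measurable_compose_rev[OF measurable_ennreal] borel_measurable_indicator
     borel_measurable_continuous_onI continuous_intros) simp

lemma measurable_monomial_ind: "(\<lambda>q. ennreal (fst q ^ m * snd q ^ n) * indicator (cell i j) q) \<in> borel_measurable borel"
  by (intro borel_measurable_times_ennreal measurable_compose_rev[OF measurable_ennreal] borel_measurable_indicator cell_borel monomial_borel)

lemma square_cell_moment:
  assumes ij: "0 \<le> i" "i \<le> 7" "0 \<le> j" "j \<le> 7" "8 \<le> i + j"
  shows "(\<integral>q. fst q ^ m * snd q ^ n \<partial>shape_measure (cell i j)) = slab_moment i m * slab_moment j n"
proof (rule integral_monomial_eq)
  let ?f = "\<lambda>m i x. ennreal (x ^ m) * indicator {real_of_int i / 8<..(real_of_int i + 1) / 8} (x :: real)"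
  have slab: "(\<integral>\<^sup>+x. ?f m i x \<partial>lborel) = ennreal (slab_moment i m)" if "0 \<le> i" for i m
    unfolding nn_integral_half_open slab_moment_def by (rule nn_integral_power) (use that in simp_all)
  have "(\<integral>\<^sup>+q\<in>cell i j. ennreal (fst q ^ m * snd q ^ n) \<partial>lborel) = (\<integral>\<^sup>+x. \<integral>\<^sup>+y. ennreal (x ^ m * y ^ n) * indicator (cell i j) (x, y) \<partial>lborel \<partial>lborel)"
    using nn_integral_lborel_pair[OF measurable_monomial_ind] by simp
  also have "\<dots> = (\<integral>\<^sup>+x. \<integral>\<^sup>+y. ?f m i x * ?f n j y \<partial>lborel \<partial>lborel)"
  proof (intro nn_integral_cong)
    fix x y :: real
    show "ennreal (x ^ m * y ^ n) * indicator (cell i j) (x, y) = ?f m i x * ?f n j y"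
    proof (cases "(x, y) \<in> cell i j")
      case True
      then have "(x, y) \<in> triangles" using cell_subset by blast
      then have "0 \<le> x" "0 \<le> y" by (auto simp: triangles_def)
      then show ?thesis using True square_cell_eq[OF ij] by (simp add: ennreal_mult)
    next
      case False
      then show ?thesis using square_cell_eq[OF ij, of x y] by (auto simp: indicator_def)
    qed
  qed
  also have "\<dots> = (\<integral>\<^sup>+x. ?f m i x * ennreal (slab_moment j n) \<partial>lborel)"
    unfolding nn_integral_cmult[OF measurable_power_ind] slab[OF ij(3)] ..
  also have "\<dots> = ennreal (slab_moment i m) * ennreal (slab_moment j n)"
    unfolding nn_integral_multc[OF measurable_power_ind] slab[OF ij(1)] ..
  finally show "(\<integral>\<^sup>+q\<in>cell i j. ennreal (fst q ^ m * snd q ^ n) \<partial>lborel) = ennreal (slab_moment i m * slab_moment j n)"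
    using slab_moment_nonneg ij by (simp add: ennreal_mult)
  show "0 \<le> slab_moment i m * slab_moment j n" using slab_moment_nonneg ij by simp
qed

lemma slab_moments:
  "slab_moment i 0 = 1 / 8" "slab_moment i 2 = (3 * real_of_int i ^ 2 + 3 * i + 1) / 1536"
  "slab_moment i 4 = (5 * real_of_int i ^ 4 + 10 * real_of_int i ^ 3 + 10 * real_of_int i ^ 2 + 5 * i + 1) / 163840"
  unfolding slab_moment_def by (simp_all add: field_simps power_divide eval_nat_numeral)

lemma square_cell_moments:
  fixes i j :: int
  assumes ij: "0 \<le> i" "i \<le> 7" "0 \<le> j" "j \<le> 7" "8 \<le> i + j"
  defines "M \<equiv> shape_measure (cell i j)"
  defines "s \<equiv> (2 * real_of_int i + 1)\<^sup>2 + (2 * real_of_int j + 1)\<^sup>2"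
  defines "U \<equiv> 9 * ((2 * real_of_int i + 1)\<^sup>2 - (2 * real_of_int j + 1)\<^sup>2)"
  shows "measure M (space M) = 2 / 128" "(\<integral>q. sqradius q \<partial>M) = 2 / 128 * ((9 * s - 1146) / 4608)"
    "(\<integral>q. abscissa q \<partial>M) = 2 / 128 * (U / 4608)" "(\<integral>q. (abscissa q)\<^sup>2 \<partial>M) = 2 / 128 * ((U\<^sup>2 + 108 * s + 72 / 5) / 4608\<^sup>2)"
  unfolding M_def coordinates_by_monomials[OF triangle_measure_cell] square_cell_moment[OF ij] slab_moments U_def s_def
  by (simp_all add: field_simps eval_nat_numeral)

text \<open>
  In terms of the squares \<open>X = x\<^sup>2\<close> and \<open>Y = y\<^sup>2\<close> the product is
  \<open>2 X Y + 2 X + 2 Y - X\<^sup>2 - Y\<^sup>2 - 1\<close>, which increases in both variables as long as they are at most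
  \<open>1\<close>. So the altitude increases with both sides, and its extreme values over a grid square are at
  two opposite corners.
\<close>

lemma heron_mono:
  fixes x y :: real
  assumes "0 \<le> x" "x \<le> x'" "x' \<le> 1" "0 \<le> y" "y \<le> y'" "y' \<le> 1"
  shows "((x + y)\<^sup>2 - 1) * (1 - (x - y)\<^sup>2) \<le> ((x' + y')\<^sup>2 - 1) * (1 - (x' - y')\<^sup>2)"
proof -
  have one: "((x + y)\<^sup>2 - 1) * (1 - (x - y)\<^sup>2) \<le> ((x' + y)\<^sup>2 - 1) * (1 - (x' - y)\<^sup>2)"
    if x: "0 \<le> x" "x \<le> x'" "x' \<le> 1" for x x' y :: real
  proof -
    have X: "x\<^sup>2 \<le> x'\<^sup>2" "x'\<^sup>2 \<le> 1" using x by (auto intro: power_mono simp: power_le_one)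
    then have "0 \<le> (x'\<^sup>2 - x\<^sup>2) * (2 * y\<^sup>2 + (1 - x\<^sup>2) + (1 - x'\<^sup>2))" by (intro mult_nonneg_nonneg add_nonneg_nonneg) auto
    also have "\<dots> = ((x' + y)\<^sup>2 - 1) * (1 - (x' - y)\<^sup>2) - ((x + y)\<^sup>2 - 1) * (1 - (x - y)\<^sup>2)" by algebra
    finally show ?thesis by simp
  qed
  have "((x + y)\<^sup>2 - 1) * (1 - (x - y)\<^sup>2) \<le> ((x' + y)\<^sup>2 - 1) * (1 - (x' - y)\<^sup>2)" using assms by (intro one)
  also have "\<dots> \<le> ((x' + y')\<^sup>2 - 1) * (1 - (x' - y')\<^sup>2)"
    using one[of y y' x'] assms by (simp add: add.commute power2_commute[of x'])
  finally show ?thesis .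
qed

lemma altitude_in_square_cell:
  fixes i j :: int
  assumes ij: "0 \<le> i" "i \<le> 7" "0 \<le> j" "j \<le> 7" "8 \<le> i + j" and q: "q \<in> cell i j"
  defines "a \<equiv> sqrt_down (1296 * ((i + j)\<^sup>2 - 64) * (64 - (i - j)\<^sup>2))"
  defines "b \<equiv> sqrt_up (1296 * ((i + j + 2)\<^sup>2 - 64) * (64 - (i - j)\<^sup>2))"
  shows "a / 4608 \<le> altitude q" "altitude q \<le> b / 4608"
proof -
  obtain x y where xy: "q = (x, y)" by (cases q)
  have c: "i / 8 \<le> x" "x \<le> (real_of_int i + 1) / 8" "j / 8 \<le> y" "y \<le> (real_of_int j + 1) / 8" using q square_cell_eq[OF ij, of x y] by (auto simp: xy)
  have r: "0 \<le> real_of_int i / 8" "(real_of_int i + 1) / 8 \<le> 1" "0 \<le> real_of_int j / 8" "(real_of_int j + 1) / 8 \<le> 1"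
    using ij by (auto simp: field_simps)
  have s: "4 * (altitude q)\<^sup>2 = ((x + y)\<^sup>2 - 1) * (1 - (x - y)\<^sup>2)"
    using altitude_square(1)[of q] q cell_subset[of i j] by (auto simp: xy)
  have nonneg: "0 \<le> altitude q" using triangles_bounds(2) q cell_subset by blast
  have corner: "((u / 8 + v / 8)\<^sup>2 - 1) * (1 - (u / 8 - v / 8)\<^sup>2) = ((u + v)\<^sup>2 - 64) * (64 - (u - v)\<^sup>2) / 4096" for u v :: real
    by (simp add: field_simps power2_eq_square)
  have "((real_of_int i + real_of_int j)\<^sup>2 - 64) * (64 - (real_of_int i - real_of_int j)\<^sup>2) / 4096 \<le> 4 * (altitude q)\<^sup>2"
    unfolding s corner[symmetric] using c r by - (rule heron_mono, linarith+)
  moreover have h2: "(4608 * altitude q)\<^sup>2 = 21233664 * (altitude q)\<^sup>2" by (simp add: power_mult_distrib)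
  moreover have "real_of_int (1296 * ((i + j)\<^sup>2 - 64) * (64 - (i - j)\<^sup>2)) = 1296 * (((real_of_int i + real_of_int j)\<^sup>2 - 64) * (64 - (real_of_int i - real_of_int j)\<^sup>2))"
    by (simp only: of_int_mult of_int_diff of_int_power of_int_add of_int_numeral mult.assoc)
  ultimately have lo: "real_of_int (1296 * ((i + j)\<^sup>2 - 64) * (64 - (i - j)\<^sup>2)) \<le> (4608 * altitude q)\<^sup>2"
    by linarith
  have "4 * (altitude q)\<^sup>2 \<le> (((real_of_int i + 1) + (real_of_int j + 1))\<^sup>2 - 64) * (64 - ((real_of_int i + 1) - (real_of_int j + 1))\<^sup>2) / 4096"
    unfolding s corner[symmetric] using c r by - (rule heron_mono, linarith+)
  moreover have "(real_of_int i + 1) + (real_of_int j + 1) = real_of_int i + real_of_int j + 2" "(real_of_int i + 1) - (real_of_int j + 1) = real_of_int i - real_of_int j" by simp_all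
  ultimately have "4 * (altitude q)\<^sup>2 \<le> ((real_of_int i + real_of_int j + 2)\<^sup>2 - 64) * (64 - (real_of_int i - real_of_int j)\<^sup>2) / 4096" by (simp only:)
  moreover have "real_of_int (1296 * ((i + j + 2)\<^sup>2 - 64) * (64 - (i - j)\<^sup>2)) = 1296 * (((real_of_int i + real_of_int j + 2)\<^sup>2 - 64) * (64 - (real_of_int i - real_of_int j)\<^sup>2))"
    by (simp only: of_int_mult of_int_diff of_int_power of_int_add of_int_numeral mult.assoc)
  ultimately have hi: "(4608 * altitude q)\<^sup>2 \<le> real_of_int (1296 * ((i + j + 2)\<^sup>2 - 64) * (64 - (i - j)\<^sup>2))"
    unfolding h2 by linarith
  have "8\<^sup>2 \<le> (i + j)\<^sup>2" using ij by (intro power_mono) auto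
  moreover have "\<bar>i - j\<bar>\<^sup>2 \<le> 8\<^sup>2" using ij by (intro power_mono) auto
  ultimately have n: "0 \<le> 1296 * ((i + j)\<^sup>2 - 64) * (64 - (i - j)\<^sup>2)" by (intro mult_nonneg_nonneg) auto
  have "real_of_int (a\<^sup>2) \<le> (4608 * altitude q)\<^sup>2"
    by (rule order_trans[OF _ lo]) (use sqrt_down(2)[OF n] in \<open>simp only: of_int_le_iff a_def\<close>)
  then have "real_of_int a \<le> 4608 * altitude q" unfolding of_int_power by (rule power2_le_imp_le) (use nonneg in simp)
  then show "a / 4608 \<le> altitude q" by simp
  have "(4608 * altitude q)\<^sup>2 \<le> real_of_int (b\<^sup>2)"
    by (rule order_trans[OF hi]) (use sqrt_up(2) in \<open>simp only: of_int_le_iff b_def\<close>)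
  moreover have "0 \<le> real_of_int b" using sqrt_up(1) by (simp add: b_def less_imp_le)
  ultimately have "4608 * altitude q \<le> real_of_int b" unfolding of_int_power by (rule power2_le_imp_le)
  then show "altitude q \<le> b / 4608" by simp
qed

lemma diagonal_cell_eq:
  assumes "0 \<le> i" "i \<le> 7"
  shows "(x, y) \<in> cell i (7 - i) \<longleftrightarrow> x \<in> {i / 8<..(i + 1) / 8} \<and> y \<in> {1 - x<..1 - i / 8}"
proof -
  have r: "0 \<le> real_of_int i" "real_of_int i \<le> 7" using assms by linarith+
  have e: "real_of_int (7 - i + 1) / 8 = 1 - i / 8" "real_of_int (7 - i) / 8 = 1 - (i + 1) / 8" by (simp_all add: field_simps)
  have "x \<le> 1" if "x \<le> (i + 1) / 8" using that r by simp
  moreover have "y \<le> 1" if "y \<le> 1 - i / 8" using that r by simp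
  moreover have "1 - (i + 1) / 8 < y" if "1 - x < y" "x \<le> (i + 1) / 8" using that by linarith
  ultimately show ?thesis unfolding cell_def triangles_def mem_Collect_eq fst_conv snd_conv e greaterThanAtMost_iff by (auto simp del: of_int_add)
qed

text \<open>
  Integration over \<open>y\<close> comes first and is elementary; the remaining integrand is a polynomial in \<open>x\<close>,
  for which an antiderivative \<open>F\<close> is supplied.
\<close>

lemma diagonal_cell_moment:
  assumes i: "0 \<le> i" "i \<le> 7"
    and F: "\<And>x. (F has_real_derivative x ^ m * (((1 - i / 8) ^ Suc n - (1 - x) ^ Suc n) / Suc n)) (at x)"
  shows "(\<integral>q. fst q ^ m * snd q ^ n \<partial>shape_measure (cell i (7 - i))) = F ((i + 1) / 8) - F (i / 8)"
proof -
  let ?g = "\<lambda>x. x ^ m * (((1 - i / 8) ^ Suc n - (1 - x) ^ Suc n) / Suc n)"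
  have r: "0 \<le> real_of_int i" "real_of_int i \<le> 7" using i by linarith+
  have g: "0 \<le> ?g x" if "i / 8 \<le> x" "x \<le> (i + 1) / 8" for x
  proof -
    have "x \<le> 1" "0 \<le> x" using that r by (auto simp: field_simps)
    then show ?thesis using that by (intro mult_nonneg_nonneg divide_nonneg_nonneg) (auto intro!: power_mono simp del: power_Suc)
  qed
  have 1: "?g \<in> borel_measurable borel" by (intro borel_measurable_continuous_onI continuous_intros) simp
  have ftc: "(\<integral>\<^sup>+x\<in>{i / 8..(i + 1) / 8}. ennreal (?g x) \<partial>lborel) = ennreal (F ((i + 1) / 8) - F (i / 8))"
    using nn_integral_FTC_Icc[OF 1, of "i / 8" "(i + 1) / 8" F] F g by (simp add: divide_right_mono del: power_Suc of_nat_Suc)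
  have "(\<integral>\<^sup>+q\<in>cell i (7 - i). ennreal (fst q ^ m * snd q ^ n) \<partial>lborel) = (\<integral>\<^sup>+x. \<integral>\<^sup>+y. ennreal (x ^ m * y ^ n) * indicator (cell i (7 - i)) (x, y) \<partial>lborel \<partial>lborel)"
    using nn_integral_lborel_pair[OF measurable_monomial_ind] by simp
  also have "\<dots> = (\<integral>\<^sup>+x. ennreal (?g x) * indicator {i / 8<..(i + 1) / 8} x \<partial>lborel)"
  proof (rule nn_integral_cong)
    fix x :: real
    show "(\<integral>\<^sup>+y. ennreal (x ^ m * y ^ n) * indicator (cell i (7 - i)) (x, y) \<partial>lborel) = ennreal (?g x) * indicator {i / 8<..(i + 1) / 8} x"
    proof (cases "x \<in> {i / 8<..(i + 1) / 8}")
      case False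
      then have "(x, y) \<notin> cell i (7 - i)" for y using diagonal_cell_eq[OF i] by blast
      then show ?thesis using False by (simp add: indicator_def)
    next
      case True
      then have x: "0 \<le> x" "x \<le> 1" "i / 8 \<le> x" using r by (auto simp: field_simps)
      have "(\<integral>\<^sup>+y. ennreal (x ^ m * y ^ n) * indicator (cell i (7 - i)) (x, y) \<partial>lborel) = (\<integral>\<^sup>+y. ennreal (x ^ m) * (ennreal (y ^ n) * indicator {1 - x<..1 - i / 8} y) \<partial>lborel)"
      proof (rule nn_integral_cong)
        fix y
        show "ennreal (x ^ m * y ^ n) * indicator (cell i (7 - i)) (x, y) = ennreal (x ^ m) * (ennreal (y ^ n) * indicator {1 - x<..1 - i / 8} y)"
          using diagonal_cell_eq[OF i, of x y] True x by (auto simp: indicator_def ennreal_mult)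
      qed
      also have "\<dots> = ennreal (x ^ m) * ennreal (((1 - i / 8) ^ Suc n - (1 - x) ^ Suc n) / Suc n)"
        unfolding nn_integral_cmult[OF measurable_power_ind] nn_integral_half_open
        by (subst nn_integral_power) (use x in simp_all)
      also have "\<dots> = ennreal (?g x)" using x by (intro ennreal_mult'[symmetric]) simp
      finally show ?thesis using True by simp
    qed
  qed
  also have "\<dots> = ennreal (F ((i + 1) / 8) - F (i / 8))" unfolding nn_integral_half_open by (rule ftc)
  finally have "(\<integral>\<^sup>+q\<in>cell i (7 - i). ennreal (fst q ^ m * snd q ^ n) \<partial>lborel) = ennreal (F ((real_of_int i + 1) / 8) - F (i / 8))" by simp
  then show ?thesis
  proof (rule integral_monomial_eq)
    have "F (i / 8) \<le> F ((real_of_int i + 1) / 8)"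
      by (rule DERIV_nonneg_imp_nondecreasing) (use F g in \<open>auto simp: divide_right_mono\<close>)
    then show "0 \<le> F ((real_of_int i + 1) / 8) - F (i / 8)" by simp
  qed
qed

lemma diagonal_cell_moments:
  fixes i :: int
  assumes i: "0 \<le> i" "i \<le> 7"
  defines "M \<equiv> shape_measure (cell i (7 - i))" and "j \<equiv> 7 - real_of_int i"
  shows "measure M (space M) = 1 / 128"
    "(\<integral>q. sqradius q \<partial>M) = 1 / 128 * ((4 * ((3 * real_of_int i + 2)\<^sup>2 + (3 * j + 2)\<^sup>2) - 1148) / 4608)"
    "(\<integral>q. abscissa q \<partial>M) = 1 / 128 * (4 * ((3 * real_of_int i + 2)\<^sup>2 - (3 * j + 2)\<^sup>2) / 4608)"
proof -
  have 00: "(\<integral>q. fst q ^ 0 * snd q ^ 0 \<partial>M) = 1 / 128"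
  proof -
    have "((\<lambda>x. x\<^sup>2 / 2 - i / 8 * x) has_real_derivative x ^ 0 * (((1 - i / 8) ^ Suc 0 - (1 - x) ^ Suc 0) / Suc 0)) (at x)" for x :: real
      by (auto intro!: derivative_eq_intros)
    from diagonal_cell_moment[OF i this] show ?thesis unfolding M_def by (simp add: field_simps power2_eq_square)
  qed
  have 20: "(\<integral>q. fst q ^ 2 * snd q ^ 0 \<partial>M) = (6 * (real_of_int i)\<^sup>2 + 8 * i + 3) / 49152"
  proof -
    have "((\<lambda>x. x ^ 4 / 4 - i / 8 * x ^ 3 / 3) has_real_derivative x ^ 2 * (((1 - i / 8) ^ Suc 0 - (1 - x) ^ Suc 0) / Suc 0)) (at x)" for x :: real
      by (auto intro!: derivative_eq_intros simp: field_simps eval_nat_numeral)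
    from diagonal_cell_moment[OF i this] show ?thesis unfolding M_def by (simp add: field_simps eval_nat_numeral)
  qed
  have 02: "(\<integral>q. fst q ^ 0 * snd q ^ 2 \<partial>M) = (6 * j\<^sup>2 + 8 * j + 3) / 49152"
  proof -
    have "((\<lambda>x. ((1 - i / 8) ^ 3 * x + (1 - x) ^ 4 / 4) / 3) has_real_derivative x ^ 0 * (((1 - i / 8) ^ Suc 2 - (1 - x) ^ Suc 2) / Suc 2)) (at x)" for x :: real
      by (auto intro!: derivative_eq_intros simp: field_simps eval_nat_numeral)
    from diagonal_cell_moment[OF i this] show ?thesis unfolding M_def j_def by (simp add: field_simps eval_nat_numeral)
  qed
  have M: "triangle_measure M" unfolding M_def by (rule triangle_measure_cell)
  show "measure M (space M) = 1 / 128"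
    "(\<integral>q. sqradius q \<partial>M) = 1 / 128 * ((4 * ((3 * real_of_int i + 2)\<^sup>2 + (3 * j + 2)\<^sup>2) - 1148) / 4608)"
    "(\<integral>q. abscissa q \<partial>M) = 1 / 128 * (4 * ((3 * real_of_int i + 2)\<^sup>2 - (3 * j + 2)\<^sup>2) / 4608)"
    unfolding coordinates_by_monomials[OF M] 00 20 02 by (simp_all add: field_simps power2_eq_square)
qed

lemma altitude_integral_le_sqrt_up:
  fixes W R U :: int
  assumes "triangle_measure M" "measure M (space M) = W / 128"
    "(\<integral>q. sqradius q \<partial>M) = W / 128 * (R / 4608)" "(\<integral>q. abscissa q \<partial>M) = W / 128 * (U / 4608)" "0 < W"
  shows "(\<integral>q. altitude q \<partial>M) \<le> W / 128 * (sqrt_up (4608 * R - U\<^sup>2) / 4608)"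
proof (rule triangle_measure.altitude_integral_le[OF assms(1-4)])
  let ?n = "4608 * R - U\<^sup>2"
  show "(0 :: real) < W" using assms(5) by simp
  show "(0 :: real) \<le> sqrt_up ?n" using sqrt_up(1)[of ?n] by simp
  have "real_of_int ?n \<le> real_of_int ((sqrt_up ?n)\<^sup>2)" using sqrt_up(2)[of ?n] by (simp only: of_int_le_iff)
  then show "4608 * real_of_int R - (real_of_int U)\<^sup>2 \<le> (real_of_int (sqrt_up ?n))\<^sup>2" by simp
qed

lemma cell_ok_diagonal:
  assumes "0 \<le> i" "i \<le> 7" shows "cell_ok (shape_measure (cell i (7 - i))) (cell_data i (7 - i))"
proof -
  let ?M = "shape_measure (cell i (7 - i))"
  define U where "U = 4 * ((3 * i + 2)\<^sup>2 - (3 * (7 - i) + 2)\<^sup>2)"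
  define R where "R = 4 * ((3 * i + 2)\<^sup>2 + (3 * (7 - i) + 2)\<^sup>2) - 1148"
  have d: "cell_data i (7 - i) = (1, R, U, 0, sqrt_up (4608 * R - U\<^sup>2))"
    unfolding cell_data_def Let_def U_def R_def by simp
  have m: "measure ?M (space ?M) = real_of_int 1 / 128" "(\<integral>q. sqradius q \<partial>?M) = real_of_int 1 / 128 * (R / 4608)"
    "(\<integral>q. abscissa q \<partial>?M) = real_of_int 1 / 128 * (U / 4608)"
    unfolding diagonal_cell_moments[OF assms] R_def U_def by simp_all
  have "0 \<le> (\<integral>q. altitude q \<partial>?M)"
    using triangle_measure.integral_nonneg_triangles[OF triangle_measure_cell] triangles_bounds(2) by blast
  then show ?thesis
    unfolding cell_ok_def d prod.case
    using triangle_measure_cell m altitude_integral_le_sqrt_up[OF triangle_measure_cell m] sqrt_up(1)[of "4608 * R - U\<^sup>2"]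
    by simp
qed

lemma cell_ok_square:
  assumes ij: "0 \<le> i" "i \<le> 7" "0 \<le> j" "j \<le> 7" "8 \<le> i + j"
  shows "cell_ok (shape_measure (cell i j)) (cell_data i j)"
proof -
  let ?M = "shape_measure (cell i j)"
  define s where "s = (2 * i + 1)\<^sup>2 + (2 * j + 1)\<^sup>2"
  define U where "U = 9 * ((2 * i + 1)\<^sup>2 - (2 * j + 1)\<^sup>2)"
  define R where "R = 9 * s - 1146"
  define a where "a = sqrt_down (1296 * ((i + j)\<^sup>2 - 64) * (64 - (i - j)\<^sup>2))"
  define b where "b = sqrt_up (1296 * ((i + j + 2)\<^sup>2 - 64) * (64 - (i - j)\<^sup>2))"
  define N where "N = 4608 * R - U\<^sup>2 - 108 * s - 15 + a * b"
  define L where "L = N div (a + b)"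
  have d: "cell_data i j = (2, R, U, L, sqrt_up (4608 * R - U\<^sup>2))"
    using ij(5) unfolding cell_data_def Let_def L_def N_def a_def b_def R_def U_def s_def by simp
  have m: "measure ?M (space ?M) = real_of_int 2 / 128" "(\<integral>q. sqradius q \<partial>?M) = real_of_int 2 / 128 * (R / 4608)"
    "(\<integral>q. abscissa q \<partial>?M) = real_of_int 2 / 128 * (U / 4608)"
    unfolding square_cell_moments[OF ij] R_def s_def U_def by simp_all
  have v: "(\<integral>q. (abscissa q)\<^sup>2 \<partial>?M) = real_of_int 2 / 128 * (((real_of_int U)\<^sup>2 + 108 * real_of_int s + 72 / 5) / 4608\<^sup>2)"
    unfolding square_cell_moments[OF ij] s_def U_def by simp
  have "8\<^sup>2 \<le> (i + j)\<^sup>2" using ij by (intro power_mono) auto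
  moreover have "\<bar>i - j\<bar>\<^sup>2 \<le> 8\<^sup>2" using ij by (intro power_mono) auto
  ultimately have "0 \<le> a" unfolding a_def by (intro sqrt_down(1) mult_nonneg_nonneg) auto
  then have ab: "0 < a + b" using sqrt_up(1) by (simp add: b_def add_nonneg_pos)
  have "L * (a + b) \<le> N" unfolding L_def using ab by (metis div_mult_mod_eq le_add_same_cancel1 pos_mod_sign)
  then have "real_of_int (L * (a + b)) \<le> real_of_int N" by (simp only: of_int_le_iff)
  then have LN: "real_of_int L * (real_of_int a + real_of_int b) \<le> 4608 * real_of_int R - ((real_of_int U)\<^sup>2 + 108 * real_of_int s + 72 / 5) + real_of_int a * b"
    unfolding N_def by simp
  have ae: "AE q in ?M. a / 4608 \<le> altitude q \<and> altitude q \<le> b / 4608"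
    by (rule AE_mp[OF AE_cell], rule AE_I2) (use altitude_in_square_cell[OF ij] in \<open>simp add: a_def b_def\<close>)
  have "real_of_int 2 / 128 * (L / 4608) \<le> (\<integral>q. altitude q \<partial>?M)"
    by (rule triangle_measure.altitude_integral_ge[OF triangle_measure_cell m(1,2) v _ ae LN]) (use ab in \<open>simp_all flip: of_int_add\<close>)
  then show ?thesis
    unfolding cell_ok_def d prod.case
    using triangle_measure_cell m altitude_integral_le_sqrt_up[OF triangle_measure_cell m] sqrt_up(1)[of "4608 * R - U\<^sup>2"]
    by simp
qed

lemma set_cell_index: "set cell_index = {(i, j). 0 \<le> i \<and> i \<le> 7 \<and> j \<le> 7 \<and> 7 \<le> i + j}"
  unfolding cell_index_def by (auto simp: image_iff)

lemma cell_ok_index: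
  assumes "(i, j) \<in> set cell_index" shows "cell_ok (shape_measure (cell i j)) (cell_data i j)"
proof (cases "i + j = 7")
  case True
  then have "j = 7 - i" by simp
  then show ?thesis using assms cell_ok_diagonal by (simp add: set_cell_index)
next
  case False
  then show ?thesis using assms by (intro cell_ok_square) (auto simp: set_cell_index)
qed

text \<open>
  The cell is found by rounding \<open>8 x\<close> and \<open>8 y\<close> up; \<open>x + y > 1\<close> forces the indices to satisfy
  \<open>i + j > 6\<close>.
\<close>

lemma triangles_covered:
  assumes "q \<in> triangles" shows "\<exists>(i, j) \<in> set cell_index. q \<in> cell i j"
proof -
  obtain x y where q: "q = (x, y)" by (cases q)
  have xy: "x \<le> 1" "y \<le> 1" "1 < x + y" using assms by (auto simp: triangles_def q)
  define i j where "i = \<lceil>8 * x\<rceil> - 1" and "j = \<lceil>8 * y\<rceil> - 1"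
  have i: "i < 8 * x" "8 * x \<le> i + 1" and j: "j < 8 * y" "8 * y \<le> j + 1" unfolding i_def j_def by linarith+
  have "-1 < real_of_int i" "real_of_int i < 8" "real_of_int j < 8" "6 < real_of_int i + real_of_int j" using i j xy by linarith+
  then have "(i, j) \<in> set cell_index" unfolding set_cell_index by simp
  moreover have "q \<in> cell i j" using i j assms unfolding cell_def q by (simp add: field_simps)
  ultimately show ?thesis by blast
qed

lemma nn_integral_triangles_le_cells:
  assumes f: "f \<in> borel_measurable borel"
  shows "(\<integral>\<^sup>+q. f q \<partial>all_triangles) \<le> (\<Sum>p\<in>set cell_index. \<integral>\<^sup>+q. f q \<partial>shape_measure (cell (fst p) (snd p)))"
proof -
  have "(\<integral>\<^sup>+q. f q \<partial>all_triangles) = (\<integral>\<^sup>+q\<in>triangles. f q \<partial>lborel)"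
    by (rule nn_integral_shape_measure[OF measurable_triangles f])
  also have "\<dots> \<le> (\<integral>\<^sup>+q. (\<Sum>p\<in>set cell_index. f q * indicator (cell (fst p) (snd p)) q) \<partial>lborel)"
  proof (rule nn_integral_mono)
    fix q :: "real \<times> real"
    show "f q * indicator triangles q \<le> (\<Sum>p\<in>set cell_index. f q * indicator (cell (fst p) (snd p)) q)"
    proof (cases "q \<in> triangles")
      case True
      then obtain p where p: "p \<in> set cell_index" "q \<in> cell (fst p) (snd p)" using triangles_covered by fastforce
      have "f q * indicator triangles q = f q * indicator (cell (fst p) (snd p)) q" using True p(2) by simp
      also have "\<dots> \<le> (\<Sum>p\<in>set cell_index. f q * indicator (cell (fst p) (snd p)) q)" by (rule member_le_sum[OF p(1)]) simp_all
      finally show ?thesis .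
    qed simp
  qed
  also have "\<dots> = (\<Sum>p\<in>set cell_index. \<integral>\<^sup>+q\<in>cell (fst p) (snd p). f q \<partial>lborel)"
    by (rule nn_integral_sum, unfold measurable_lborel2) (intro borel_measurable_times_ennreal f borel_measurable_indicator cell_borel)
  also have "\<dots> = (\<Sum>p\<in>set cell_index. \<integral>\<^sup>+q. f q \<partial>shape_measure (cell (fst p) (snd p)))"
    by (intro sum.cong refl nn_integral_shape_measure[symmetric] cell_borel f)
  finally show ?thesis .
qed

lemma pair_bounds_sum:
  "(\<Sum>p\<in>set cell_index. \<Sum>p'\<in>set cell_index. pair_bound (cell_data (fst p) (snd p)) (cell_data (fst p') (snd p'))) \<le> 8235744"
proof -
  have d: "distinct cell_index" by code_simp
  have s: "(\<Sum>p\<in>set cell_index. F (cell_data (fst p) (snd p))) = sum_list (map F (cells1 @ cells2 @ cells3 @ cells4))" for F :: "_ \<Rightarrow> int"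
    unfolding cells_eval[symmetric] sum_list_distinct_conv_sum_set[OF d, symmetric] map_map by (simp add: comp_def split_beta)
  have "sum_list (map F (cells1 @ cells2 @ cells3 @ cells4)) = sum_list (map F cells1) + sum_list (map F cells2) + sum_list (map F cells3) + sum_list (map F cells4)"
    for F :: "_ \<Rightarrow> int" by simp
  note split = this
  define S where "S p = sum_list (map (pair_bound p) (cells1 @ cells2 @ cells3 @ cells4))" for p
  have "(\<Sum>p\<in>set cell_index. \<Sum>p'\<in>set cell_index. pair_bound (cell_data (fst p) (snd p)) (cell_data (fst p') (snd p')))
      = (\<Sum>p\<in>set cell_index. S (cell_data (fst p) (snd p)))"
    unfolding S_def by (intro sum.cong refl s)
  also have "\<dots> = sum_list (map S (cells1 @ cells2 @ cells3 @ cells4))" by (rule s)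
  finally show ?thesis using split[of S] pair_bounds_1[folded S_def] pair_bounds_2[folded S_def] pair_bounds_3[folded S_def] pair_bounds_4[folded S_def]
    by linarith
qed

lemma flap_volume_le: "flap_volume {0..1} \<le> ennreal (111 / 1000)"
proof -
  let ?I = "set cell_index"
  let ?M = "\<lambda>p. shape_measure (cell (fst p) (snd p))"
  let ?d = "\<lambda>p. cell_data (fst p) (snd p)"
  have ok: "cell_ok (?M p) (?d p)" if "p \<in> ?I" for p using cell_ok_index[of "fst p" "snd p"] that by simp
  have inner: "(\<lambda>q. \<integral>\<^sup>+q'. ennreal (gap q q') \<partial>?M p) \<in> borel_measurable borel" for p
    by (rule measurable_inner_gap[OF triangle_measure_cell])
  have "flap_volume {0..1} = (\<integral>\<^sup>+q. \<integral>\<^sup>+q'. ennreal (gap q q') \<partial>all_triangles \<partial>all_triangles)"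
    by (rule flap_volume_eq_double_integral)
  also have "\<dots> \<le> (\<integral>\<^sup>+q. (\<Sum>p'\<in>?I. \<integral>\<^sup>+q'. ennreal (gap q q') \<partial>?M p') \<partial>all_triangles)"
    by (intro nn_integral_mono nn_integral_triangles_le_cells measurable_compose_rev[OF measurable_ennreal] measurable_gap_right)
  also have "\<dots> \<le> (\<Sum>p\<in>?I. \<integral>\<^sup>+q. (\<Sum>p'\<in>?I. \<integral>\<^sup>+q'. ennreal (gap q q') \<partial>?M p') \<partial>?M p)"
    by (intro nn_integral_triangles_le_cells borel_measurable_sum inner)
  also have "\<dots> = (\<Sum>p\<in>?I. \<Sum>p'\<in>?I. \<integral>\<^sup>+q. \<integral>\<^sup>+q'. ennreal (gap q q') \<partial>?M p' \<partial>?M p)"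
  proof (intro sum.cong refl nn_integral_sum)
    fix p p' :: "int \<times> int"
    have "sets (?M p) = sets borel" by (simp add: shape_measure_def)
    then show "(\<lambda>q. \<integral>\<^sup>+q'. ennreal (gap q q') \<partial>?M p') \<in> borel_measurable (?M p)"
      using inner[of p'] by (simp cong: measurable_cong_sets)
  qed
  also have "\<dots> \<le> (\<Sum>p\<in>?I. \<Sum>p'\<in>?I. ennreal (pair_bound (?d p) (?d p') / (4608 * 16384)))"
    by (intro sum_mono cell_pair_bound(1) ok)
  also have "\<dots> = ennreal (\<Sum>p\<in>?I. \<Sum>p'\<in>?I. pair_bound (?d p) (?d p') / (4608 * 16384))"
  proof -
    have "0 \<le> real_of_int (pair_bound (?d p) (?d p')) / (4608 * 16384)" if "p \<in> ?I" "p' \<in> ?I" for p p'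
      using cell_pair_bound(2)[OF ok[OF that(1)] ok[OF that(2)]] by simp
    then show ?thesis by (simp add: sum_ennreal sum_nonneg)
  qed
  also have "(\<Sum>p\<in>?I. \<Sum>p'\<in>?I. real_of_int (pair_bound (?d p) (?d p')) / (4608 * 16384)) =
      real_of_int (\<Sum>p\<in>?I. \<Sum>p'\<in>?I. pair_bound (?d p) (?d p')) / (4608 * 16384)"
    by (simp add: sum_divide_distrib)
  also have "ennreal \<dots> \<le> ennreal (111 / 1000)"
  proof (rule ennreal_leI)
    have "real_of_int (\<Sum>p\<in>?I. \<Sum>p'\<in>?I. pair_bound (?d p) (?d p')) \<le> real_of_int 8235744"
      using pair_bounds_sum by (simp only: of_int_le_iff)
    then show "real_of_int (\<Sum>p\<in>?I. \<Sum>p'\<in>?I. pair_bound (?d p) (?d p')) / (4608 * 16384) \<le> 111 / 1000" by simp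
  qed
  finally show ?thesis .
qed

section \<open>The probability of a tetrahedron\<close>

theorem theorem2:
  fixes M :: "'a measure" and \<Delta> :: "'a \<Rightarrow> real ^ 4 ^ 4"
  assumes "prob_space M"
    and symmetric: "\<And>\<omega>. \<omega> \<in> space M \<Longrightarrow> transpose (\<Delta> \<omega>) = \<Delta> \<omega>"
    and zero_diagonal: "\<And>\<omega> i. \<omega> \<in> space M \<Longrightarrow> \<Delta> \<omega> $ i $ i = 0"
    and independent: "prob_space.indep_vars M (\<lambda>_. borel) (\<lambda>(i, j) \<omega>. \<Delta> \<omega> $ i $ j) {(i, j). i < j}"
    and uniform: "\<And>i j. i < j \<Longrightarrow>
      distr M borel (\<lambda>\<omega>. \<Delta> \<omega> $ i $ j) = uniform_measure lborel {0..1}"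
  shows "0.090 \<le> measure M {\<omega> \<in> space M. tetrahedron_distance_matrix (\<Delta> \<omega>)} \<and>
         measure M {\<omega> \<in> space M. tetrahedron_distance_matrix (\<Delta> \<omega>)} \<le> 0.111"
proof -
  interpret random_edge_lengths M \<Delta> by (rule random_edge_lengthsI[OF assms])
  let ?P = "prob {\<omega> \<in> space M. tetrahedron_distance_matrix (\<Delta> \<omega>)}"
  have P: "ennreal ?P = flap_volume {0..1}" using emeasure_tetrahedron by (simp add: emeasure_eq_measure)
  have "90 / 1000 \<le> ?P" using flap_volume_ge unfolding P[symmetric] by (simp add: ennreal_le_iff)
  moreover have "?P \<le> 111 / 1000" using flap_volume_le unfolding P[symmetric] by (simp add: ennreal_le_iff)
  ultimately show ?thesis by simp
qed

end
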